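(* Let $\tilde v,\tilde w$ be signed involutions of size $n$ with $\tilde v\in\overline{\mathfrak B_{\tilde w}}$ and $\operatorname{cd}_{\tilde v}=\operatorname{cd}_{\tilde w}-1$, let $(i,j)$ be the associated suitable rise of $v$, $D=\{i,j,v(i),v(j)\}$, $\tilde x=\tilde v|_D$ and $\tilde u=\tilde w|_D$. Then $$o(\tilde v,\tilde w)=o(\tilde x,\tilde u)\cdot\operatorname{sign}(\rho_{D,\tilde v})\cdot\operatorname{sign}(\rho_{D,\tilde w}).$$
   Context: A signed involution of size $n$ is a signed permutation matrix $\tilde w$ with $\tilde w^2=1$; $w$ is the underlying permutation. $B^+$ is the group of real invertible upper triangular $n\times n$ matrices with positive diagonal. With $k$ determined by $\operatorname{Tr}\tilde w=n-2k$, let $G_k=\{g\in O(n):g^2=1,\operatorname{Tr}g=n-2k\}$ and $\mathfrak B_{\tilde w}=G_k\cap B^+\tilde wB^+$; these sets are the open cells of a CW structure on $G_k$, and $\operatorname{cd}_{\tilde w}=\dim\mathfrak B_{\tilde w}$ is the number of classes of inversions of $w$ ($i<j$, $w(i)>w(j)$) under $(i,j)\sim(w(j),w(i))$. Rises. A rise of an involution $v$ is $(i,j)$ with $i<j$, $v(i)<v(j)$; it is free if no $k$ with $i<k<j$ has $v(i)<v(k)<v(j)$. An index $i$ has type $d,f,e$ if $v(i)<i$, $v(i)=i$, $v(i)>i$ respectively; a rise is suitable if it is free and of type $f\!f,fe,ef,ee$ or $ed$; an $ee$-rise is crossing if $i<v(i)<j<v(j)$, non-crossing if $i<j<v(i)<v(j)$.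 Let $\mathrm{co}_{(i,j)}(v)$ be the permutation (cycle notation) $(i,j)$ for $f\!f$; $(i,j,v(j))$ for $fe$; $(i,j,v(i))$ for $ef$; $(i,j)(v(i),v(j))$ for $ee$ non-crossing and for $ed$; $(i,j,v(j),v(i))$ for $ee$ crossing. Under the hypotheses there is a unique suitable rise $(i,j)$ of $v$ with $w=v\cdot\mathrm{co}_{(i,j)}(v)$; this is the associated rise. Then $D$ is invariant under $v$ and $w$, $\tilde v$ and $\tilde w$ agree on $e_k$ for $k\in D^c=\{1,\dots,n\}\setminus D$, and the restrictions $\tilde x,\tilde u$ to the span of $e_k$, $k\in D$, are regarded as signed involutions of size $|D|$ through the order preserving bijection $D\cong\{1,\dots,|D|\}$. Definition of $o$. Let $I_{\tilde v}=\{i: i<v(i)\}\cup\{i: v(i)=i,\ \tilde v(e_i)=-e_i\}$, so that $e_i-\tilde v(e_i)$, $i\in I_{\tilde v}$, is a basis of the $(-1)$-eigenspace $E^-_{\tilde v}$; in increasing order of $i$ it gives the preferred orientation $\tilde v^+$, the opposite one being $\tilde v^-$. For $\tilde v,\tilde w$ as in the claim choose a continuous path $g:[0,1]\to G_k$ with $g(0)=\tilde w$, $g(1)=\tilde v$, $g(t)\in\mathfrak B_{\tilde w}$ for $t<1$, and transport $\tilde w^+$ continuously along the $(-1)$-eigenspaces of $g(t)$ to $E^-_{\tilde v}$ (the result does not depend on the path). Set $o(\tilde v,\tilde w)=+1$ if the result is $\tilde v^+$, and $-1$ if it is $\tilde v^-$; $o(\tilde x,\tilde u)$ is defined in the same way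 in size $|D|$. Shuffles. $\rho_{D,\tilde v}$ is the permutation that rearranges the elements of $I_{\tilde v}$, listed in increasing order, into the elements of $I_{\tilde v}\cap D$ in increasing order followed by the elements of $I_{\tilde v}\cap D^c$ in increasing order; $\rho_{D,\tilde w}$ is defined in the same way from $I_{\tilde w}$. *)

theory Defs
  imports
    Complex_Main
    "HOL-Combinatorics.Cycles"
    "Jordan_Normal_Form.Determinant"
    "Jordan_Normal_Form.DL_Submatrix"
begin

text \<open>
  Matrices and vectors are those of Jordan Normal Form, so that the size is an ordinary natural
  number. Indices run over \<open>{..<n}\<close> instead of \<open>{1,\<dots>,n}\<close>.
\<close>

definition signed_perm_mat :: "nat \<Rightarrow> real mat \<Rightarrow> bool" where
  "signed_perm_mat n W \<longleftrightarrow>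
     (\<exists>p s. p permutes {..<n} \<and> (\<forall>c<n. s c \<in> {1, -1}) \<and>
            W = mat n n (\<lambda>(r, c). if r = p c then s c else 0))"

definition signed_involution :: "nat \<Rightarrow> real mat \<Rightarrow> bool" where
  "signed_involution n W \<longleftrightarrow> signed_perm_mat n W \<and> W * W = 1\<^sub>m n"

definition underlying :: "real mat \<Rightarrow> nat \<Rightarrow> nat" where
  "underlying W = (THE p. p permutes {..<dim_col W} \<and> (\<forall>c<dim_col W. W $$ (p c, c) \<noteq> 0))"

definition Bplus :: "nat \<Rightarrow> real mat set" where
  "Bplus n = {b \<in> carrier_mat n n. upper_triangular b \<and> (\<forall>i<n. b $$ (i, i) > 0)}"

definition mat_trace :: "real mat \<Rightarrow> real" where
  "mat_trace A = (\<Sum>i<dim_row A. A $$ (i, i))"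

definition orth_invol :: "nat \<Rightarrow> nat \<Rightarrow> real mat set" where
  "orth_invol n k = {g \<in> carrier_mat n n. transpose_mat g * g = 1\<^sub>m n \<and> g * g = 1\<^sub>m n \<and>
                       mat_trace g = real n - 2 * real k}"

definition invol_index :: "nat \<Rightarrow> real mat \<Rightarrow> nat" where
  "invol_index n W = (THE k. mat_trace W = real n - 2 * real k)"

definition cell :: "nat \<Rightarrow> real mat \<Rightarrow> real mat set" where
  "cell n W = orth_invol n (invol_index n W) \<inter> {a * W * b | a b. a \<in> Bplus n \<and> b \<in> Bplus n}"

text \<open>Topological closure in the space of \<open>n \<times> n\<close> matrices (the type \<open>mat\<close> carries no topology).\<close>

definition mat_closure :: "nat \<Rightarrow> real mat set \<Rightarrow> real mat set" where
  "mat_closure n S = {A \<in> carrier_mat n n. \<exists>X. (\<forall>m::nat. X m \<in> S) \<and>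
     (\<forall>r<n. \<forall>c<n. (\<lambda>m. X m $$ (r, c)) \<longlonglongrightarrow> A $$ (r, c))}"

definition inversions :: "nat \<Rightarrow> (nat \<Rightarrow> nat) \<Rightarrow> (nat \<times> nat) set" where
  "inversions n w = {(i, j). i < j \<and> j < n \<and> w i > w j}"

definition inversion_rel :: "nat \<Rightarrow> (nat \<Rightarrow> nat) \<Rightarrow> ((nat \<times> nat) \<times> (nat \<times> nat)) set" where
  "inversion_rel n w = {(p, q). p \<in> inversions n w \<and> q \<in> inversions n w \<and>
                          (q = p \<or> q = (w (snd p), w (fst p)))}"

text \<open>
  The dimension of the cell of \<open>W\<close>, given by its combinatorial formula: \<open>(i, j)\<close> and \<open>(w j, w i)\<close>
  are identified.
\<close>

definition cell_dim :: "nat \<Rightarrow> real mat \<Rightarrow> nat" where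
  "cell_dim n W = card (inversions n (underlying W) // inversion_rel n (underlying W))"

definition free_rise :: "nat \<Rightarrow> (nat \<Rightarrow> nat) \<Rightarrow> nat \<Rightarrow> nat \<Rightarrow> bool" where
  "free_rise n v i j \<longleftrightarrow> i < j \<and> j < n \<and> v i < v j \<and>
     \<not> (\<exists>k. i < k \<and> k < j \<and> v i < v k \<and> v k < v j)"

definition type_d :: "(nat \<Rightarrow> nat) \<Rightarrow> nat \<Rightarrow> bool" where "type_d v i \<longleftrightarrow> v i < i"
definition type_f :: "(nat \<Rightarrow> nat) \<Rightarrow> nat \<Rightarrow> bool" where "type_f v i \<longleftrightarrow> v i = i"
definition type_e :: "(nat \<Rightarrow> nat) \<Rightarrow> nat \<Rightarrow> bool" where "type_e v i \<longleftrightarrow> v i > i"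

definition suitable_rise :: "nat \<Rightarrow> (nat \<Rightarrow> nat) \<Rightarrow> nat \<Rightarrow> nat \<Rightarrow> bool" where
  "suitable_rise n v i j \<longleftrightarrow> free_rise n v i j \<and>
     (type_f v i \<and> type_f v j \<or> type_f v i \<and> type_e v j \<or> type_e v i \<and> type_f v j \<or>
      type_e v i \<and> type_e v j \<or> type_e v i \<and> type_d v j)"

text \<open>The last branch covers the non-crossing \<open>ee\<close>-rises and the \<open>ed\<close>-rises.\<close>

definition co :: "nat \<Rightarrow> nat \<Rightarrow> (nat \<Rightarrow> nat) \<Rightarrow> nat \<Rightarrow> nat" where
  "co i j v =
     (if type_f v i \<and> type_f v j then cycle_of_list [i, j]
      else if type_f v i \<and> type_e v j then cycle_of_list [i, j, v j]
      else if type_e v i \<and> type_f v j then cycle_of_list [i, j, v i]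
      else if type_e v i \<and> type_e v j \<and> v i < j then cycle_of_list [i, j, v j, v i]
      else cycle_of_list [i, j] \<circ> cycle_of_list [v i, v j])"

text \<open>
  The product \<open>w = v \<cdot> co\<close> applies \<open>co\<close> first; \<open>cycle_of_list [a, b, c]\<close> maps
  \<open>a \<mapsto> b \<mapsto> c \<mapsto> a\<close>.
\<close>

definition associated_rise :: "nat \<Rightarrow> real mat \<Rightarrow> real mat \<Rightarrow> nat \<Rightarrow> nat \<Rightarrow> bool" where
  "associated_rise n V W i j \<longleftrightarrow> suitable_rise n (underlying V) i j \<and>
     underlying W = underlying V \<circ> co i j (underlying V)"

definition neg_eigenspace :: "nat \<Rightarrow> real mat \<Rightarrow> real vec set" where
  "neg_eigenspace n g = {x \<in> carrier_vec n. g *\<^sub>v x = - x}"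

definition neg_indices :: "nat \<Rightarrow> real mat \<Rightarrow> nat set" where
  "neg_indices n V = {i. i < n \<and> i < underlying V i} \<union>
     {i. i < n \<and> underlying V i = i \<and> V *\<^sub>v unit_vec n i = - unit_vec n i}"

text \<open>An ordered basis is represented by the matrix whose columns are the basis vectors.\<close>

definition ordered_basis :: "nat \<Rightarrow> real vec set \<Rightarrow> real mat \<Rightarrow> bool" where
  "ordered_basis n E A \<longleftrightarrow> dim_row A = n \<and> (\<forall>c<dim_col A. col A c \<in> E) \<and>
     (\<forall>x\<in>E. \<exists>!y. y \<in> carrier_vec (dim_col A) \<and> A *\<^sub>v y = x)"

definition preferred_basis :: "nat \<Rightarrow> real mat \<Rightarrow> real mat" where
  "preferred_basis n V = mat_of_cols n
     (map (\<lambda>i. unit_vec n i - V *\<^sub>v unit_vec n i) (sorted_list_of_set (neg_indices n V)))"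

text \<open>
  An orientation of a subspace is a set of ordered bases, closed under base changes of positive
  determinant.
\<close>

definition orientation_of :: "nat \<Rightarrow> real vec set \<Rightarrow> real mat \<Rightarrow> real mat set" where
  "orientation_of n E A = {A'. ordered_basis n E A' \<and>
     (\<exists>P \<in> carrier_mat (dim_col A) (dim_col A). det P > 0 \<and> A' = A * P)}"

definition preferred_orientation :: "nat \<Rightarrow> real mat \<Rightarrow> real mat set" where
  "preferred_orientation n V = orientation_of n (neg_eigenspace n V) (preferred_basis n V)"

definition mat_path :: "nat \<Rightarrow> nat \<Rightarrow> (real \<Rightarrow> real mat) \<Rightarrow> bool" where
  "mat_path n m F \<longleftrightarrow> (\<forall>t\<in>{0..1}. F t \<in> carrier_mat n m) \<and>
     (\<forall>r<n. \<forall>c<m. continuous_on {0..1} (\<lambda>t. F t $$ (r, c)))"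

definition transport :: "nat \<Rightarrow> (real \<Rightarrow> real mat) \<Rightarrow> real mat set \<Rightarrow> real mat set" where
  "transport n g Or = {F 1 | F. (\<exists>m. mat_path n m F) \<and>
     (\<forall>t\<in>{0..1}. ordered_basis n (neg_eigenspace n (g t)) (F t)) \<and> F 0 \<in> Or}"

definition cell_path :: "nat \<Rightarrow> real mat \<Rightarrow> real mat \<Rightarrow> (real \<Rightarrow> real mat) \<Rightarrow> bool" where
  "cell_path n V W g \<longleftrightarrow> mat_path n n g \<and>
     (\<forall>t\<in>{0..1}. g t \<in> orth_invol n (invol_index n W)) \<and>
     g 0 = W \<and> g 1 = V \<and> (\<forall>t\<in>{0..<1}. g t \<in> cell n W)"

text \<open>
  This is \<open>o(V, W)\<close>. The transported orientation is either the preferred one of \<open>V\<close> or its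
  opposite.
\<close>

definition orient_sign :: "nat \<Rightarrow> real mat \<Rightarrow> real mat \<Rightarrow> int" where
  "orient_sign n V W =
     (let g = (SOME g. cell_path n V W g)
      in if transport n g (preferred_orientation n W) = preferred_orientation n V then 1 else -1)"

definition shuffle_perm :: "nat set \<Rightarrow> nat set \<Rightarrow> nat \<Rightarrow> nat" where
  "shuffle_perm D I = (THE \<rho>. \<rho> permutes I \<and>
     map \<rho> (sorted_list_of_set I) = sorted_list_of_set (I \<inter> D) @ sorted_list_of_set (I - D))"

end

theory Submission
  imports Defs
begin

text \<open>
  If \<open>g = a W b\<close> with \<open>a, b \<in> B\<^sup>+\<close> is a symmetric involution, the last nonzero coordinate \<open>r\<close> of a vector of
  its \<open>(-1)\<close>-eigenspace satisfies \<open>r \<in> w(I\<^sub>W)\<close>, and the first one lies in \<open>I\<^sub>W\<close>. Hence for a basis of that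
  eigenspace the minors with rows \<open>I\<^sub>W\<close> and \<open>w(I\<^sub>W)\<close> vanish nowhere on the cell of \<open>W\<close>. If one of them
  is also nonzero at \<open>V\<close>, then comparing its signs for the preferred bases at \<open>W\<close> and at \<open>V\<close> gives
  \<open>o(V, W)\<close>. This covers every rise except those of type \<open>ed\<close>; there the minor with rows \<open>w(I\<^sub>W)\<close> vanishes
  at \<open>V\<close>, and its sign close to \<open>V\<close> is found by exchanging one row and following a vector \<open>z \<rightarrow> e\<^sub>i\<close> with
  prescribed zeros of \<open>z\<close> and \<open>g z\<close>. Such vectors also show that \<open>V\<close> in the closure of the cell of \<open>W\<close>
  forces the signs of \<open>V\<close> and \<open>W\<close> to agree outside \<open>D\<close> and to be related on \<open>D\<close>, which makes explicit
  paths inside the cell available both in size \<open>n\<close> and in size \<open>|D|\<close>. After sorting the rows and columns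
  into \<open>D\<close> and its complement, which costs the signs of the two shuffles, all minors involved become
  block diagonal, with the same block outside \<open>D\<close> for \<open>V\<close> and \<open>W\<close>; the block on \<open>D\<close> computes \<open>o(x, u)\<close>.
\<close>


section \<open>Signed involutions and double cosets\<close>

text \<open>A minor of a frame is continuous along a path and is multiplied by \<open>det P\<close>
  when the frame is multiplied by \<open>P\<close>. As long as it does not vanish, its sign
  therefore carries the orientation, whatever path and frame are used. At \<open>V\<close> the
  preferred basis vectors are supported on disjoint orbits of \<open>v\<close>, so a minor is
  nonzero there as soon as its rows meet every orbit that contributes to the basis; which rows do so
  depends on the type of the rise and on the signs. For an \<open>ed\<close> rise neither row map
  works: \<open>I_W\<close> meets \<open>D\<close> in \<open>i\<close> and \<open>v i\<close>, a
  single orbit of \<open>v\<close>, and \<open>w\<close> carries them to \<open>v j\<close> and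
  \<open>j\<close>, again a single orbit. This is the obstacle behind the exchange of a row. The
  closure relation is given for size \<open>n\<close> only. It is converted into order and sign
  relations that pass to \<open>D\<close>, and paths are constructed from these relations alone.
  They come in two forms: a circular arc from \<open>W\<close> to \<open>V\<close> when the blocks
  on \<open>D\<close> anticommute, and otherwise, up to sign, a reflection or a product of two
  reflections whose vectors move.\<close>

definition spm :: "nat \<Rightarrow> (nat \<Rightarrow> nat) \<Rightarrow> (nat \<Rightarrow> real) \<Rightarrow> real mat" where
  "spm n w s = mat n n (\<lambda>(r, c). if r = w c then s c else 0)"

text \<open>For signs 1 and -1 the equation \<open>W * W = 1\<close> says that \<open>w\<close> is
  an involution and that the two signs on an orbit have product 1, so they agree.\<close>

definition involution_data :: "nat \<Rightarrow> (nat \<Rightarrow> nat) \<Rightarrow> (nat \<Rightarrow> real) \<Rightarrow> bool" where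
  "involution_data n w s \<longleftrightarrow>
     (\<forall>c<n. w c < n \<and> w (w c) = c \<and> s (w c) = s c \<and> (s c = 1 \<or> s c = -1))"

definition neg_set :: "nat \<Rightarrow> (nat \<Rightarrow> nat) \<Rightarrow> (nat \<Rightarrow> real) \<Rightarrow> nat set" where
  "neg_set n w s = {c. c < n \<and> (c < w c \<or> w c = c \<and> s c = -1)}"

definition double_coset :: "nat \<Rightarrow> real mat \<Rightarrow> real mat set" where
  "double_coset n W = {a * W * b | a b. a \<in> Bplus n \<and> b \<in> Bplus n}"

lemma involution_dataD:
  assumes "involution_data n w s" "c < n"
  shows "w c < n" "w (w c) = c" "s (w c) = s c" "s c = 1 \<or> s c = -1" "s c * s c = 1" "s c \<noteq> 0"
  using assms unfolding involution_data_def by auto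

lemma involution_data_eq_iff:
  assumes "involution_data n w s" "r < n" "c < n"
  shows "r = w c \<longleftrightarrow> c = w r"
  using assms unfolding involution_data_def by metis

lemma spm_carrier [simp]: "spm n w s \<in> carrier_mat n n"
  and spm_dim [simp]: "dim_row (spm n w s) = n" "dim_col (spm n w s) = n"
  by (auto simp: spm_def)

lemma spm_index [simp]: "r < n \<Longrightarrow> c < n \<Longrightarrow> spm n w s $$ (r, c) = (if r = w c then s c else 0)"
  by (simp add: spm_def)

lemma spm_sym:
  assumes "involution_data n w s"
  shows "transpose_mat (spm n w s) = spm n w s"
  using involution_data_eq_iff[OF assms] involution_dataD[OF assms]
  by (intro eq_matI) auto

lemma mult_mat_vec_nth:
  assumes "A \<in> carrier_mat n m" "x \<in> carrier_vec m" "r < n"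
  shows "(A *\<^sub>v x) $ r = (\<Sum>c<m. A $$ (r, c) * x $ c)"
  using assms by (auto simp: scalar_prod_def lessThan_atLeast0 intro!: sum.cong)

lemma mult_mat_nth:
  assumes "A \<in> carrier_mat n m" "B \<in> carrier_mat m k" "r < n" "c < k"
  shows "(A * B) $$ (r, c) = (\<Sum>x<m. A $$ (r, x) * B $$ (x, c))"
  using assms by (auto simp: scalar_prod_def lessThan_atLeast0 intro!: sum.cong)

lemma spm_mult_vec_nth:
  assumes W: "involution_data n w s" and x: "x \<in> carrier_vec n" and r: "r < n"
  shows "(spm n w s *\<^sub>v x) $ r = s r * x $ w r"
proof -
  have "(spm n w s *\<^sub>v x) $ r = (\<Sum>c<n. (if r = w c then s c else 0) * x $ c)"
    using r by (subst mult_mat_vec_nth[OF _ x]) auto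
  also have "\<dots> = (\<Sum>c<n. if c = w r then s r * x $ w r else 0)"
    using involution_data_eq_iff[OF W r] involution_dataD[OF W] r by (intro sum.cong) auto
  also have "\<dots> = s r * x $ w r"
    using involution_dataD(1)[OF W r] by simp
  finally show ?thesis .
qed

lemma spm_mult_self:
  assumes W: "involution_data n w s"
  shows "spm n w s * spm n w s = 1\<^sub>m n"
proof (rule eq_matI)
  fix r c assume rc: "r < dim_row (1\<^sub>m n :: real mat)" "c < dim_col (1\<^sub>m n :: real mat)"
  then have "(spm n w s * spm n w s) $$ (r, c) = (spm n w s *\<^sub>v col (spm n w s) c) $ r"
    by simp
  also have "\<dots> = s r * (if w r = w c then s c else 0)"
    using rc involution_dataD(1)[OF W, of r] by (subst spm_mult_vec_nth[OF W]) (auto simp: col_def)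
  also have "\<dots> = (1\<^sub>m n :: real mat) $$ (r, c)"
    using rc involution_dataD[OF W] by (auto simp: one_mat_def) metis
  finally show "(spm n w s * spm n w s) $$ (r, c) = (1\<^sub>m n :: real mat) $$ (r, c)" .
qed auto

section \<open>Triangular matrices and extreme nonzero coordinates\<close>

lemma BplusD:
  assumes "a \<in> Bplus n"
  shows "a \<in> carrier_mat n n" "r < n \<Longrightarrow> c < r \<Longrightarrow> a $$ (r, c) = 0" "r < n \<Longrightarrow> a $$ (r, r) > 0"
  using assms unfolding Bplus_def upper_triangular_def by auto

lemma Bplus_mult_vec_top:
  assumes a: "a \<in> Bplus n" and y: "y \<in> carrier_vec n" and q: "q < n"
    and 0: "\<And>r. q < r \<Longrightarrow> r < n \<Longrightarrow> y $ r = 0"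
  shows "(a *\<^sub>v y) $ q = a $$ (q, q) * y $ q"
proof -
  have "(a *\<^sub>v y) $ q = (\<Sum>c<n. a $$ (q, c) * y $ c)"
    by (rule mult_mat_vec_nth[OF BplusD(1)[OF a] y q])
  also have "\<dots> = (\<Sum>c<n. if c = q then a $$ (q, q) * y $ q else 0)"
    using 0 BplusD(2)[OF a q] by (intro sum.cong) (auto, metis linorder_neqE_nat)
  also have "\<dots> = a $$ (q, q) * y $ q"
    using q by simp
  finally show ?thesis .
qed

lemma Bplus_mult_vec_zero:
  assumes a: "a \<in> Bplus n" and y: "y \<in> carrier_vec n"
    and 0: "\<And>r. q < r \<Longrightarrow> r < n \<Longrightarrow> y $ r = 0" and r: "q < r" "r < n"
  shows "(a *\<^sub>v y) $ r = 0"
  using Bplus_mult_vec_top[OF a y r(2)] 0 r by auto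

text \<open>At the largest index \<open>m\<close> with \<open>y $ m \<noteq> 0\<close> the product
  has the entry \<open>a $$ (m, m) * y $ m\<close>, which is nonzero, so \<open>m\<close> cannot
  exceed \<open>q\<close>.\<close>

lemma Bplus_mult_vec_zeroD:
  assumes a: "a \<in> Bplus n" and y: "y \<in> carrier_vec n"
    and 0: "\<And>r. q < r \<Longrightarrow> r < n \<Longrightarrow> (a *\<^sub>v y) $ r = 0" and r: "q < r" "r < n"
  shows "y $ r = 0"
proof (rule ccontr)
  assume "y $ r \<noteq> 0"
  define S where "S = {r. r < n \<and> y $ r \<noteq> 0}"
  have fin: "finite S" and ne: "r \<in> S" using r \<open>y $ r \<noteq> 0\<close> by (auto simp: S_def)
  define m where "m = Max S"
  have m: "m \<in> S" "r \<le> m" using Max_in[OF fin] Max_ge[OF fin ne] ne by (auto simp: m_def)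
  have "(a *\<^sub>v y) $ m = a $$ (m, m) * y $ m"
  proof (rule Bplus_mult_vec_top[OF a y])
    show "m < n" using m by (simp add: S_def)
    fix r' assume "m < r'" "r' < n"
    then have "r' \<notin> S" using Max_ge[OF fin, of r'] by (auto simp: m_def)
    then show "y $ r' = 0" using \<open>r' < n\<close> by (simp add: S_def)
  qed
  moreover have "(a *\<^sub>v y) $ m = 0" using 0 m r by (auto simp: S_def)
  ultimately show False using m BplusD(3)[OF a, of m] by (auto simp: S_def)
qed

text \<open>Multiplication by \<open>a\<close> or \<open>b\<close> preserves the position and the
  sign of the last nonzero coordinate. So \<open>b x\<close> ends at \<open>r\<close> like
  \<open>x\<close>, while \<open>W b x\<close>, which \<open>a\<close> sends to \<open>- x\<close>,
  vanishes above \<open>r\<close>. Since \<open>W\<close> moves the entry at \<open>r\<close> to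
  \<open>w r\<close>, this gives \<open>w r \<le> r\<close>; at a fixed point that entry has to
  change its sign.\<close>

lemma double_coset_eigenvector_top:
  assumes W: "involution_data n w s" and g: "g \<in> double_coset n (spm n w s)"
    and x: "x \<in> carrier_vec n" and gx: "g *\<^sub>v x = - x"
    and r: "r < n" "x $ r \<noteq> 0" and top: "\<And>r'. r < r' \<Longrightarrow> r' < n \<Longrightarrow> x $ r' = 0"
  shows "w r < r \<or> w r = r \<and> s r = -1"
proof -
  obtain a b where a: "a \<in> Bplus n" and b: "b \<in> Bplus n" and gab: "g = a * spm n w s * b"
    using g by (auto simp: double_coset_def)
  note ac = BplusD(1)[OF a] and bc = BplusD(1)[OF b]
  define y where "y = b *\<^sub>v x"
  define y' where "y' = spm n w s *\<^sub>v y"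
  have yc: "y \<in> carrier_vec n" "y' \<in> carrier_vec n" 
    using bc x by (auto simp: y_def y'_def intro!: mult_mat_vec_carrier)
  have ay': "a *\<^sub>v y' = - x"
  proof -
    have "g *\<^sub>v x = a * spm n w s *\<^sub>v (b *\<^sub>v x)"
      unfolding gab by (rule assoc_mult_mat_vec[OF _ bc x]) (use ac in auto)
    also have "\<dots> = a *\<^sub>v (spm n w s *\<^sub>v (b *\<^sub>v x))"
      by (rule assoc_mult_mat_vec[OF ac spm_carrier]) (use bc x in auto)
    finally show ?thesis using gx by (simp add: y_def y'_def)
  qed
  have y'0: "y' $ r' = 0" if "r < r'" "r' < n" for r'
    by (rule Bplus_mult_vec_zeroD[OF a yc(2) _ that]) (use ay' x top in auto)
  have y'r: "a $$ (r, r) * y' $ r = - x $ r"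
    using Bplus_mult_vec_top[OF a yc(2) r(1) y'0] ay' x r by simp
  have yr: "y $ r = b $$ (r, r) * x $ r"
    unfolding y_def by (rule Bplus_mult_vec_top[OF b x r(1) top])
  have pos: "a $$ (r, r) > 0" "b $$ (r, r) > 0"
    using BplusD(3)[OF a] BplusD(3)[OF b] r by auto
  have sr: "s r \<noteq> 0" using involution_dataD[OF W r(1)] by auto
  have y'w: "y' $ w r = s r * y $ r"
    unfolding y'_def using spm_mult_vec_nth[OF W yc(1), of "w r"] involution_dataD[OF W r(1)] by simp
  have "\<not> r < w r"
    using y'w y'0[of "w r"] involution_dataD[OF W r(1)] yr pos r sr by auto
  moreover have "s r = -1" if "w r = r"
  proof (rule ccontr)
    assume "s r \<noteq> -1"
    then have "s r = 1" using involution_dataD[OF W r(1)] by auto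
    then have "a $$ (r, r) * (b $$ (r, r) * x $ r) = - x $ r"
      using y'r y'w yr that by simp
    then have "(a $$ (r, r) * b $$ (r, r) + 1) * x $ r = 0" by (simp add: algebra_simps)
    moreover have "a $$ (r, r) * b $$ (r, r) > 0" using pos by simp
    ultimately show False using r by auto
  qed
  ultimately show ?thesis by linarith
qed

section \<open>Reversal of the order of the indices\<close>

definition rev_vec :: "nat \<Rightarrow> real vec \<Rightarrow> real vec" where
  "rev_vec n x = vec n (\<lambda>r. x $ (n - 1 - r))"

definition rev_mat :: "nat \<Rightarrow> real mat \<Rightarrow> real mat" where
  "rev_mat n A = mat n n (\<lambda>(r, c). A $$ (n - 1 - r, n - 1 - c))"

lemma sum_rev:
  fixes f :: "nat \<Rightarrow> real"
  shows "(\<Sum>c<n. f (n - 1 - c)) = (\<Sum>c<n. f c)"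
  using sum.nat_diff_reindex[of f n] by simp

lemma rev_carrier [simp]: "rev_mat n A \<in> carrier_mat n n" "rev_vec n x \<in> carrier_vec n"
  by (auto simp: rev_mat_def rev_vec_def)

lemma rev_vec_nth [simp]: "r < n \<Longrightarrow> rev_vec n x $ r = x $ (n - 1 - r)"
  by (simp add: rev_vec_def)

lemma rev_mat_nth [simp]:
  "r < n \<Longrightarrow> c < n \<Longrightarrow> rev_mat n A $$ (r, c) = A $$ (n - 1 - r, n - 1 - c)"
  by (simp add: rev_mat_def)

lemma rev_mat_mult:
  assumes A: "A \<in> carrier_mat n n" and B: "B \<in> carrier_mat n n"
  shows "rev_mat n (A * B) = rev_mat n A * rev_mat n B"
proof (rule eq_matI)
  fix r c assume "r < dim_row (rev_mat n A * rev_mat n B)" "c < dim_col (rev_mat n A * rev_mat n B)"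
  then have rc: "r < n" "c < n" by (auto simp: rev_mat_def)
  have "rev_mat n (A * B) $$ (r, c) = (\<Sum>x<n. A $$ (n - 1 - r, x) * B $$ (x, n - 1 - c))"
    using rc by (simp add: mult_mat_nth[OF A B] del: index_mult_mat)
  also have "\<dots> = (\<Sum>x<n. A $$ (n - 1 - r, n - 1 - x) * B $$ (n - 1 - x, n - 1 - c))"
    by (rule sum_rev[symmetric])
  also have "\<dots> = (rev_mat n A * rev_mat n B) $$ (r, c)"
    using rc by (subst mult_mat_nth[where m = n]) auto
  finally show "rev_mat n (A * B) $$ (r, c) = (rev_mat n A * rev_mat n B) $$ (r, c)" .
qed (auto simp: rev_mat_def)

lemma rev_mat_mult_vec:
  assumes A: "A \<in> carrier_mat n n" and x: "x \<in> carrier_vec n"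
  shows "rev_mat n A *\<^sub>v rev_vec n x = rev_vec n (A *\<^sub>v x)"
proof (rule eq_vecI)
  fix r assume "r < dim_vec (rev_vec n (A *\<^sub>v x))"
  then have r: "r < n" by (simp add: rev_vec_def)
  have "(rev_mat n A *\<^sub>v rev_vec n x) $ r = (\<Sum>c<n. A $$ (n - 1 - r, n - 1 - c) * x $ (n - 1 - c))"
    using r by (subst mult_mat_vec_nth[where m = n]) auto
  also have "\<dots> = (\<Sum>c<n. A $$ (n - 1 - r, c) * x $ c)"
    by (rule sum_rev)
  also have "\<dots> = rev_vec n (A *\<^sub>v x) $ r"
    using r by (simp add: mult_mat_vec_nth[OF A x] del: index_mult_mat_vec)
  finally show "(rev_mat n A *\<^sub>v rev_vec n x) $ r = rev_vec n (A *\<^sub>v x) $ r" .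
qed (auto simp: rev_mat_def rev_vec_def)

definition rev_perm :: "nat \<Rightarrow> (nat \<Rightarrow> nat) \<Rightarrow> nat \<Rightarrow> nat" where
  "rev_perm n w c = n - 1 - w (n - 1 - c)"

definition rev_sgn :: "nat \<Rightarrow> (nat \<Rightarrow> real) \<Rightarrow> nat \<Rightarrow> real" where
  "rev_sgn n s c = s (n - 1 - c)"

lemma rev_involution_data:
  assumes W: "involution_data n w s"
  shows "involution_data n (rev_perm n w) (rev_sgn n s)"
  unfolding involution_data_def
proof (intro allI impI)
  fix c assume "c < n"
  then have c: "n - 1 - c < n" "n - 1 - (n - 1 - c) = c" by auto
  note D = involution_dataD[OF W c(1)]
  have "n - 1 - (n - 1 - w (n - 1 - c)) = w (n - 1 - c)" using D(1) by simp
  then show "rev_perm n w c < n \<and> rev_perm n w (rev_perm n w c) = c \<and>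
      rev_sgn n s (rev_perm n w c) = rev_sgn n s c \<and> (rev_sgn n s c = 1 \<or> rev_sgn n s c = -1)"
    using D c by (auto simp: rev_perm_def rev_sgn_def)
qed

lemma rev_spm:
  assumes W: "involution_data n w s"
  shows "rev_mat n (spm n w s) = spm n (rev_perm n w) (rev_sgn n s)"
proof (rule eq_matI)
  fix r c assume "r < dim_row (spm n (rev_perm n w) (rev_sgn n s))"
    "c < dim_col (spm n (rev_perm n w) (rev_sgn n s))"
  then have rc: "r < n" "c < n" by auto
  have "w (n - 1 - c) < n" using involution_dataD[OF W, of "n - 1 - c"] rc by simp
  then have "n - 1 - r = w (n - 1 - c) \<longleftrightarrow> r = n - 1 - w (n - 1 - c)" using rc by auto
  then show "rev_mat n (spm n w s) $$ (r, c) = spm n (rev_perm n w) (rev_sgn n s) $$ (r, c)"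
    using rc by (simp add: rev_perm_def rev_sgn_def)
qed (auto simp: rev_mat_def)

lemma rev_transpose_Bplus:
  assumes a: "a \<in> Bplus n"
  shows "rev_mat n (transpose_mat a) \<in> Bplus n"
proof -
  have "rev_mat n (transpose_mat a) $$ (i, j) = 0" if "i < n" "j < i" for i j
  proof -
    have "n - 1 - j < n" "n - 1 - i < n - 1 - j" "j < n" using that by auto
    then show ?thesis using that BplusD(1)[OF a] BplusD(2)[OF a, of "n - 1 - j" "n - 1 - i"] by auto
  qed
  moreover have "rev_mat n (transpose_mat a) $$ (i, i) > 0" if "i < n" for i
  proof -
    have "n - 1 - i < n" using that by auto
    then show ?thesis using that BplusD(1)[OF a] BplusD(3)[OF a, of "n - 1 - i"] by auto
  qed
  ultimately show ?thesis
    by (auto simp: Bplus_def upper_triangular_def rev_mat_def)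
qed

text \<open>
  For symmetric \<open>g = a W b\<close> one also has \<open>g = b\<^sup>T W a\<^sup>T\<close>, so reversing the order of the indices
  exchanges the roles of top and bottom coordinates.
\<close>

lemma double_coset_rev:
  assumes W: "involution_data n w s" and g: "g \<in> double_coset n (spm n w s)"
    and sym: "transpose_mat g = g"
  shows "rev_mat n g \<in> double_coset n (spm n (rev_perm n w) (rev_sgn n s))"
proof -
  obtain a b where a: "a \<in> Bplus n" and b: "b \<in> Bplus n" and gab: "g = a * spm n w s * b"
    using g by (auto simp: double_coset_def)
  note ac = BplusD(1)[OF a] and bc = BplusD(1)[OF b]
  have "g = transpose_mat (a * spm n w s * b)" using sym gab by simp
  also have "\<dots> = transpose_mat b * transpose_mat (a * spm n w s)"
    by (rule transpose_mult[OF _ bc]) (use ac in auto)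
  also have "transpose_mat (a * spm n w s) = spm n w s * transpose_mat a"
    using transpose_mult[OF ac spm_carrier] spm_sym[OF W] by simp
  finally have "rev_mat n g = rev_mat n (transpose_mat b * (spm n w s * transpose_mat a))" by simp
  also have "\<dots> = rev_mat n (transpose_mat b) * rev_mat n (spm n w s * transpose_mat a)"
    by (rule rev_mat_mult) (use ac bc in auto)
  also have "rev_mat n (spm n w s * transpose_mat a)
      = spm n (rev_perm n w) (rev_sgn n s) * rev_mat n (transpose_mat a)"
    using ac by (subst rev_mat_mult) (auto simp: rev_spm[OF W])
  finally have "rev_mat n g = rev_mat n (transpose_mat b) *
      (spm n (rev_perm n w) (rev_sgn n s) * rev_mat n (transpose_mat a))" .
  also have "\<dots> = rev_mat n (transpose_mat b) * spm n (rev_perm n w) (rev_sgn n s)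
      * rev_mat n (transpose_mat a)"
    by (rule assoc_mult_mat[symmetric, OF rev_carrier(1) spm_carrier rev_carrier(1)])
  finally show ?thesis
    unfolding double_coset_def using rev_transpose_Bplus[OF a] rev_transpose_Bplus[OF b] by blast
qed

lemma double_coset_carrier: "g \<in> double_coset n (spm n w s) \<Longrightarrow> g \<in> carrier_mat n n"
  unfolding double_coset_def using BplusD(1) by (auto intro!: mult_carrier_mat)

lemma double_coset_eigenvector_bottom:
  assumes W: "involution_data n w s" and g: "g \<in> double_coset n (spm n w s)"
    and sym: "transpose_mat g = g"
    and x: "x \<in> carrier_vec n" and gx: "g *\<^sub>v x = - x"
    and r: "r < n" "x $ r \<noteq> 0" and bot: "\<And>r'. r' < r \<Longrightarrow> x $ r' = 0"
  shows "r < w r \<or> w r = r \<and> s r = -1"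
proof -
  have r': "n - 1 - r < n" "n - 1 - (n - 1 - r) = r" using r by auto
  have "rev_mat n g *\<^sub>v rev_vec n x = - rev_vec n x"
    using rev_mat_mult_vec[OF double_coset_carrier[OF g] x] gx x
    by (auto simp: rev_vec_def intro!: eq_vecI)
  then have "rev_perm n w (n - 1 - r) < n - 1 - r \<or>
      rev_perm n w (n - 1 - r) = n - 1 - r \<and> rev_sgn n s (n - 1 - r) = -1"
    by (rule double_coset_eigenvector_top[OF rev_involution_data[OF W] double_coset_rev[OF W g sym] rev_carrier(2)])
      (use r r' in \<open>auto intro!: bot\<close>)
  then show ?thesis
    using involution_dataD(1)[OF W r(1)] r r' by (auto simp: rev_perm_def rev_sgn_def)
qed



section \<open>Minors of bases of eigenspaces\<close>

lemma tendsto_det: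
  assumes "\<And>m. A m \<in> carrier_mat k k" and L: "L \<in> carrier_mat k k"
    and lim: "\<And>r c. r < k \<Longrightarrow> c < k \<Longrightarrow> ((\<lambda>m. A m $$ (r, c)) \<longlongrightarrow> L $$ (r, c)) F"
  shows "((\<lambda>m. det (A m)) \<longlongrightarrow> (det L :: real)) F"
  unfolding det_def'[OF assms(1)] det_def'[OF L]
  by (intro tendsto_sum tendsto_mult tendsto_const tendsto_prod lim)
    (auto simp: permutes_in_image)

lemma continuous_on_det:
  assumes "\<And>t. A t \<in> carrier_mat k k"
    and "\<And>r c. r < k \<Longrightarrow> c < k \<Longrightarrow> continuous_on S (\<lambda>t. A t $$ (r, c))"
  shows "continuous_on S (\<lambda>t. det (A t) :: real)"
  unfolding continuous_on_def
  by (intro ballI tendsto_det[OF assms(1) assms(1)]) (use assms(2) in \<open>auto simp: continuous_on_def\<close>)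

text \<open>The adjugate form of the inverse is part of the conclusion because it identifies
  solutions of linear systems with expressions whose limits can be computed.\<close>

lemma det_nonzero_inverse:
  fixes A :: "real mat"
  assumes A: "A \<in> carrier_mat k k" and d: "det A \<noteq> 0"
  obtains B where "B \<in> carrier_mat k k" "A * B = 1\<^sub>m k" "B * A = 1\<^sub>m k" "B = (1 / det A) \<cdot>\<^sub>m adj_mat A"
proof
  let ?B = "(1 / det A) \<cdot>\<^sub>m adj_mat A"
  show "?B \<in> carrier_mat k k" using adj_mat(1)[OF A] by simp
  show "A * ?B = 1\<^sub>m k" 
    using mult_smult_distrib[OF A adj_mat(1)[OF A], of "1 / det A"] adj_mat(2)[OF A] d
    by (auto intro!: eq_matI)
  show "?B * A = 1\<^sub>m k"
    using mult_smult_assoc_mat[OF adj_mat(1)[OF A] A, of "1 / det A"] adj_mat(3)[OF A] d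
    by (auto intro!: eq_matI)
qed simp

section \<open>Coordinates and changes of basis in a (-1)-eigenspace\<close>

lemma neg_eigenspaceD:
  assumes "x \<in> neg_eigenspace n g"
  shows "x \<in> carrier_vec n" "g *\<^sub>v x = - x"
  using assms by (auto simp: neg_eigenspace_def)

lemma neg_eigenspace_combination:
  assumes g: "g \<in> carrier_mat n n" and A: "A \<in> carrier_mat n k"
    and col: "\<And>c. c < k \<Longrightarrow> col A c \<in> neg_eigenspace n g" and y: "y \<in> carrier_vec k"
  shows "A *\<^sub>v y \<in> neg_eigenspace n g"
proof -
  have "g * A = - A"
  proof (rule mat_col_eqI)
    fix c assume "c < dim_col (- A)"
    then have c: "c < k" using A by simp
    have "col (g * A) c = g *\<^sub>v col A c" using c A g by (auto simp: col_mult2)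
    also have "\<dots> = - col A c" using neg_eigenspaceD(2)[OF col[OF c]] .
    also have "\<dots> = col (- A) c" using c A by (auto intro!: eq_vecI)
    finally show "col (g * A) c = col (- A) c" .
  qed (use A g in auto)
  then have "g *\<^sub>v (A *\<^sub>v y) = (- A) *\<^sub>v y"
    using assoc_mult_mat_vec[OF g A y] by simp
  also have "\<dots> = - (A *\<^sub>v y)" using A y by (auto intro!: eq_vecI simp: scalar_prod_def sum_negf)
  finally show ?thesis using A y by (auto simp: neg_eigenspace_def)
qed

lemma ordered_basis_coordinates:
  assumes A: "ordered_basis n E A" and k: "dim_col A = k" and B: "B \<in> carrier_mat n m"
    and col: "\<And>c. c < m \<Longrightarrow> col B c \<in> E"
  obtains P where "P \<in> carrier_mat k m" "B = A * P"
proof -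
  have "\<forall>c\<in>{..<m}. \<exists>y. y \<in> carrier_vec k \<and> A *\<^sub>v y = col B c"
    using A col k unfolding ordered_basis_def by blast
  from bchoice[OF this] obtain y
    where y: "\<And>c. c < m \<Longrightarrow> y c \<in> carrier_vec k" "\<And>c. c < m \<Longrightarrow> A *\<^sub>v y c = col B c"
    by blast
  define P where "P = mat k m (\<lambda>(r, c). y c $ r)"
  have P: "P \<in> carrier_mat k m" by (simp add: P_def)
  have Ac: "A \<in> carrier_mat n k" using A k by (auto simp: ordered_basis_def)
  have "B = A * P"
  proof (rule mat_col_eqI)
    fix c assume "c < dim_col (A * P)"
    then have c: "c < m" by (simp add: P_def)
    have "col P c = y c" using c y(1)[OF c] by (auto simp: P_def intro!: eq_vecI)
    then show "col B c = col (A * P) c" using col_mult2[OF Ac P c] y(2)[OF c] by simp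
  qed (use B Ac P in auto)
  with P show ?thesis by (rule that)
qed

text \<open>\<open>ordered_basis\<close> grants unique coordinates only to vectors of the
  eigenspace, so the common image has to be placed there first.\<close>

lemma ordered_basis_inj:
  assumes A: "ordered_basis n (neg_eigenspace n g) A" and g: "g \<in> carrier_mat n n"
    and y: "y \<in> carrier_vec (dim_col A)" "y' \<in> carrier_vec (dim_col A)" and eq: "A *\<^sub>v y = A *\<^sub>v y'"
  shows "y = y'"
proof -
  have Ac: "A \<in> carrier_mat n (dim_col A)" using A by (auto simp: ordered_basis_def)
  have "A *\<^sub>v y \<in> neg_eigenspace n g"
    by (rule neg_eigenspace_combination[OF g Ac _ y(1)]) (use A in \<open>auto simp: ordered_basis_def\<close>)
  then have "\<exists>!z. z \<in> carrier_vec (dim_col A) \<and> A *\<^sub>v z = A *\<^sub>v y"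
    using A by (auto simp: ordered_basis_def)
  then show ?thesis using y eq by metis
qed

lemma ordered_basis_mult_inj:
  assumes A: "ordered_basis n (neg_eigenspace n g) A" and g: "g \<in> carrier_mat n n"
    and P: "P \<in> carrier_mat (dim_col A) m" "Q \<in> carrier_mat (dim_col A) m" and eq: "A * P = A * Q"
  shows "P = Q"
proof (rule mat_col_eqI)
  have Ac: "A \<in> carrier_mat n (dim_col A)" using A by (auto simp: ordered_basis_def)
  fix c assume "c < dim_col Q"
  then have c: "c < m" using P by simp
  show "col P c = col Q c"
    by (rule ordered_basis_inj[OF A g]) (use P c eq col_mult2[OF Ac P(1) c] col_mult2[OF Ac P(2) c] in auto)
qed (use P in auto)

lemma ordered_basis_change_det:
  assumes A: "ordered_basis n (neg_eigenspace n g) A" and B: "ordered_basis n (neg_eigenspace n g) (A * P)"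
    and g: "g \<in> carrier_mat n n" and k: "dim_col A = k" and P: "P \<in> carrier_mat k k"
  shows "det P \<noteq> 0"
proof
  assume "det P = 0"
  then obtain y where y: "y \<in> carrier_vec k" "y \<noteq> 0\<^sub>v k" "P *\<^sub>v y = 0\<^sub>v k"
    using det_0_iff_vec_prod_zero[OF P] by auto
  have Ac: "A \<in> carrier_mat n k" using A k by (auto simp: ordered_basis_def)
  have "A * P *\<^sub>v y = A *\<^sub>v 0\<^sub>v k" using assoc_mult_mat_vec[OF Ac P y(1)] y by simp
  also have "\<dots> = A * P *\<^sub>v 0\<^sub>v k" using Ac P by (auto intro!: eq_vecI simp: scalar_prod_def)
  finally have eq: "A * P *\<^sub>v y = A * P *\<^sub>v 0\<^sub>v k" .
  have "y = 0\<^sub>v k"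
    by (rule ordered_basis_inj[OF B g _ _ eq]) (use y P in simp_all)
  with y show False by simp
qed

lemma ordered_basis_change:
  assumes A: "ordered_basis n (neg_eigenspace n g) A" and g: "g \<in> carrier_mat n n"
    and k: "dim_col A = k" and P: "P \<in> carrier_mat k k" and d: "det P \<noteq> 0"
  shows "ordered_basis n (neg_eigenspace n g) (A * P)"
  unfolding ordered_basis_def
proof (intro conjI allI impI ballI)
  have Ac: "A \<in> carrier_mat n k" using A k by (auto simp: ordered_basis_def)
  obtain B where B: "B \<in> carrier_mat k k" "P * B = 1\<^sub>m k" "B * P = 1\<^sub>m k"
    using det_nonzero_inverse[OF P d] by metis
  show "dim_row (A * P) = n" using Ac by simp
  show "col (A * P) c \<in> neg_eigenspace n g" if "c < dim_col (A * P)" for c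
    using that P col_mult2[OF Ac P] neg_eigenspace_combination[OF g Ac, of "col P c"] A k
    by (auto simp: ordered_basis_def)
  fix x assume x: "x \<in> neg_eigenspace n g"
  obtain y where y: "y \<in> carrier_vec k" "A *\<^sub>v y = x"
    using A x k unfolding ordered_basis_def by blast
  have APy: "A * P *\<^sub>v z = A *\<^sub>v (P *\<^sub>v z)" if "z \<in> carrier_vec k" for z
    by (rule assoc_mult_mat_vec[OF Ac P that])
  show "\<exists>!z. z \<in> carrier_vec (dim_col (A * P)) \<and> A * P *\<^sub>v z = x"
  proof (rule ex1I[of _ "B *\<^sub>v y"])
    show "B *\<^sub>v y \<in> carrier_vec (dim_col (A * P)) \<and> A * P *\<^sub>v (B *\<^sub>v y) = x"
      using B P y APy[of "B *\<^sub>v y"] assoc_mult_mat_vec[OF P B(1) y(1), symmetric] by auto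
    fix z assume z: "z \<in> carrier_vec (dim_col (A * P)) \<and> A * P *\<^sub>v z = x"
    then have zc: "z \<in> carrier_vec k" using P by simp
    have "P *\<^sub>v z = y"
      by (rule ordered_basis_inj[OF A g]) (use z zc y P k APy in auto)
    then have "B *\<^sub>v y = (B * P) *\<^sub>v z" using assoc_mult_mat_vec[OF B(1) P zc] by simp
    then show "z = B *\<^sub>v y" using B zc by simp
  qed
qed

text \<open>The row map \<open>\<tau>\<close> is separated from the list \<open>xs\<close> so that
  the rows \<open>I_W\<close>, the rows \<open>w(I_W)\<close> and variants changed in a single row
  share one indexing.\<close>

definition sel_rows :: "(nat \<Rightarrow> nat) \<Rightarrow> nat list \<Rightarrow> real mat \<Rightarrow> real mat" where
  "sel_rows \<tau> xs A = mat (length xs) (length xs) (\<lambda>(a, b). A $$ (\<tau> (xs ! a), b))"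

lemma sel_rows_carrier [simp]: "sel_rows \<tau> xs A \<in> carrier_mat (length xs) (length xs)"
  and sel_rows_dim [simp]: "dim_row (sel_rows \<tau> xs A) = length xs" "dim_col (sel_rows \<tau> xs A) = length xs"
  by (auto simp: sel_rows_def)

lemma sel_rows_nth [simp]:
  "a < length xs \<Longrightarrow> b < length xs \<Longrightarrow> sel_rows \<tau> xs A $$ (a, b) = A $$ (\<tau> (xs ! a), b)"
  by (simp add: sel_rows_def)

lemma sel_rows_mult:
  assumes A: "A \<in> carrier_mat n (length xs)" and P: "P \<in> carrier_mat (length xs) (length xs)"
    and "\<And>c. c \<in> set xs \<Longrightarrow> \<tau> c < n"
  shows "sel_rows \<tau> xs (A * P) = sel_rows \<tau> xs A * P"
proof (rule eq_matI)
  fix a b assume "a < dim_row (sel_rows \<tau> xs A * P)" "b < dim_col (sel_rows \<tau> xs A * P)"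
  then have ab: "a < length xs" "b < length xs" using P by auto
  show "sel_rows \<tau> xs (A * P) $$ (a, b) = (sel_rows \<tau> xs A * P) $$ (a, b)"
    using ab assms(3)[of "xs ! a"]
    by (simp add: mult_mat_nth[OF A P] mult_mat_nth[OF sel_rows_carrier P] del: index_mult_mat)
qed (use P in auto)

lemma sel_rows_mult_vec:
  assumes A: "A \<in> carrier_mat n (length xs)" and y: "y \<in> carrier_vec (length xs)"
    and "a < length xs" "\<tau> (xs ! a) < n"
  shows "(sel_rows \<tau> xs A *\<^sub>v y) $ a = (A *\<^sub>v y) $ \<tau> (xs ! a)"
  using assms by (simp add: mult_mat_vec_nth[OF A y] mult_mat_vec_nth[OF sel_rows_carrier y] del: index_mult_mat_vec)

lemma neg_set_finite [simp]: "finite (neg_set n w s)"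
  by (rule finite_subset[of _ "{..<n}"]) (auto simp: neg_set_def)

lemma neg_set_lt: "c \<in> neg_set n w s \<Longrightarrow> c < n"
  by (simp add: neg_set_def)

text \<open>The last nonzero coordinate sits at some \<open>w c\<close> with \<open>c\<close> in the
  negative set. The threshold \<open>k\<close> leaves the coordinates below it unrestricted:
  \<open>k = 0\<close> serves the nonvanishing of minors, a positive threshold serves the
  \<open>ed\<close> rises.\<close>

lemma double_coset_eigenvector_vanish_above:
  assumes W: "involution_data n w s" and g: "g \<in> double_coset n (spm n w s)"
    and x: "x \<in> neg_eigenspace n g"
    and 0: "\<And>c. c \<in> neg_set n w s \<Longrightarrow> k \<le> w c \<Longrightarrow> x $ w c = 0"
    and r: "k \<le> r" "r < n"
  shows "x $ r = 0"
proof (rule ccontr)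
  assume "x $ r \<noteq> 0"
  define S where "S = {r. r < n \<and> x $ r \<noteq> 0}"
  have fin: "finite S" and ne: "r \<in> S" using r \<open>x $ r \<noteq> 0\<close> by (auto simp: S_def)
  define m where "m = Max S"
  have m: "m \<in> S" "r \<le> m" using Max_in[OF fin] Max_ge[OF fin ne] ne by (auto simp: m_def)
  have top: "x $ r' = 0" if "m < r'" "r' < n" for r'
  proof -
    have "r' \<notin> S" using that Max_ge[OF fin, of r'] by (auto simp: m_def)
    then show ?thesis using that by (simp add: S_def)
  qed
  have mn: "m < n" "x $ m \<noteq> 0" using m by (auto simp: S_def)
  have "w m < m \<or> w m = m \<and> s m = -1"
    by (rule double_coset_eigenvector_top[OF W g neg_eigenspaceD[OF x] mn top])
  then have "w m \<in> neg_set n w s" using involution_dataD[OF W mn(1)] by (auto simp: neg_set_def)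
  then show False using 0[of "w m"] involution_dataD[OF W mn(1)] m r mn by auto
qed

lemma double_coset_eigenvector_vanish_below:
  assumes W: "involution_data n w s" and g: "g \<in> double_coset n (spm n w s)"
    and sym: "transpose_mat g = g" and x: "x \<in> neg_eigenspace n g"
    and 0: "\<And>c. c \<in> neg_set n w s \<Longrightarrow> x $ c = 0"
    and r: "r < n"
  shows "x $ r = 0"
proof (rule ccontr)
  assume "x $ r \<noteq> 0"
  define m where "m = (LEAST r. r < n \<and> x $ r \<noteq> 0)"
  have m: "m < n" "x $ m \<noteq> 0"
    using LeastI[of "\<lambda>r. r < n \<and> x $ r \<noteq> 0" r] r \<open>x $ r \<noteq> 0\<close> by (auto simp: m_def)
  have "x $ r' = 0" if "r' < m" for r'
    using not_less_Least[of r' "\<lambda>r. r < n \<and> x $ r \<noteq> 0"] that m by (auto simp: m_def)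
  then have "m < w m \<or> w m = m \<and> s m = -1"
    using double_coset_eigenvector_bottom[OF W g sym neg_eigenspaceD[OF x] m] by blast
  then have "m \<in> neg_set n w s" using m by (auto simp: neg_set_def)
  with 0 m show False by auto
qed

text \<open>
  These minors are the Plucker coordinates of the \<open>(-1)\<close>-eigenspace with rows \<open>I\<^sub>W\<close> and \<open>w(I\<^sub>W)\<close>.
\<close>

lemma sel_rows_det_nonzero:
  assumes W: "involution_data n w s" and g: "g \<in> double_coset n (spm n w s)"
    and sym: "transpose_mat g = g" and A: "ordered_basis n (neg_eigenspace n g) A"
    and xs: "set xs = neg_set n w s" and k: "dim_col A = length xs"
    and \<tau>: "\<tau> = w \<or> \<tau> = (\<lambda>c. c)"
  shows "det (sel_rows \<tau> xs A) \<noteq> 0"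
proof
  assume "det (sel_rows \<tau> xs A) = 0"
  then obtain y where y: "y \<in> carrier_vec (length xs)" "y \<noteq> 0\<^sub>v (length xs)"
      "sel_rows \<tau> xs A *\<^sub>v y = 0\<^sub>v (length xs)"
    using det_0_iff_vec_prod_zero[OF sel_rows_carrier] by metis
  have gc: "g \<in> carrier_mat n n" by (rule double_coset_carrier[OF g])
  have Ac: "A \<in> carrier_mat n (length xs)" using A k by (auto simp: ordered_basis_def)
  define x where "x = A *\<^sub>v y"
  have x: "x \<in> neg_eigenspace n g" unfolding x_def
    by (rule neg_eigenspace_combination[OF gc Ac _ y(1)]) (use A k in \<open>auto simp: ordered_basis_def\<close>)
  have 0: "x $ \<tau> c = 0" if "c \<in> neg_set n w s" for c
  proof -
    from that xs have "c \<in> set xs" by simp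
    then obtain a where a: "a < length xs" "c = xs ! a" by (auto simp: in_set_conv_nth)
    have "\<tau> c < n" using \<tau> neg_set_lt[OF that] involution_dataD[OF W] by auto
    then show ?thesis using sel_rows_mult_vec[OF Ac y(1) a(1), of \<tau>] y(3) a by (simp add: x_def)
  qed
  have "x $ r = 0" if "r < n" for r
    using \<tau>
  proof
    assume "\<tau> = w"
    then show ?thesis
      using double_coset_eigenvector_vanish_above[OF W g x, of 0 r] 0 that by auto
  next
    assume "\<tau> = (\<lambda>c. c)"
    then show ?thesis
      using double_coset_eigenvector_vanish_below[OF W g sym x, of r] 0 that by auto
  qed
  then have eq: "A *\<^sub>v y = A *\<^sub>v 0\<^sub>v (length xs)"
    using neg_eigenspaceD(1)[OF x] Ac by (auto simp: x_def scalar_prod_def intro!: eq_vecI)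
  have "y = 0\<^sub>v (length xs)" by (rule ordered_basis_inj[OF A gc _ _ eq]) (use y k in simp_all)
  with y show False by simp
qed



section \<open>The preferred basis\<close>

text \<open>Coordinate \<open>r\<close> of the preferred basis vector
  \<open>e_c - V e_c\<close>.\<close>

definition frame_entry :: "(nat \<Rightarrow> nat) \<Rightarrow> (nat \<Rightarrow> real) \<Rightarrow> nat \<Rightarrow> nat \<Rightarrow> real" where
  "frame_entry v t c r = (if r = c then 1 else 0) - (if r = v c then t c else 0)"

definition neg_list :: "nat \<Rightarrow> (nat \<Rightarrow> nat) \<Rightarrow> (nat \<Rightarrow> real) \<Rightarrow> nat list" where
  "neg_list n v t = sorted_list_of_set (neg_set n v t)"

text \<open>The lists of rows and columns are arguments because the minors are later reordered and
  cut into blocks.\<close>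

definition frame_det ::
  "(nat \<Rightarrow> nat) \<Rightarrow> nat list \<Rightarrow> (nat \<Rightarrow> nat) \<Rightarrow> (nat \<Rightarrow> real) \<Rightarrow> nat list \<Rightarrow> real" where
  "frame_det \<tau> xs v t ys =
     det (mat (length xs) (length xs) (\<lambda>(a, b). frame_entry v t (ys ! b) (\<tau> (xs ! a))))"

definition frame_mat :: "nat \<Rightarrow> (nat \<Rightarrow> nat) \<Rightarrow> (nat \<Rightarrow> real) \<Rightarrow> real mat" where
  "frame_mat n v t = mat n (length (neg_list n v t)) (\<lambda>(r, b). frame_entry v t (neg_list n v t ! b) r)"

lemma neg_list_props [simp]:
  "set (neg_list n v t) = neg_set n v t" "distinct (neg_list n v t)"
  "length (neg_list n v t) = card (neg_set n v t)"
  by (auto simp: neg_list_def)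

lemma neg_list_nth_mem: "b < card (neg_set n v t) \<Longrightarrow> neg_list n v t ! b \<in> neg_set n v t"
  by (metis neg_list_props(1,3) nth_mem)

lemma frame_mat_carrier [simp]: "frame_mat n v t \<in> carrier_mat n (card (neg_set n v t))"
  by (simp add: frame_mat_def)

lemma frame_mat_dim [simp]: "dim_row (frame_mat n v t) = n" "dim_col (frame_mat n v t) = card (neg_set n v t)"
  by (simp_all add: frame_mat_def)

text \<open>Basis vectors of different orbits of \<open>v\<close> have disjoint supports, so only
  the orbit of \<open>r\<close> contributes. The factor 2 comes from
  \<open>e_c - V e_c = 2 e_c\<close> at a negative fixed point.\<close>

lemma frame_sum:
  assumes V: "involution_data n v t" and r: "r < n"
  shows "(\<Sum>c\<in>neg_set n v t. \<eta> c * frame_entry v t c r) =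
    (if r \<in> neg_set n v t then (if v r = r then 2 * \<eta> r else \<eta> r)
     else if v r \<in> neg_set n v t then - t r * \<eta> (v r) else 0)"
proof -
  note D = involution_dataD[OF V]
  have eq: "r = v c \<longleftrightarrow> c = v r" if "c \<in> neg_set n v t" for c
    using involution_data_eq_iff[OF V r] that by (simp add: neg_set_def)
  consider (a) "r \<in> neg_set n v t" | (b) "r \<notin> neg_set n v t" "v r \<in> neg_set n v t"
    | (c) "r \<notin> neg_set n v t" "v r \<notin> neg_set n v t" by blast
  then show ?thesis
  proof cases
    case a
    have "(\<Sum>c\<in>neg_set n v t. \<eta> c * frame_entry v t c r)
        = (\<Sum>c\<in>neg_set n v t. if c = r then (if v r = r then 2 * \<eta> r else \<eta> r) else 0)"
    proof (intro sum.cong refl)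
      fix c assume c: "c \<in> neg_set n v t"
      show "\<eta> c * frame_entry v t c r = (if c = r then (if v r = r then 2 * \<eta> r else \<eta> r) else 0)"
        using eq[OF c] a c D(2)[OF r] by (auto simp: frame_entry_def neg_set_def)
    qed
    then show ?thesis using a by simp
  next
    case b
    then have "v r \<noteq> r" by auto
    have "(\<Sum>c\<in>neg_set n v t. \<eta> c * frame_entry v t c r)
        = (\<Sum>c\<in>neg_set n v t. if c = v r then - t r * \<eta> (v r) else 0)"
    proof (intro sum.cong refl)
      fix c assume c: "c \<in> neg_set n v t"
      then have "c \<noteq> r" using b by auto
      then show "\<eta> c * frame_entry v t c r = (if c = v r then - t r * \<eta> (v r) else 0)"
        using eq[OF c] D(3)[OF r] D(2)[OF r] by (auto simp: frame_entry_def)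
    qed
    then show ?thesis using b by simp
  next
    case c
    have "(\<Sum>c\<in>neg_set n v t. \<eta> c * frame_entry v t c r) = (\<Sum>c\<in>neg_set n v t. 0)"
    proof (intro sum.cong refl)
      fix d assume d: "d \<in> neg_set n v t"
      then have "d \<noteq> r" "d \<noteq> v r" using c by auto
      then show "\<eta> d * frame_entry v t d r = 0"
        using eq[OF d] by (auto simp: frame_entry_def)
    qed
    then show ?thesis using c by simp
  qed
qed

text \<open>Trades coordinates indexed by list positions for a function \<open>\<eta>\<close> on the
  listed elements, so that sums over columns become sums over orbits.\<close>

lemma sum_nth_distinct:
  assumes xs: "distinct xs"
  obtains \<eta> where "\<And>b. b < length xs \<Longrightarrow> \<eta> (xs ! b) = (y b :: real)"
    "\<And>f. (\<Sum>b<length xs. y b * f (xs ! b)) = (\<Sum>c\<in>set xs. \<eta> c * f c)"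
proof -
  define \<eta> where "\<eta> c = y (THE b. b < length xs \<and> xs ! b = c)" for c
  have 1: "\<eta> (xs ! b) = y b" if "b < length xs" for b
  proof -
    have "(THE b'. b' < length xs \<and> xs ! b' = xs ! b) = b"
      using that xs by (intro the_equality) (auto simp: nth_eq_iff_index_eq)
    then show ?thesis by (simp add: \<eta>_def)
  qed
  have "(\<Sum>b<length xs. y b * f (xs ! b)) = (\<Sum>c\<in>set xs. \<eta> c * f c)" for f
  proof -
    have "(\<Sum>b<length xs. y b * f (xs ! b)) = (\<Sum>b<length xs. \<eta> (xs ! b) * f (xs ! b))"
      using 1 by (intro sum.cong) auto
    also have "\<dots> = (\<Sum>c\<in>set xs. \<eta> c * f c)"
      by (rule sum.reindex_bij_betw[OF bij_betw_nth[OF xs refl refl]])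
    finally show ?thesis .
  qed
  with 1 show ?thesis by (rule that)
qed

lemma frame_mat_mult_vec:
  assumes y: "y \<in> carrier_vec (card (neg_set n v t))" and V: "involution_data n v t"
  obtains \<eta> where "\<And>b. b < card (neg_set n v t) \<Longrightarrow> \<eta> (neg_list n v t ! b) = y $ b"
    "\<And>r. r < n \<Longrightarrow> (frame_mat n v t *\<^sub>v y) $ r =
      (if r \<in> neg_set n v t then (if v r = r then 2 * \<eta> r else \<eta> r)
       else if v r \<in> neg_set n v t then - t r * \<eta> (v r) else 0)"
proof -
  obtain \<eta> where 1: "\<And>b. b < card (neg_set n v t) \<Longrightarrow> \<eta> (neg_list n v t ! b) = y $ b"
    and 2: "\<And>f. (\<Sum>b<card (neg_set n v t). y $ b * f (neg_list n v t ! b)) = (\<Sum>c\<in>neg_set n v t. \<eta> c * f c)"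
    using sum_nth_distinct[OF neg_list_props(2), of n v t "\<lambda>b. y $ b"] by auto
  have "(frame_mat n v t *\<^sub>v y) $ r = (\<Sum>c\<in>neg_set n v t. \<eta> c * frame_entry v t c r)" if "r < n" for r
    unfolding 2[of "\<lambda>c. frame_entry v t c r", symmetric]
    using that by (subst mult_mat_vec_nth[OF frame_mat_carrier y]) (auto simp: frame_mat_def mult.commute)
  then show ?thesis using 1 frame_sum[OF V] by (intro that[of \<eta>]) simp_all
qed

lemma spm_neg_eigenspace_iff:
  assumes V: "involution_data n v t"
  shows "x \<in> neg_eigenspace n (spm n v t) \<longleftrightarrow> x \<in> carrier_vec n \<and> (\<forall>r<n. t r * x $ v r = - x $ r)"
proof (cases "x \<in> carrier_vec n")
  case True
  then have "spm n v t *\<^sub>v x = - x \<longleftrightarrow> (\<forall>r<n. (spm n v t *\<^sub>v x) $ r = (- x) $ r)"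
    by (auto simp: vec_eq_iff)
  then show ?thesis using True by (simp add: neg_eigenspace_def spm_mult_vec_nth[OF V] del: index_mult_mat_vec)
qed (simp add: neg_eigenspace_def)

lemma frame_mat_ordered_basis:
  assumes V: "involution_data n v t"
  shows "ordered_basis n (neg_eigenspace n (spm n v t)) (frame_mat n v t)"
  unfolding ordered_basis_def
proof (intro conjI allI impI ballI)
  note D = involution_dataD[OF V]
  show "dim_row (frame_mat n v t) = n" by simp
  show "col (frame_mat n v t) b \<in> neg_eigenspace n (spm n v t)" if "b < dim_col (frame_mat n v t)" for b
    unfolding spm_neg_eigenspace_iff[OF V]
  proof (intro conjI allI impI)
    have b: "b < card (neg_set n v t)" using that by simp
    define c where "c = neg_list n v t ! b"
    have c: "c < n" using neg_list_nth_mem[OF b] neg_set_lt by (simp add: c_def)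
    fix r assume r: "r < n"
    have "r = v c \<longleftrightarrow> c = v r" "v r = v c \<longleftrightarrow> r = c" 
      using involution_data_eq_iff[OF V r c] D(2)[OF r] D(2)[OF c] by metis+
    then show "t r * col (frame_mat n v t) b $ v r = - col (frame_mat n v t) b $ r"
      using b r D[OF r] D[OF c] by (auto simp: frame_mat_def frame_entry_def c_def[symmetric])
  qed (simp add: carrier_vecI)
  fix x assume x: "x \<in> neg_eigenspace n (spm n v t)"
  then have xc: "x \<in> carrier_vec n" and xr: "\<And>r. r < n \<Longrightarrow> t r * x $ v r = - x $ r"
    using spm_neg_eigenspace_iff[OF V] by auto
  \<comment> \<open>The coefficient at \<open>c\<close> is coordinate \<open>c\<close> of
    \<open>x\<close>, halved at fixed points because the basis vector there is
    \<open>2 e_c\<close>.\<close>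
  define h where "h c = (if v c = c then x $ c / 2 else x $ c)" for c
  have char: "frame_mat n v t *\<^sub>v y = x \<longleftrightarrow> y = vec (card (neg_set n v t)) (\<lambda>b. h (neg_list n v t ! b))"
    if y: "y \<in> carrier_vec (card (neg_set n v t))" for y
  proof -
    obtain \<eta> where \<eta>: "\<And>b. b < card (neg_set n v t) \<Longrightarrow> \<eta> (neg_list n v t ! b) = y $ b"
      "\<And>r. r < n \<Longrightarrow> (frame_mat n v t *\<^sub>v y) $ r =
      (if r \<in> neg_set n v t then (if v r = r then 2 * \<eta> r else \<eta> r)
       else if v r \<in> neg_set n v t then - t r * \<eta> (v r) else 0)"
      using frame_mat_mult_vec[OF y V] by metis
    have "frame_mat n v t *\<^sub>v y = x \<longleftrightarrow> (\<forall>r<n. (frame_mat n v t *\<^sub>v y) $ r = x $ r)"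
      using xc by (auto simp: vec_eq_iff)
    also have "\<dots> \<longleftrightarrow> (\<forall>c\<in>neg_set n v t. \<eta> c = h c)"
    proof (intro iffI allI impI ballI)
      fix c assume *: "\<forall>r<n. (frame_mat n v t *\<^sub>v y) $ r = x $ r" and c: "c \<in> neg_set n v t"
      then show "\<eta> c = h c" using \<eta>(2)[of c] neg_set_lt[OF c] by (auto simp: h_def split: if_splits)
    next
      fix r assume *: "\<forall>c\<in>neg_set n v t. \<eta> c = h c" and r: "r < n"
      have nn: "x $ r = 0" if "r \<notin> neg_set n v t" "v r \<notin> neg_set n v t"
      proof -
        have "v r = r" "t r = 1" using that D[OF r] r by (auto simp: neg_set_def)
        then show ?thesis using xr[OF r] by simp
      qed
      have "v r \<noteq> r" if "r \<notin> neg_set n v t" "v r \<in> neg_set n v t" using that by auto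
      then show "(frame_mat n v t *\<^sub>v y) $ r = x $ r"
        using \<eta>(2)[OF r] * nn xr[OF r] D[OF r] by (auto simp: h_def)
    qed
    also have "\<dots> \<longleftrightarrow> (\<forall>b<card (neg_set n v t). y $ b = h (neg_list n v t ! b))"
      using \<eta>(1) neg_list_props(1,3)[of n v t] by (metis in_set_conv_nth)
    also have "\<dots> \<longleftrightarrow> y = vec (card (neg_set n v t)) (\<lambda>b. h (neg_list n v t ! b))"
      using y by (auto simp: vec_eq_iff)
    finally show ?thesis .
  qed
  show "\<exists>!y. y \<in> carrier_vec (dim_col (frame_mat n v t)) \<and> frame_mat n v t *\<^sub>v y = x"
    using char by (intro ex1I[of _ "vec (card (neg_set n v t)) (\<lambda>b. h (neg_list n v t ! b))"]) auto
qed

text \<open>A row in the orbit of \<open>d\<close> sees only the coefficient at \<open>d\<close>,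
  multiplied by 1, 2 or a sign. If every contributing orbit is met, a vector in the kernel of the
  minor has all its coefficients zero.\<close>

lemma frame_det_nonzero:
  assumes V: "involution_data n v t" and k: "length xs = card (neg_set n v t)"
    and \<tau>: "\<And>c. c \<in> set xs \<Longrightarrow> \<tau> c < n"
    and hit: "\<And>d. d \<in> neg_set n v t \<Longrightarrow> \<exists>c\<in>set xs. \<tau> c = d \<or> \<tau> c = v d"
  shows "frame_det \<tau> xs v t (neg_list n v t) \<noteq> 0"
proof
  note D = involution_dataD[OF V]
  let ?F = "frame_mat n v t"
  have eq: "mat (length xs) (length xs) (\<lambda>(a, b). frame_entry v t (neg_list n v t ! b) (\<tau> (xs ! a))) = sel_rows \<tau> xs ?F"
    using k \<tau> by (auto simp: sel_rows_def frame_mat_def intro!: eq_matI)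
  assume "frame_det \<tau> xs v t (neg_list n v t) = 0"
  then obtain y where y: "y \<in> carrier_vec (length xs)" "y \<noteq> 0\<^sub>v (length xs)"
      "sel_rows \<tau> xs ?F *\<^sub>v y = 0\<^sub>v (length xs)"
    unfolding frame_det_def eq using det_0_iff_vec_prod_zero[OF sel_rows_carrier] by metis
  obtain \<eta> where \<eta>: "\<And>b. b < card (neg_set n v t) \<Longrightarrow> \<eta> (neg_list n v t ! b) = y $ b"
      "\<And>r. r < n \<Longrightarrow> (frame_mat n v t *\<^sub>v y) $ r =
      (if r \<in> neg_set n v t then (if v r = r then 2 * \<eta> r else \<eta> r)
       else if v r \<in> neg_set n v t then - t r * \<eta> (v r) else 0)"
    using frame_mat_mult_vec[OF _ V] y k by metis
  have 0: "(?F *\<^sub>v y) $ \<tau> c = 0" if "c \<in> set xs" for c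
  proof -
    from that obtain a where a: "a < length xs" "c = xs ! a" by (auto simp: in_set_conv_nth)
    have "?F \<in> carrier_mat n (length xs)" using k by simp
    then show ?thesis using sel_rows_mult_vec[OF _ y(1) a(1), of ?F n \<tau>] y(3) a \<tau>[OF that] by simp
  qed
  have "\<eta> d = 0" if d: "d \<in> neg_set n v t" for d
  proof -
    obtain c where c: "c \<in> set xs" "\<tau> c = d \<or> \<tau> c = v d" using hit[OF d] by auto
    have dn: "d < n" using neg_set_lt[OF d] .
    have "v d \<notin> neg_set n v t" if "v d \<noteq> d" using that d D[OF dn] by (auto simp: neg_set_def)
    then show ?thesis using \<eta>(2)[of "\<tau> c"] 0[OF c(1)] c(2) d D[OF dn] dn D(6)[OF D(1)[OF dn]] by (auto split: if_splits)
  qed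
  then have "y $ b = 0" if "b < length xs" for b
    using \<eta>(1)[of b] neg_list_nth_mem[of b n v t] that k by simp
  then have "y = 0\<^sub>v (length xs)" using y by (auto intro!: eq_vecI)
  with y show False by simp
qed

lemma sel_rows_frame_mat:
  assumes "length xs = card (neg_set n v t)" "\<And>c. c \<in> set xs \<Longrightarrow> \<tau> c < n"
  shows "det (sel_rows \<tau> xs (frame_mat n v t)) = frame_det \<tau> xs v t (neg_list n v t)"
  unfolding frame_det_def by (rule arg_cong[of _ _ det]) 
    (use assms in \<open>auto simp: sel_rows_def frame_mat_def intro!: eq_matI\<close>)

section \<open>Signs, preferred basis and trace of a signed involution\<close>

lemma underlying_spm:
  assumes v: "v permutes {..<n}" and t: "\<And>c. c < n \<Longrightarrow> t c \<noteq> 0"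
  shows "underlying (spm n v t) = v"
  unfolding underlying_def
proof (rule the_equality)
  show "v permutes {..<dim_col (spm n v t)} \<and> (\<forall>c<dim_col (spm n v t). spm n v t $$ (v c, c) \<noteq> 0)"
    using v t permutes_in_image[OF v] by auto
  fix p assume p: "p permutes {..<dim_col (spm n v t)} \<and> (\<forall>c<dim_col (spm n v t). spm n v t $$ (p c, c) \<noteq> 0)"
  show "p = v"
  proof
    fix c show "p c = v c"
    proof (cases "c < n")
      case True
      then have "p c < n" using p permutes_in_image[of p "{..<n}" c] by auto
      then show ?thesis using p True by (auto split: if_splits)
    next
      case False
      then show ?thesis using p v permutes_not_in[of p "{..<n}" c] permutes_not_in[OF v, of c] by auto
    qed
  qed
qed

lemma signed_involution_data:
  assumes "signed_involution n V"
  obtains t where "V = spm n (underlying V) t" "involution_data n (underlying V) t"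
    "underlying V permutes {..<n}"
proof -
  obtain p t where p: "p permutes {..<n}" and t: "\<And>c. c < n \<Longrightarrow> t c \<in> {1, -1}"
    and V: "V = spm n p t" and sq: "V * V = 1\<^sub>m n"
    using assms unfolding signed_involution_def signed_perm_mat_def spm_def by auto
  have u: "underlying V = p" unfolding V using t by (intro underlying_spm[OF p]) force
  have "involution_data n p t"
    unfolding involution_data_def
  proof (intro allI impI)
    fix c assume c: "c < n"
    have pc: "p c < n" "p (p c) < n" using permutes_in_image[OF p] c by auto
    \<comment> \<open>Column \<open>c\<close> of \<open>V * V\<close> has its only nonzero entry in
      this row; comparing it with the identity matrix yields both \<open>p (p c) = c\<close> and the
      equality of the signs.\<close>
    have "(V * V) $$ (p (p c), c) = (\<Sum>x<n. (if p (p c) = p x then t x else 0) * (if x = p c then t c else 0))"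
      unfolding V using pc c by (subst mult_mat_nth[OF spm_carrier spm_carrier]) auto
    also have "\<dots> = (\<Sum>x<n. if x = p c then t (p c) * t c else 0)" by (intro sum.cong) auto
    also have "\<dots> = t (p c) * t c" using pc by simp
    finally have "(1\<^sub>m n :: real mat) $$ (p (p c), c) = t (p c) * t c" using sq by simp
    then have *: "(if p (p c) = c then 1 else 0) = t (p c) * t c" using pc c by simp
    then show "p c < n \<and> p (p c) = c \<and> t (p c) = t c \<and> (t c = 1 \<or> t c = -1)"
      using t[OF c] t[OF pc(1)] pc by (auto split: if_splits)
  qed
  with u V p show ?thesis by (intro that[of t]) auto
qed

lemma neg_indices_spm:
  assumes V: "involution_data n v t" and v: "v permutes {..<n}"
  shows "neg_indices n (spm n v t) = neg_set n v t"
proof -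
  have u: "underlying (spm n v t) = v" by (rule underlying_spm[OF v involution_dataD(6)[OF V]])
  have "spm n v t *\<^sub>v unit_vec n i = - unit_vec n i \<longleftrightarrow> t i = -1" if i: "i < n" "v i = i" for i
  proof
    assume "spm n v t *\<^sub>v unit_vec n i = - unit_vec n i"
    then have "(spm n v t *\<^sub>v unit_vec n i) $ i = (- unit_vec n i) $ i" by simp
    then show "t i = -1" unfolding spm_mult_vec_nth[OF V unit_vec_carrier i(1)] using i by simp
  next
    assume ti: "t i = -1"
    show "spm n v t *\<^sub>v unit_vec n i = - unit_vec n i"
    proof (rule eq_vecI)
      fix r assume "r < dim_vec (- unit_vec n i :: real vec)"
      then have r: "r < n" by simp
      show "(spm n v t *\<^sub>v unit_vec n i) $ r = (- unit_vec n i) $ r"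
        unfolding spm_mult_vec_nth[OF V unit_vec_carrier r] 
        using r i ti involution_dataD[OF V r] by (cases "r = i") (auto simp: unit_vec_def)
    qed simp
  qed
  then show ?thesis unfolding neg_indices_def neg_set_def u by auto
qed

lemma preferred_basis_spm:
  assumes V: "involution_data n v t" and v: "v permutes {..<n}"
  shows "preferred_basis n (spm n v t) = frame_mat n v t"
proof -
  have "(unit_vec n c - spm n v t *\<^sub>v unit_vec n c) $ r = frame_entry v t c r" if "r < n" "c < n" for r c
  proof -
    have "(spm n v t *\<^sub>v unit_vec n c) $ r = t r * unit_vec n c $ v r"
      by (rule spm_mult_vec_nth[OF V _ that(1)]) simp
    also have "\<dots> = (if r = v c then t c else 0)"
      using that involution_data_eq_iff[OF V that] involution_dataD[OF V that(1)] by auto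
    finally show ?thesis using that by (auto simp: frame_entry_def simp del: index_mult_mat_vec)
  qed
  moreover have "neg_list n v t ! b < n" if "b < card (neg_set n v t)" for b
    using neg_list_nth_mem[OF that] neg_set_lt by blast
  ultimately show ?thesis
    unfolding preferred_basis_def neg_indices_spm[OF V v] mat_of_cols_def frame_mat_def
    by (intro eq_matI) (auto simp: neg_list_def[symmetric] simp del: index_mult_mat_vec index_minus_vec)
qed

lemma mat_trace_spm:
  assumes V: "involution_data n v t"
  shows "mat_trace (spm n v t) = real n - 2 * real (card (neg_set n v t))"
proof -
  note D = involution_dataD[OF V]
  let ?I = "neg_set n v t"
  have "mat_trace (spm n v t) = (\<Sum>r<n. if r = v r then t r else 0)"
    by (simp add: mat_trace_def)
  \<comment> \<open>In a 2-cycle exactly one of \<open>r\<close> and \<open>v r\<close> is counted,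
    which gives 0; a negative fixed point is counted twice, a positive one never.\<close>
  also have "\<dots> = (\<Sum>r<n. 1 - of_bool (r \<in> ?I) - of_bool (v r \<in> ?I))"
  proof (intro sum.cong refl)
    fix r assume "r \<in> {..<n}"
    then have r: "r < n" by simp
    show "(if r = v r then t r else 0) = 1 - of_bool (r \<in> ?I) - of_bool (v r \<in> ?I)"
      using D[OF r] r by (auto simp: neg_set_def)
  qed
  also have "\<dots> = real n - (\<Sum>r<n. of_bool (r \<in> ?I)) - (\<Sum>r<n. of_bool (v r \<in> ?I))"
    by (simp add: sum_subtractf)
  also have "(\<Sum>r<n. of_bool (v r \<in> ?I)) = (\<Sum>r<n. of_bool (r \<in> ?I) :: real)"
    by (rule sum.reindex_bij_betw[of v]) (rule bij_betwI[of _ _ _ v], use D in auto)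
  also have "(\<Sum>r<n. of_bool (r \<in> ?I) :: real) = real (card ?I)"
  proof -
    have "{..<n} \<inter> ?I = ?I" by (auto simp: neg_set_def)
    then show ?thesis by (simp add: of_bool_def sum.If_cases)
  qed
  finally show ?thesis by simp
qed

lemma invol_index_spm:
  assumes V: "involution_data n v t"
  shows "invol_index n (spm n v t) = card (neg_set n v t)"
  unfolding invol_index_def mat_trace_spm[OF V] by (rule the_equality) auto



section \<open>Transport of orientations along paths\<close>

lemma orth_involD:
  assumes "g \<in> orth_invol n k"
  shows "g \<in> carrier_mat n n" "g * g = 1\<^sub>m n" "transpose_mat g * g = 1\<^sub>m n" "transpose_mat g = g"
    "mat_trace g = real n - 2 * real k"
proof -
  show g: "g \<in> carrier_mat n n" "g * g = 1\<^sub>m n" "transpose_mat g * g = 1\<^sub>m n"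
    "mat_trace g = real n - 2 * real k"
    using assms by (auto simp: orth_invol_def)
  have gT: "transpose_mat g \<in> carrier_mat n n" using g by simp
  have "transpose_mat g = transpose_mat g * (g * g)" using g gT by simp
  also have "\<dots> = transpose_mat g * g * g" using assoc_mult_mat[OF gT g(1) g(1)] by simp
  also have "\<dots> = g" using g by simp
  finally show "transpose_mat g = g" .
qed

text \<open>Subtracting the two equations gives \<open>2 x = (g' - g) x\<close>. In the maximum norm
  \<open>M\<close> of \<open>x\<close> this reads \<open>2 M \<le> n / (n + 1) * M\<close>, which
  forces \<open>M = 0\<close>.\<close>

lemma close_involutions_eigenvector:
  assumes g: "g \<in> carrier_mat n n" and g': "g' \<in> carrier_mat n n"
    and close: "\<And>r c. r < n \<Longrightarrow> c < n \<Longrightarrow> \<bar>g' $$ (r, c) - g $$ (r, c)\<bar> < 1 / (real n + 1)"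
    and x: "x \<in> carrier_vec n" and gx: "g *\<^sub>v x = - x" and g'x: "g' *\<^sub>v x = x"
  shows "x = 0\<^sub>v n"
proof (rule ccontr)
  assume "x \<noteq> 0\<^sub>v n"
  then obtain i where i: "i < n" "x $ i \<noteq> 0" using x by (auto simp: vec_eq_iff)
  define M where "M = Max ((\<lambda>i. \<bar>x $ i\<bar>) ` {..<n})"
  have ge: "\<bar>x $ c\<bar> \<le> M" if "c < n" for c unfolding M_def using that by (intro Max_ge) auto
  have "M \<in> (\<lambda>i. \<bar>x $ i\<bar>) ` {..<n}" unfolding M_def using i by (intro Max_in) auto
  then obtain m where m: "m < n" "M = \<bar>x $ m\<bar>" by auto
  have Mpos: "M > 0" using ge[OF i(1)] i by auto
  have "2 * x $ m = (g' *\<^sub>v x) $ m - (g *\<^sub>v x) $ m" using gx g'x m x by simp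
  also have "\<dots> = (\<Sum>c<n. (g' $$ (m, c) - g $$ (m, c)) * x $ c)"
    by (simp add: mult_mat_vec_nth[OF g x m(1)] mult_mat_vec_nth[OF g' x m(1)] sum_subtractf
        left_diff_distrib del: index_mult_mat_vec)
  finally have "2 * M = \<bar>\<Sum>c<n. (g' $$ (m, c) - g $$ (m, c)) * x $ c\<bar>" using m by simp
  also have "\<dots> \<le> (\<Sum>c<n. \<bar>(g' $$ (m, c) - g $$ (m, c)) * x $ c\<bar>)" by (rule sum_abs)
  also have "\<dots> \<le> (\<Sum>c<n. 1 / (real n + 1) * M)"
  proof (rule sum_mono)
    fix c assume "c \<in> {..<n}"
    then have c: "c < n" by simp
    show "\<bar>(g' $$ (m, c) - g $$ (m, c)) * x $ c\<bar> \<le> 1 / (real n + 1) * M"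
      unfolding abs_mult using close[OF m(1) c] ge[OF c] by (intro mult_mono) auto
  qed
  also have "\<dots> = real n / (real n + 1) * M" by simp
  also have "\<dots> \<le> 1 * M" using Mpos by (intro mult_right_mono) auto
  finally show False using Mpos by simp
qed

section \<open>Projections between nearby eigenspaces\<close>

lemma neg_projection_mem:
  assumes g: "g \<in> carrier_mat n n" and gg: "g * g = 1\<^sub>m n" and x: "x \<in> carrier_vec n"
  shows "(1/2) \<cdot>\<^sub>v (x - g *\<^sub>v x) \<in> neg_eigenspace n g"
proof -
  have gx: "g *\<^sub>v x \<in> carrier_vec n" using g x by auto
  have "g *\<^sub>v ((1/2) \<cdot>\<^sub>v (x - g *\<^sub>v x)) = (1/2) \<cdot>\<^sub>v (g *\<^sub>v (x - g *\<^sub>v x))"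
    using mult_mat_vec[OF g, of "x - g *\<^sub>v x" "1/2"] gx x by simp
  also have "g *\<^sub>v (x - g *\<^sub>v x) = g *\<^sub>v x - g *\<^sub>v (g *\<^sub>v x)"
    by (rule mult_minus_distrib_mat_vec[OF g x gx])
  also have "g *\<^sub>v (g *\<^sub>v x) = x"
    using assoc_mult_mat_vec[OF g g x] gg x by simp
  also have "(1/2) \<cdot>\<^sub>v (g *\<^sub>v x - x) = - ((1/2) \<cdot>\<^sub>v (x - g *\<^sub>v x))"
    using x gx g by (intro eq_vecI) (simp_all add: field_simps del: index_mult_mat_vec)
  finally show ?thesis using x gx by (simp add: neg_eigenspace_def)
qed

lemma neg_projection_eq_0D:
  fixes g :: "real mat"
  assumes g: "g \<in> carrier_mat n n" and x: "x \<in> carrier_vec n"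
    and 0: "(1/2) \<cdot>\<^sub>v (x - g *\<^sub>v x) = 0\<^sub>v n"
  shows "g *\<^sub>v x = x"
proof (rule eq_vecI)
  fix r assume "r < dim_vec x"
  then have r: "r < n" using x by simp
  then have "((1/2) \<cdot>\<^sub>v (x - g *\<^sub>v x)) $ r = 0" using 0 by simp
  then show "(g *\<^sub>v x) $ r = x $ r" using r x g by (simp del: index_mult_mat_vec)
qed (use g x in auto)

definition neg_proj_mat :: "real mat \<Rightarrow> real mat \<Rightarrow> real mat" where
  "neg_proj_mat g A = (1/2) \<cdot>\<^sub>m (A - g * A)"

lemma neg_proj_mat_carrier [simp]:
  "g \<in> carrier_mat n n \<Longrightarrow> A \<in> carrier_mat n k \<Longrightarrow> neg_proj_mat g A \<in> carrier_mat n k"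
  unfolding neg_proj_mat_def by (intro smult_carrier_mat minus_carrier_mat mult_carrier_mat)

lemma neg_proj_mat_mult_vec:
  assumes g: "g \<in> carrier_mat n n" and A: "A \<in> carrier_mat n k" and y: "y \<in> carrier_vec k"
  shows "neg_proj_mat g A *\<^sub>v y = (1/2) \<cdot>\<^sub>v (A *\<^sub>v y - g *\<^sub>v (A *\<^sub>v y))"
proof -
  have gA: "g * A \<in> carrier_mat n k" using g A by auto
  have "neg_proj_mat g A *\<^sub>v y = (1/2) \<cdot>\<^sub>v ((A - g * A) *\<^sub>v y)"
    unfolding neg_proj_mat_def using gA A y
    by (intro eq_vecI) (auto simp: scalar_prod_def sum_distrib_left mult.assoc)
  also have "(A - g * A) *\<^sub>v y = A *\<^sub>v y - (g * A) *\<^sub>v y"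
    by (rule minus_mult_distrib_mat_vec[OF A gA y])
  also have "(g * A) *\<^sub>v y = g *\<^sub>v (A *\<^sub>v y)" by (rule assoc_mult_mat_vec[OF g A y])
  finally show ?thesis .
qed

lemma neg_proj_mat_col:
  assumes g: "g \<in> carrier_mat n n" and A: "A \<in> carrier_mat n k" and c: "c < k"
  shows "col (neg_proj_mat g A) c = (1/2) \<cdot>\<^sub>v (col A c - g *\<^sub>v col A c)"
  using assms by (intro eq_vecI) (auto simp: neg_proj_mat_def)

text \<open>A vector of the eigenspace of \<open>g\<close> killed by the projection for
  \<open>g'\<close> would be negated by \<open>g\<close> and fixed by \<open>g'\<close>, so the
  projection is injective there; the same holds in the other direction. Projecting to and fro is
  thus an injective endomorphism, hence invertible, and surjectivity follows without comparing
  dimensions.\<close>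

lemma neg_proj_mat_ordered_basis:
  assumes g: "g \<in> carrier_mat n n" "g * g = 1\<^sub>m n" and g': "g' \<in> carrier_mat n n" "g' * g' = 1\<^sub>m n"
    and close: "\<And>r c. r < n \<Longrightarrow> c < n \<Longrightarrow> \<bar>g' $$ (r, c) - g $$ (r, c)\<bar> < 1 / (real n + 1)"
    and A: "ordered_basis n (neg_eigenspace n g) A"
  shows "ordered_basis n (neg_eigenspace n g') (neg_proj_mat g' A)"
proof -
  define k where "k = dim_col A"
  have Ac: "A \<in> carrier_mat n k" using A by (auto simp: ordered_basis_def k_def)
  define B where "B = neg_proj_mat g' A"
  have Bc: "B \<in> carrier_mat n k" using g' Ac by (simp add: B_def)
  have Bcol: "col B c \<in> neg_eigenspace n g'" if "c < k" for c
    unfolding B_def neg_proj_mat_col[OF g'(1) Ac that]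
    by (rule neg_projection_mem[OF g']) (use Ac that in auto)
  have By: "B *\<^sub>v y \<in> neg_eigenspace n g'" if "y \<in> carrier_vec k" for y
    by (rule neg_eigenspace_combination[OF g'(1) Bc Bcol that])
  have Ay: "A *\<^sub>v y \<in> neg_eigenspace n g" if "y \<in> carrier_vec k" for y
    by (rule neg_eigenspace_combination[OF g(1) Ac _ that])
      (use A in \<open>auto simp: ordered_basis_def k_def\<close>)
  have injB: "y = 0\<^sub>v k" if y: "y \<in> carrier_vec k" and 0: "B *\<^sub>v y = 0\<^sub>v n" for y
  proof -
    note a = neg_eigenspaceD[OF Ay[OF y]]
    have fix': "g' *\<^sub>v (A *\<^sub>v y) = A *\<^sub>v y"
      by (rule neg_projection_eq_0D[OF g'(1) a(1)])
        (use 0 neg_proj_mat_mult_vec[OF g'(1) Ac y] in \<open>simp add: B_def\<close>)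
    have "A *\<^sub>v y = 0\<^sub>v n" by (rule close_involutions_eigenvector[OF g(1) g'(1) close a fix'])
    then have eq: "A *\<^sub>v y = A *\<^sub>v 0\<^sub>v k" using Ac by (auto simp: scalar_prod_def intro!: eq_vecI)
    show ?thesis by (rule ordered_basis_inj[OF A g(1) _ _ eq]) (use y in \<open>simp_all add: k_def\<close>)
  qed
  have injQ: "x = 0\<^sub>v n" if x: "x \<in> neg_eigenspace n g'" and 0: "(1/2) \<cdot>\<^sub>v (x - g *\<^sub>v x) = 0\<^sub>v n" for x
  proof (rule close_involutions_eigenvector[OF g'(1) g(1) _ neg_eigenspaceD[OF x]])
    show "\<bar>g $$ (r, c) - g' $$ (r, c)\<bar> < 1 / (real n + 1)" if "r < n" "c < n" for r c
      using close[OF that] by (simp add: abs_minus_commute)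
    show "g *\<^sub>v x = x" by (rule neg_projection_eq_0D[OF g(1) neg_eigenspaceD(1)[OF x] 0])
  qed
  have Q: "neg_proj_mat g B \<in> carrier_mat n k" using g Bc by simp
  have Qcol: "col (neg_proj_mat g B) c \<in> neg_eigenspace n g" if "c < k" for c
    unfolding neg_proj_mat_col[OF g(1) Bc that]
    by (rule neg_projection_mem[OF g]) (use Bc that in auto)
  \<comment> \<open>\<open>C\<close> is the matrix, in the basis \<open>A\<close>, of projecting to
    the eigenspace of \<open>g'\<close> and back.\<close>
  obtain C where C: "C \<in> carrier_mat k k" "neg_proj_mat g B = A * C"
    using ordered_basis_coordinates[OF A k_def[symmetric] Q Qcol] by blast
  have "det C \<noteq> 0"
  proof
    assume "det C = 0"
    then obtain y where y: "y \<in> carrier_vec k" "y \<noteq> 0\<^sub>v k" "C *\<^sub>v y = 0\<^sub>v k"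
      using det_0_iff_vec_prod_zero[OF C(1)] by blast
    have "neg_proj_mat g B *\<^sub>v y = A *\<^sub>v 0\<^sub>v k"
      using assoc_mult_mat_vec[OF Ac C(1) y(1)] C y by simp
    also have "\<dots> = 0\<^sub>v n" using Ac by (auto simp: scalar_prod_def intro!: eq_vecI)
    finally have "B *\<^sub>v y = 0\<^sub>v n"
      unfolding neg_proj_mat_mult_vec[OF g(1) Bc y(1)] by (rule injQ[OF By[OF y(1)]])
    with injB y show False by blast
  qed
  then obtain C' where C': "C' \<in> carrier_mat k k" "C * C' = 1\<^sub>m k"
    using det_nonzero_inverse[OF C(1)] by blast
  have sub0: "x = y" if "x - y = 0\<^sub>v m" "x \<in> carrier_vec m" "y \<in> carrier_vec m" for x y :: "real vec" and m
    using that by (auto simp: vec_eq_iff)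
  have half_diff: "(1/2) \<cdot>\<^sub>v (a - b - (c - d)) = (1/2) \<cdot>\<^sub>v (a - c) - (1/2) \<cdot>\<^sub>v (b - d)"
    if "a \<in> carrier_vec n" "b \<in> carrier_vec n" "c \<in> carrier_vec n" "d \<in> carrier_vec n" for a b c d :: "real vec"
    using that by (intro eq_vecI) (auto simp: field_simps)
  show ?thesis unfolding B_def[symmetric] ordered_basis_def
  proof (intro conjI allI impI ballI)
    show "dim_row B = n" using Bc by simp
    show "col B c \<in> neg_eigenspace n g'" if "c < dim_col B" for c
      using Bcol that Bc by simp
    fix x assume x: "x \<in> neg_eigenspace n g'"
    note xc = neg_eigenspaceD(1)[OF x]
    have Qx: "(1/2) \<cdot>\<^sub>v (x - g *\<^sub>v x) \<in> neg_eigenspace n g" by (rule neg_projection_mem[OF g xc])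
    then obtain y0 where y0: "y0 \<in> carrier_vec k" "A *\<^sub>v y0 = (1/2) \<cdot>\<^sub>v (x - g *\<^sub>v x)"
      using A unfolding ordered_basis_def k_def by blast
    define y where "y = C' *\<^sub>v y0"
    have y: "y \<in> carrier_vec k" using C' y0 by (simp add: y_def)
    have Cy: "C *\<^sub>v y = y0" unfolding y_def using assoc_mult_mat_vec[OF C(1) C'(1) y0(1)] C' y0 by simp
    note Byc = neg_eigenspaceD[OF By[OF y]]
    have "(1/2) \<cdot>\<^sub>v (B *\<^sub>v y - g *\<^sub>v (B *\<^sub>v y)) = A *\<^sub>v y0"
      using neg_proj_mat_mult_vec[OF g(1) Bc y] C(2) assoc_mult_mat_vec[OF Ac C(1) y] Cy by simp
    then have e: "(1/2) \<cdot>\<^sub>v (B *\<^sub>v y - g *\<^sub>v (B *\<^sub>v y)) = (1/2) \<cdot>\<^sub>v (x - g *\<^sub>v x)" using y0 by simp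
    have "B *\<^sub>v y - x = 0\<^sub>v n"
    proof (rule injQ)
      show "B *\<^sub>v y - x \<in> neg_eigenspace n g'"
        using mult_minus_distrib_mat_vec[OF g'(1) Byc(1) xc] Byc neg_eigenspaceD[OF x] Bc
        by (auto simp: neg_eigenspace_def intro!: eq_vecI simp del: index_mult_mat_vec)
      have "(1/2) \<cdot>\<^sub>v (B *\<^sub>v y - x - g *\<^sub>v (B *\<^sub>v y - x)) =
          (1/2) \<cdot>\<^sub>v (B *\<^sub>v y - g *\<^sub>v (B *\<^sub>v y)) - (1/2) \<cdot>\<^sub>v (x - g *\<^sub>v x)"
        unfolding mult_minus_distrib_mat_vec[OF g(1) Byc(1) xc]
        by (rule half_diff) (use Byc(1) xc g in \<open>auto intro!: mult_mat_vec_carrier\<close>)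
      then show "(1/2) \<cdot>\<^sub>v (B *\<^sub>v y - x - g *\<^sub>v (B *\<^sub>v y - x)) = 0\<^sub>v n"
        unfolding e using xc g by (auto intro!: eq_vecI simp del: index_mult_mat_vec)
    qed
    then have Byx: "B *\<^sub>v y = x" using sub0 Byc(1) xc by blast
    show "\<exists>!y. y \<in> carrier_vec (dim_col B) \<and> B *\<^sub>v y = x"
    proof (rule ex1I[of _ y])
      show "y \<in> carrier_vec (dim_col B) \<and> B *\<^sub>v y = x" using y Byx Bc by simp
      fix z assume z: "z \<in> carrier_vec (dim_col B) \<and> B *\<^sub>v z = x"
      then have zc: "z \<in> carrier_vec k" using Bc by simp
      have "z - y = 0\<^sub>v k"
        by (rule injB) (use zc y z Byx mult_minus_distrib_mat_vec[OF Bc zc y] xc in auto)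
      then show "z = y" using sub0 zc y by blast
    qed
  qed
qed

text \<open>Over a short interval a frame is continued by projecting it onto the moving eigenspaces.
  Pieces can be glued because each may start from an arbitrary basis. The bisection principle
  \<open>Bolzano\<close> combines the two facts into a frame over the whole interval.\<close>

lemma frame_lift:
  assumes g: "\<And>t. t \<in> {0..1} \<Longrightarrow> g t \<in> carrier_mat n n" "\<And>t. t \<in> {0..1} \<Longrightarrow> g t * g t = 1\<^sub>m n"
    and cont: "\<And>r c. r < n \<Longrightarrow> c < n \<Longrightarrow> continuous_on {0..1} (\<lambda>t. g t $$ (r, c))"
    and A: "ordered_basis n (neg_eigenspace n (g 0)) A" "dim_col A = k"
  obtains F where "mat_path n k F" "F 0 = A"
    "\<And>t. t \<in> {0..1} \<Longrightarrow> ordered_basis n (neg_eigenspace n (g t)) (F t)"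
proof -
  \<comment> \<open>Clamping the parameter makes the path defined and continuous on all reals; the
    local step of \<open>Bolzano\<close> also concerns intervals that stick out of the unit
    interval.\<close>
  define h where "h t = g (max 0 (min 1 t))" for t :: real
  have mm: "max 0 (min 1 t) \<in> {0..1}" for t :: real by auto
  have h: "h t \<in> carrier_mat n n" "h t * h t = 1\<^sub>m n" for t
    using g[OF mm] by (auto simp: h_def)
  have hcont: "continuous_on UNIV (\<lambda>t. h t $$ (r, c))" if "r < n" "c < n" for r c
    unfolding h_def
    by (rule continuous_on_compose2[OF cont[OF that]]) (auto intro!: continuous_intros)
  define P where "P a b \<longleftrightarrow> (\<forall>A. ordered_basis n (neg_eigenspace n (h a)) A \<and> dim_col A = k \<longrightarrow>
    (\<exists>F. (\<forall>t\<in>{a..b}. F t \<in> carrier_mat n k \<and> ordered_basis n (neg_eigenspace n (h t)) (F t)) \<and>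
      (\<forall>r<n. \<forall>c<k. continuous_on {a..b} (\<lambda>t. F t $$ (r, c))) \<and> F a = A))" for a b :: real
  have P01: "P 0 1"
  proof (rule Bolzano)
    show "(0::real) \<le> 1" by simp
  next
    fix a b c :: real
    assume trans: "P a b" "P b c" "a \<le> b" "b \<le> c"
    show "P a c" unfolding P_def
    proof (intro allI impI)
      fix A assume A: "ordered_basis n (neg_eigenspace n (h a)) A \<and> dim_col A = k"
      obtain F1 where F1: "\<And>t. t \<in> {a..b} \<Longrightarrow> F1 t \<in> carrier_mat n k \<and> ordered_basis n (neg_eigenspace n (h t)) (F1 t)"
        "\<And>r c. r < n \<Longrightarrow> c < k \<Longrightarrow> continuous_on {a..b} (\<lambda>t. F1 t $$ (r, c))" "F1 a = A"
        using trans(1)[unfolded P_def, rule_format, OF A] by blast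
      have "ordered_basis n (neg_eigenspace n (h b)) (F1 b) \<and> dim_col (F1 b) = k"
        using F1(1)[of b] trans(3) by auto
      from trans(2)[unfolded P_def, rule_format, OF this] obtain F2 where F2: "\<And>t. t \<in> {b..c} \<Longrightarrow> F2 t \<in> carrier_mat n k \<and> ordered_basis n (neg_eigenspace n (h t)) (F2 t)"
        "\<And>r c'. r < n \<Longrightarrow> c' < k \<Longrightarrow> continuous_on {b..c} (\<lambda>t. F2 t $$ (r, c'))" "F2 b = F1 b"
        by blast
      define F where "F t = (if t \<le> b then F1 t else F2 t)" for t
      have "continuous_on {a..c} (\<lambda>t. F t $$ (r, c'))" if "r < n" "c' < k" for r c'
      proof -
        have "continuous_on ({a..b} \<union> {b..c}) (\<lambda>t. if t \<le> b then F1 t $$ (r, c') else F2 t $$ (r, c'))"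
          using F1(2)[OF that] F2(2)[OF that] F2(3) by (intro continuous_on_cases) auto
        moreover have "{a..b} \<union> {b..c} = {a..c}" using trans(3,4) by auto
        moreover have "(\<lambda>t. F t $$ (r, c')) = (\<lambda>t. if t \<le> b then F1 t $$ (r, c') else F2 t $$ (r, c'))"
          by (auto simp: F_def)
        ultimately show ?thesis by (simp only:)
      qed
      then show "\<exists>F. (\<forall>t\<in>{a..c}. F t \<in> carrier_mat n k \<and> ordered_basis n (neg_eigenspace n (h t)) (F t)) \<and>
        (\<forall>r<n. \<forall>c'<k. continuous_on {a..c} (\<lambda>t. F t $$ (r, c'))) \<and> F a = A"
        using F1 F2 trans(3) by (intro exI[of _ F]) (auto simp: F_def)
    qed
  next
    fix x :: real
    \<comment> \<open>Half the tolerance of \<open>close_involutions_eigenvector\<close>, so that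
      any two parameters near \<open>x\<close> are within the full tolerance of each other.\<close>
    have "eventually (\<lambda>t. \<forall>p\<in>{..<n}\<times>{..<n}. \<bar>h t $$ p - h x $$ p\<bar> < 1 / (2 * (real n + 1))) (nhds x)"
    proof (intro eventually_ball_finite ballI)
      fix p assume "p \<in> {..<n}\<times>{..<n}"
      then obtain r c where p: "p = (r, c)" "r < n" "c < n" by auto
      have "isCont (\<lambda>t. h t $$ (r, c)) x" using hcont[OF p(2,3)] by (simp add: continuous_on_eq_continuous_at)
      then have "((\<lambda>t. h t $$ (r, c)) \<longlongrightarrow> h x $$ (r, c)) (nhds x)"
        using tendsto_at_iff_tendsto_nhds[of "\<lambda>t. h t $$ (r, c)" x] by (simp add: isCont_def)
      then have "eventually (\<lambda>t. dist (h t $$ (r, c)) (h x $$ (r, c)) < 1 / (2 * (real n + 1))) (nhds x)"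
        by (rule tendstoD) simp
      then show "eventually (\<lambda>t. \<bar>h t $$ p - h x $$ p\<bar> < 1 / (2 * (real n + 1))) (nhds x)"
        by (simp add: dist_real_def p)
    qed simp
    then obtain d where d: "d > 0" "\<And>t r c. dist t x < d \<Longrightarrow> r < n \<Longrightarrow> c < n \<Longrightarrow>
        \<bar>h t $$ (r, c) - h x $$ (r, c)\<bar> < 1 / (2 * (real n + 1))"
      unfolding eventually_nhds_metric by auto
    show "\<exists>d>0. \<forall>a b. a \<le> x \<and> x \<le> b \<and> b - a < d \<longrightarrow> P a b"
    proof (intro exI[of _ d] conjI d(1) allI impI)
      fix a b assume ab: "a \<le> x \<and> x \<le> b \<and> b - a < d"
      have close: "\<bar>h t $$ (r, c) - h a $$ (r, c)\<bar> < 1 / (real n + 1)" if "t \<in> {a..b}" "r < n" "c < n" for t r c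
      proof -
        define e where "e = 1 / (2 * (real n + 1))"
        have "\<bar>h t $$ (r, c) - h x $$ (r, c)\<bar> < e" unfolding e_def
          by (rule d(2)) (use that ab in \<open>auto simp: dist_real_def\<close>)
        moreover have "\<bar>h a $$ (r, c) - h x $$ (r, c)\<bar> < e" unfolding e_def
          by (rule d(2)) (use that ab in \<open>auto simp: dist_real_def\<close>)
        ultimately have "\<bar>h t $$ (r, c) - h a $$ (r, c)\<bar> < 2 * e" by linarith
        also have "2 * e = 1 / (real n + 1)" by (simp add: e_def field_simps)
        finally show ?thesis .
      qed
      show "P a b" unfolding P_def
      proof (intro allI impI)
        fix A assume A: "ordered_basis n (neg_eigenspace n (h a)) A \<and> dim_col A = k"
        have Ac: "A \<in> carrier_mat n k" using A by (auto simp: ordered_basis_def)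
        define F where "F t = (if t = a then A else neg_proj_mat (h t) A)" for t
        have Fa: "neg_proj_mat (h a) A = A"
        proof (rule mat_col_eqI)
          fix c assume "c < dim_col A"
          then have c: "c < k" "col A c \<in> neg_eigenspace n (h a)"
            using A by (auto simp: ordered_basis_def)
          show "col (neg_proj_mat (h a) A) c = col A c"
            unfolding neg_proj_mat_col[OF h(1) Ac c(1)] neg_eigenspaceD(2)[OF c(2)]
            using Ac by (auto intro!: eq_vecI)
        qed (use Ac h(1)[of a] in \<open>auto simp: neg_proj_mat_def\<close>)
        then have F: "F t = neg_proj_mat (h t) A" for t by (simp add: F_def)
        have "continuous_on {a..b} (\<lambda>t. F t $$ (r, c))" if "r < n" "c < k" for r c
        proof -
          have Frc: "F t $$ (r, c) = 1/2 * (A $$ (r, c) - (\<Sum>x<n. h t $$ (r, x) * A $$ (x, c)))" for t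
            unfolding F neg_proj_mat_def using that Ac h(1)[of t]
            by (simp add: mult_mat_nth[OF h(1) Ac] del: index_mult_mat(1))
          have "continuous_on {a..b} (\<lambda>t. h t $$ (r, x))" if "x < n" for x
            by (rule continuous_on_subset[OF hcont]) (use that \<open>r < n\<close> in auto)
          then show ?thesis unfolding Frc by (auto intro!: continuous_intros)
        qed
        moreover have "F t \<in> carrier_mat n k" for t unfolding F using h Ac by simp
        moreover have "ordered_basis n (neg_eigenspace n (h t)) (F t)" if "t \<in> {a..b}" for t
          unfolding F by (rule neg_proj_mat_ordered_basis[OF h h close]) (use that A in auto)
        moreover have "F a = A" by (simp add: F_def)
        ultimately show "\<exists>F. (\<forall>t\<in>{a..b}. F t \<in> carrier_mat n k \<and> ordered_basis n (neg_eigenspace n (h t)) (F t)) \<and>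
          (\<forall>r<n. \<forall>c<k. continuous_on {a..b} (\<lambda>t. F t $$ (r, c))) \<and> F a = A" by blast
      qed
    qed
  qed
  have hg: "h t = g t" if "t \<in> {0..1}" for t using that by (simp add: h_def)
  have "ordered_basis n (neg_eigenspace n (h 0)) A \<and> dim_col A = k" using A hg[of 0] by simp
  from P01[unfolded P_def, rule_format, OF this]
  obtain F where F: "\<And>t. t \<in> {0..1} \<Longrightarrow> F t \<in> carrier_mat n k \<and> ordered_basis n (neg_eigenspace n (h t)) (F t)"
      "\<And>r c. r < n \<Longrightarrow> c < k \<Longrightarrow> continuous_on {0..1} (\<lambda>t. F t $$ (r, c))" "F 0 = A"
    by blast
  show ?thesis
    by (rule that[of F]) (use F hg in \<open>auto simp: mat_path_def\<close>)
qed

section \<open>Orientation signs read off from frames\<close>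

lemma cell_eq: "cell n W = orth_invol n (invol_index n W) \<inter> double_coset n W"
  by (simp add: cell_def double_coset_def)

lemma cell_pathD:
  assumes "cell_path n V W g"
  shows "g 0 = W" "g 1 = V" "\<And>x. x \<in> {0..1} \<Longrightarrow> g x \<in> orth_invol n (invol_index n W)"
    "\<And>x. 0 \<le> x \<Longrightarrow> x < 1 \<Longrightarrow> g x \<in> double_coset n W"
    "\<And>r c. r < n \<Longrightarrow> c < n \<Longrightarrow> continuous_on {0..1} (\<lambda>x. g x $$ (r, c))"
  using assms by (auto simp: cell_path_def mat_path_def cell_eq)

lemma cell_path_card:
  assumes V: "involution_data n v t" and W: "involution_data n w s"
    and g: "cell_path n (spm n v t) (spm n w s) g"
  shows "card (neg_set n v t) = card (neg_set n w s)"
  using orth_involD(5)[OF cell_pathD(3)[OF g, of 1]] cell_pathD(2)[OF g]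
  by (simp add: mat_trace_spm[OF V] invol_index_spm[OF W])

lemma preferred_orientation_iff:
  assumes V: "involution_data n v t" and v: "v permutes {..<n}"
  shows "A \<in> preferred_orientation n (spm n v t) \<longleftrightarrow>
    ordered_basis n (neg_eigenspace n (spm n v t)) A \<and>
    (\<exists>P \<in> carrier_mat (card (neg_set n v t)) (card (neg_set n v t)). det P > 0 \<and> A = frame_mat n v t * P)"
  by (simp add: preferred_orientation_def orientation_of_def preferred_basis_spm[OF V v])

text \<open>The hypothesis \<open>main\<close> ranges over all cell paths because
  \<open>orient_sign\<close> takes one by choice. For positive \<open>\<kappa>\<close> every
  transported frame ends positively, and every positive basis at \<open>V\<close> is reached by
  multiplying one lifted frame by a constant matrix. For negative \<open>\<kappa>\<close> the lift
  of the preferred basis ends outside the preferred orientation, so the two sets differ.\<close>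

lemma orient_sign_eqI:
  assumes V: "involution_data n v t" "v permutes {..<n}" and W: "involution_data n w s" "w permutes {..<n}"
    and path: "cell_path n (spm n v t) (spm n w s) g0" and \<kappa>: "\<kappa> \<noteq> 0"
    and k: "k = card (neg_set n w s)"
    and main: "\<And>g F P Q. cell_path n (spm n v t) (spm n w s) g \<Longrightarrow> mat_path n k F \<Longrightarrow>
      (\<And>x. x \<in> {0..1} \<Longrightarrow> ordered_basis n (neg_eigenspace n (g x)) (F x)) \<Longrightarrow>
      P \<in> carrier_mat k k \<Longrightarrow> Q \<in> carrier_mat k k \<Longrightarrow> det P > 0 \<Longrightarrow>
      F 0 = frame_mat n w s * P \<Longrightarrow> F 1 = frame_mat n v t * Q \<Longrightarrow> \<kappa> * det Q > 0"
  shows "orient_sign n (spm n v t) (spm n w s) = (if \<kappa> > 0 then 1 else -1)"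
proof -
  let ?V = "spm n v t" and ?W = "spm n w s"
  define g where "g = (SOME g. cell_path n ?V ?W g)"
  have g: "cell_path n ?V ?W g" using someI[of "cell_path n ?V ?W" g0] path by (simp add: g_def)
  have kV: "card (neg_set n v t) = k" using cell_path_card[OF V(1) W(1) g] k by simp
  note gD = cell_pathD[OF g] and oD = orth_involD[OF cell_pathD(3)[OF g]]
  have fV: "frame_mat n v t \<in> carrier_mat n k" "dim_col (frame_mat n v t) = k" using kV frame_mat_carrier[of n v t] by auto
  have fW: "frame_mat n w s \<in> carrier_mat n k" "dim_col (frame_mat n w s) = k" using k frame_mat_carrier[of n w s] by auto
  have coord: "\<exists>Q \<in> carrier_mat k k. F 1 = frame_mat n v t * Q"
    if "mat_path n k F" "\<And>x. x \<in> {0..1} \<Longrightarrow> ordered_basis n (neg_eigenspace n (g x)) (F x)" for F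
  proof -
    have F1: "F 1 \<in> carrier_mat n k" using that(1) by (simp add: mat_path_def)
    have "col (F 1) c \<in> neg_eigenspace n ?V" if "c < k" for c
      using \<open>\<And>x. x \<in> {0..1} \<Longrightarrow> ordered_basis n (neg_eigenspace n (g x)) (F x)\<close>[of 1] that F1 gD(2)
      by (auto simp: ordered_basis_def)
    then show ?thesis
      using ordered_basis_coordinates[OF frame_mat_ordered_basis[OF V(1)] fV(2) F1] by blast
  qed
  have "ordered_basis n (neg_eigenspace n (g 0)) (frame_mat n w s)"
    using frame_mat_ordered_basis[OF W(1)] gD(1) by simp
  then obtain F0 where F0: "mat_path n k F0" "F0 0 = frame_mat n w s"
    "\<And>x. x \<in> {0..1} \<Longrightarrow> ordered_basis n (neg_eigenspace n (g x)) (F0 x)"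
    using frame_lift[of g n, OF oD(1) oD(2) gD(5) _ fW(2)] by blast
  obtain Q0 where Q0: "Q0 \<in> carrier_mat k k" "F0 1 = frame_mat n v t * Q0" using coord[OF F0(1,3)] by blast
  have kQ0: "\<kappa> * det Q0 > 0"
    by (rule main[OF g F0(1,3) one_carrier_mat Q0(1) _ _ Q0(2)]) (use F0(2) fW in auto)
  let ?T = "transport n g (preferred_orientation n ?W)"
  note Viff = preferred_orientation_iff[OF V, unfolded kV] 
  note Wiff = preferred_orientation_iff[OF W, folded k]
  show ?thesis
  proof (cases "\<kappa> > 0")
    case True
    have "?T = preferred_orientation n ?V"
    proof (intro equalityI subsetI)
      fix A assume "A \<in> ?T"
      then obtain F m where F: "mat_path n m F" "A = F 1" "F 0 \<in> preferred_orientation n ?W"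
        "\<And>x. x \<in> {0..1} \<Longrightarrow> ordered_basis n (neg_eigenspace n (g x)) (F x)"
        unfolding transport_def by blast
      obtain P where P: "P \<in> carrier_mat k k" "det P > 0" "F 0 = frame_mat n w s * P" using F(3) Wiff by blast
      have "F 0 \<in> carrier_mat n m" using F(1) by (simp add: mat_path_def)
      then have "m = k" using P by auto
      with F have Fk: "mat_path n k F" by simp
      obtain Q where Q: "Q \<in> carrier_mat k k" "F 1 = frame_mat n v t * Q" using coord[OF Fk F(4)] by blast
      have "\<kappa> * det Q > 0" by (rule main[OF g Fk F(4) P(1) Q(1) P(2,3) Q(2)])
      then have "det Q > 0" using True by (simp add: zero_less_mult_iff)
      then show "A \<in> preferred_orientation n ?V"
        unfolding Viff using Q F(2) F(4)[of 1] gD(2) by auto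
    next
      fix A assume "A \<in> preferred_orientation n ?V"
      then obtain P where A: "ordered_basis n (neg_eigenspace n ?V) A"
        and P: "P \<in> carrier_mat k k" "det P > 0" "A = frame_mat n v t * P" unfolding Viff by blast
      have dQ0: "det Q0 > 0" using kQ0 True by (simp add: zero_less_mult_iff)
      then obtain Q' where Q': "Q' \<in> carrier_mat k k" "Q0 * Q' = 1\<^sub>m k"
        using det_nonzero_inverse[OF Q0(1)] by force
      \<comment> \<open>Chosen with \<open>Q0 * R = P\<close> and positive determinant: the frame
        \<open>F0 x * R\<close> still starts in the preferred orientation and ends at
        \<open>A\<close>.\<close>
      define R where "R = Q' * P"
      have R: "R \<in> carrier_mat k k" using Q' P by (simp add: R_def)
      have "det Q0 * det Q' = 1" using det_mult[OF Q0(1) Q'(1)] Q'(2) by simp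
      then have "det Q' > 0" using dQ0 zero_less_mult_pos[of "det Q0" "det Q'"] by simp
      then have dR: "det R > 0" using det_mult[OF Q'(1) P(1)] P by (simp add: R_def)
      define F where "F x = F0 x * R" for x
      have F0c: "F0 x \<in> carrier_mat n k" if "x \<in> {0..1}" for x using F0(1) that by (simp add: mat_path_def)
      have "mat_path n k F" unfolding mat_path_def
      proof (intro conjI ballI allI impI)
        show "F x \<in> carrier_mat n k" if "x \<in> {0..1}" for x using F0c[OF that] R by (simp add: F_def)
        fix r c assume rc: "r < n" "c < k"
        have "continuous_on {0..1} (\<lambda>x. \<Sum>y<k. F0 x $$ (r, y) * R $$ (y, c))"
          using F0(1) rc by (auto simp: mat_path_def intro!: continuous_intros)
        moreover have "continuous_on {0..1} (\<lambda>x. F x $$ (r, c)) \<longleftrightarrow>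
            continuous_on {0..1} (\<lambda>x. \<Sum>y<k. F0 x $$ (r, y) * R $$ (y, c))"
          by (rule continuous_on_cong) (simp_all add: F_def mult_mat_nth[OF F0c R rc] del: index_mult_mat)
        ultimately show "continuous_on {0..1} (\<lambda>x. F x $$ (r, c))" by simp
      qed
      moreover have Fb: "ordered_basis n (neg_eigenspace n (g x)) (F x)" if "x \<in> {0..1}" for x
        unfolding F_def
        by (rule ordered_basis_change[OF F0(3)[OF that] oD(1)[OF that] _ R]) (use F0c[OF that] dR in auto)
      moreover have "F 1 = A"
      proof -
        have "F 1 = frame_mat n v t * (Q0 * R)" unfolding F_def Q0(2) by (rule assoc_mult_mat[OF fV(1) Q0(1) R])
        also have "Q0 * R = (Q0 * Q') * P" unfolding R_def by (rule assoc_mult_mat[OF Q0(1) Q'(1) P(1), symmetric])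
        finally show ?thesis using Q' P by simp
      qed
      moreover have "F 0 \<in> preferred_orientation n ?W"
        unfolding Wiff using Fb[of 0] gD(1) R dR F0(2) by (auto simp: F_def)
      ultimately show "A \<in> ?T" unfolding transport_def by blast
    qed
    then show ?thesis using True by (simp add: orient_sign_def g_def[symmetric] Let_def)
  next
    case False
    have "F0 0 \<in> preferred_orientation n ?W"
      unfolding Wiff using F0(2) F0(3)[of 0] gD(1) fW by (auto intro!: bexI[of _ "1\<^sub>m k"])
    then have "F0 1 \<in> ?T" unfolding transport_def using F0 by blast
    moreover have "F0 1 \<notin> preferred_orientation n ?V"
    proof
      assume "F0 1 \<in> preferred_orientation n ?V"
      then obtain P where P: "P \<in> carrier_mat k k" "det P > 0" "F0 1 = frame_mat n v t * P" unfolding Viff by blast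
      have eq: "frame_mat n v t * P = frame_mat n v t * Q0" using P Q0 by simp
      have "P = Q0"
        by (rule ordered_basis_mult_inj[OF frame_mat_ordered_basis[OF V(1)] _ _ _ eq]) (use P Q0 kV in auto)
      then show False using kQ0 P False \<kappa> by (simp add: zero_less_mult_iff)
    qed
    ultimately have "?T \<noteq> preferred_orientation n ?V" by blast
    then show ?thesis using False by (simp add: orient_sign_def g_def[symmetric] Let_def)
  qed
qed

lemma nonzero_continuous_sign:
  fixes f :: "real \<Rightarrow> real"
  assumes ab: "a \<le> b" and f: "continuous_on {a..b} f" and nz: "\<And>x. x \<in> {a..b} \<Longrightarrow> f x \<noteq> 0"
  shows "f a * f b > 0"
proof (rule ccontr)
  assume "\<not> f a * f b > 0"
  then have "f a < 0 \<and> 0 < f b \<or> f b < 0 \<and> 0 < f a"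
    using nz[of a] nz[of b] ab by (auto simp: zero_less_mult_iff not_less)
  then have "\<exists>x\<ge>a. x \<le> b \<and> f x = 0"
    using IVT'[of f a 0 b] IVT2'[of f b 0 a] ab f by (auto simp: less_imp_le)
  then show False using nz by auto
qed

lemma continuous_on_sel_rows_det:
  assumes F: "mat_path n (length xs) F" and \<tau>: "\<And>c. c \<in> set xs \<Longrightarrow> \<tau> c < n"
  shows "continuous_on {0..1} (\<lambda>x. det (sel_rows \<tau> xs (F x)))"
  by (rule continuous_on_det[where k = "length xs"]) (use assms in \<open>auto simp: mat_path_def\<close>)

text \<open>The minor along a lifted frame is nonzero inside the cell by
  \<open>sel_rows_det_nonzero\<close> and at the end of the path by \<open>nz\<close>, so its sign
  is constant. At each end it is the minor of the preferred basis times the determinant of the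
  coordinates.\<close>

lemma orient_sign_transversal:
  assumes V: "involution_data n v t" "v permutes {..<n}" and W: "involution_data n w s" "w permutes {..<n}"
    and path: "cell_path n (spm n v t) (spm n w s) g0"
    and \<tau>: "\<tau> = w \<or> \<tau> = (\<lambda>c. c)"
    and nz: "frame_det \<tau> (neg_list n w s) v t (neg_list n v t) \<noteq> 0"
  shows "orient_sign n (spm n v t) (spm n w s) =
    (if frame_det \<tau> (neg_list n w s) w s (neg_list n w s) *
        frame_det \<tau> (neg_list n w s) v t (neg_list n v t) > 0 then 1 else -1)"
proof (rule orient_sign_eqI[OF V W path _ refl])
  let ?xs = "neg_list n w s"
  have \<tau>n: "\<tau> c < n" if "c \<in> set ?xs" for c
    using that \<tau> involution_dataD[OF W(1)] neg_set_lt[of c n w s] by auto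
  have nzW: "frame_det \<tau> ?xs w s ?xs \<noteq> 0"
    by (rule frame_det_nonzero[OF W(1) _ \<tau>n]) (use \<tau> in auto)
  show "frame_det \<tau> ?xs w s ?xs * frame_det \<tau> ?xs v t (neg_list n v t) \<noteq> 0" using nz nzW by simp
  fix g F P Q
  let ?k = "card (neg_set n w s)"
  assume g: "cell_path n (spm n v t) (spm n w s) g" and F: "mat_path n ?k F"
    "\<And>x. x \<in> {0..1} \<Longrightarrow> ordered_basis n (neg_eigenspace n (g x)) (F x)"
    and P: "P \<in> carrier_mat ?k ?k" and Q: "Q \<in> carrier_mat ?k ?k" and dP: "det P > 0"
    and F0: "F 0 = frame_mat n w s * P" and F1: "F 1 = frame_mat n v t * Q"
  note gD = cell_pathD[OF g]
  have kV: "card (neg_set n v t) = ?k" by (rule cell_path_card[OF V(1) W(1) g])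
  have fV: "frame_mat n v t \<in> carrier_mat n (length ?xs)" using kV frame_mat_carrier[of n v t] by auto
  have fW: "frame_mat n w s \<in> carrier_mat n (length ?xs)" by auto
  define f where "f x = det (sel_rows \<tau> ?xs (F x))" for x
  have f0: "f 0 = frame_det \<tau> ?xs w s ?xs * det P"
    unfolding f_def F0 using sel_rows_mult[OF fW _ \<tau>n, of P] P det_mult[OF sel_rows_carrier[of \<tau> ?xs "frame_mat n w s"], of P]
      sel_rows_frame_mat[of ?xs n w s \<tau>, OF _ \<tau>n] by simp
  have f1: "f 1 = frame_det \<tau> ?xs v t (neg_list n v t) * det Q"
    unfolding f_def F1 using sel_rows_mult[OF fV _ \<tau>n, of Q] Q det_mult[OF sel_rows_carrier[of \<tau> ?xs "frame_mat n v t"], of Q]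
      sel_rows_frame_mat[of ?xs n v t \<tau>, OF _ \<tau>n] kV by simp
  have dQ: "det Q \<noteq> 0"
  proof (rule ordered_basis_change_det[OF frame_mat_ordered_basis[OF V(1)]])
    show "ordered_basis n (neg_eigenspace n (spm n v t)) (frame_mat n v t * Q)"
      using F(2)[of 1] F1 gD(2) by simp
  qed (use kV Q in auto)
  have "f x \<noteq> 0" if "x \<in> {0..1}" for x
  proof (cases "x = 1")
    case True
    then show ?thesis using f1 nz dQ by simp
  next
    case False
    have Fx: "F x \<in> carrier_mat n ?k" using F(1) that by (simp add: mat_path_def)
    have "g x \<in> double_coset n (spm n w s)" using gD(4)[of x] that False by simp
    then show ?thesis unfolding f_def
      by (rule sel_rows_det_nonzero[OF W(1) _ orth_involD(4)[OF gD(3)[OF that]] F(2)[OF that] _ _ \<tau>])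
        (use Fx in auto)
  qed
  moreover have "continuous_on {0..1} f"
    unfolding f_def by (rule continuous_on_sel_rows_det[OF _ \<tau>n]) (use F in auto)
  ultimately have "f 0 * f 1 > 0" by (intro nonzero_continuous_sign) auto
  then show "frame_det \<tau> ?xs w s ?xs * frame_det \<tau> ?xs v t (neg_list n v t) * det Q > 0"
    unfolding f0 f1 using dP by (simp add: zero_less_mult_iff algebra_simps)
qed



section \<open>Limits of elements of a cell\<close>

lemma tendsto_adj_mat:
  assumes A: "\<And>m. A m \<in> carrier_mat k k" and L: "L \<in> carrier_mat k k"
    and lim: "\<And>r c. r < k \<Longrightarrow> c < k \<Longrightarrow> ((\<lambda>m. A m $$ (r, c)) \<longlongrightarrow> L $$ (r, c)) F"
    and rc: "r < k" "c < k"
  shows "((\<lambda>m. adj_mat (A m) $$ (r, c)) \<longlongrightarrow> (adj_mat L $$ (r, c) :: real)) F"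
proof -
  have adj: "adj_mat B $$ (r, c) = (-1) ^ (c + r) * det (mat_delete B c r)" if "B \<in> carrier_mat k k" for B :: "real mat"
    using that rc by (simp add: adj_mat_def cofactor_def)
  have del: "mat_delete B c r \<in> carrier_mat (k - 1) (k - 1)" if "B \<in> carrier_mat k k" for B :: "real mat"
    using that by (rule mat_delete_carrier)
  show ?thesis unfolding adj[OF A] adj[OF L]
    by (intro tendsto_mult tendsto_const tendsto_det[OF del[OF A] del[OF L]])
      (use lim L rc in \<open>auto simp: mat_delete_def carrier_matD[OF A]\<close>)
qed

text \<open>Serves to pad a square block with arbitrary row and column sets to a matrix on all
  indices below \<open>c\<close>.\<close>

lemma bij_betw_diff_same_card:
  assumes "X \<subseteq> A" "T \<subseteq> A" "finite A" "card X = card T"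
  obtains f where "bij_betw f (A - X) (A - T)"
proof -
  have "card (A - X) = card (A - T)"
    using assms by (simp add: card_Diff_subset finite_subset)
  then show ?thesis using assms(3) that finite_same_card_bij[of "A - X" "A - T"] by auto
qed

text \<open>In \<open>g = a W b\<close> consider the rows \<open>v x\<close> with \<open>x\<close>
  in \<open>X\<close> and the columns below \<open>c\<close>. Triangularity of \<open>a\<close> and
  \<open>b\<close> leaves only intermediate indices \<open>r > w c\<close> with
  \<open>w r < c\<close>, so these rows factor through \<open>T\<close>. As \<open>X\<close> and
  \<open>T\<close> have the same size and \<open>M\<close> is invertible, the square block of
  \<open>a\<close> in this factorization is invertible. The equations for \<open>X\<close> then
  force \<open>b z\<close> to vanish on \<open>T\<close>; hence \<open>W b z\<close> vanishes above
  \<open>w c\<close>, and its entry at \<open>w c\<close> is \<open>s c\<close> times a positive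
  number.\<close>

lemma double_coset_system_solution:
  assumes V: "involution_data n v t" and W: "involution_data n w s"
    and g: "g \<in> double_coset n (spm n w s)" and c: "c < n" and le: "v c \<le> w c"
    and card: "card {x. x < c \<and> w c < v x} = card {x. x < c \<and> w c < w x}"
    and M: "M = mat c c (\<lambda>(x, y). if v c < v x then g $$ (v x, y) else if x = y then 1 else 0)"
    and dM: "det M \<noteq> 0"
    and z: "z \<in> carrier_vec n" "z $ c = 1" "\<And>x. c < x \<Longrightarrow> x < n \<Longrightarrow> z $ x = 0"
    and gz: "\<And>x. x < c \<Longrightarrow> v c < v x \<Longrightarrow> (g *\<^sub>v z) $ v x = 0"
  shows "\<And>r. w c < r \<Longrightarrow> r < n \<Longrightarrow> (g *\<^sub>v z) $ r = 0" "s c * (g *\<^sub>v z) $ w c > 0"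
proof -
  note DV = involution_dataD[OF V] and DW = involution_dataD[OF W]
  obtain a b where a: "a \<in> Bplus n" and b: "b \<in> Bplus n" and gab: "g = a * spm n w s * b"
    using g by (auto simp: double_coset_def)
  note ac = BplusD(1)[OF a] and bc = BplusD(1)[OF b]
  have mv: "g *\<^sub>v x = a *\<^sub>v (spm n w s *\<^sub>v (b *\<^sub>v x))" if x: "x \<in> carrier_vec n" for x
  proof -
    have "g *\<^sub>v x = a * spm n w s *\<^sub>v (b *\<^sub>v x)"
      unfolding gab by (rule assoc_mult_mat_vec[OF _ bc x]) (use ac in auto)
    also have "\<dots> = a *\<^sub>v (spm n w s *\<^sub>v (b *\<^sub>v x))"
      by (rule assoc_mult_mat_vec[OF ac spm_carrier]) (use bc x in auto)
    finally show ?thesis .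
  qed
  have mvn: "(g *\<^sub>v x) $ r = (\<Sum>i<n. a $$ (r, i) * (s i * (b *\<^sub>v x) $ w i))" if x: "x \<in> carrier_vec n" and r: "r < n" for x r
  proof -
    have bx: "b *\<^sub>v x \<in> carrier_vec n" using bc x by simp
    have sbx: "spm n w s *\<^sub>v (b *\<^sub>v x) \<in> carrier_vec n" by (rule mult_mat_vec_carrier[OF spm_carrier bx])
    show ?thesis unfolding mv[OF x]
      by (subst mult_mat_vec_nth[OF ac sbx r]) (auto intro!: sum.cong simp: spm_mult_vec_nth[OF W bx] simp del: index_mult_mat_vec)
  qed
  define X where "X = {x. x < c \<and> w c < v x}"
  define T where "T = {x. x < c \<and> w c < w x}"
  have XT: "X \<subseteq> {..<c}" "T \<subseteq> {..<c}" "card X = card T" using card by (auto simp: X_def T_def)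
  obtain f where f: "bij_betw f ({..<c} - X) ({..<c} - T)"
    by (rule bij_betw_diff_same_card[OF XT(1,2) finite_lessThan XT(3)])
  \<comment> \<open>The block of \<open>a\<close> with rows \<open>v X\<close> and columns
    \<open>w T\<close>, signs included, padded on the complementary rows and columns by the
    permutation matrix of \<open>f\<close>.\<close>
  define A' where "A' = mat c c (\<lambda>(x, y). if x \<in> X \<and> y \<in> T then a $$ (v x, w y) * s y
    else if x \<notin> X \<and> y \<notin> T \<and> y = f x then 1 else 0)"
  have A'c: "A' \<in> carrier_mat c c" by (simp add: A'_def)
  have Mc: "M \<in> carrier_mat c c" by (simp add: M)
  have vn: "v x < n" if "x < c" for x using DV(1)[of x] that c by simp
  have "det A' \<noteq> 0"
  proof
    assume "det A' = 0"
    then have "det (transpose_mat A') = 0" using det_transpose[OF A'c] by simp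
    then obtain p where p: "p \<in> carrier_vec c" "p \<noteq> 0\<^sub>v c" "transpose_mat A' *\<^sub>v p = 0\<^sub>v c"
      using det_0_iff_vec_prod_zero[of "transpose_mat A'" c] A'c by auto
    have A'p: "(\<Sum>x<c. A' $$ (x, y) * p $ x) = 0" if "y < c" for y
    proof -
      have "(transpose_mat A' *\<^sub>v p) $ y = (\<Sum>x<c. transpose_mat A' $$ (y, x) * p $ x)"
        by (rule mult_mat_vec_nth[OF _ p(1) that]) (use A'c in auto)
      also have "\<dots> = (\<Sum>x<c. A' $$ (x, y) * p $ x)" using A'c that by (intro sum.cong) auto
      finally show ?thesis using p(3) that by simp
    qed
    have pX: "p $ x = 0" if x: "x < c" "x \<notin> X" for x
    proof -
      have fx: "f x < c" "f x \<notin> T" using bij_betwE[OF f] x by auto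
      have "A' $$ (x', f x) * p $ x' = (if x' = x then p $ x else 0)" if "x' < c" for x'
        using that fx x bij_betw_imp_inj_on[OF f] by (auto simp: A'_def inj_on_def)
      then have "(\<Sum>x'<c. A' $$ (x', f x) * p $ x') = (\<Sum>x'<c. if x' = x then p $ x else 0)"
        by (intro sum.cong) auto
      then show ?thesis using A'p[OF fx(1)] x by simp
    qed
    have pT: "(\<Sum>x\<in>X. a $$ (v x, w y) * p $ x) = 0" if y: "y \<in> T" for y
    proof -
      have yc: "y < c" "y < n" using y c by (auto simp: T_def)
      have "(\<Sum>x<c. A' $$ (x, y) * p $ x) = (\<Sum>x\<in>X. A' $$ (x, y) * p $ x)"
        using XT pX by (intro sum.mono_neutral_right) auto
      also have "\<dots> = (\<Sum>x\<in>X. s y * (a $$ (v x, w y) * p $ x))"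
        using XT yc y by (intro sum.cong) (auto simp: A'_def)
      also have "\<dots> = s y * (\<Sum>x\<in>X. a $$ (v x, w y) * p $ x)" by (rule sum_distrib_left[symmetric])
      finally show ?thesis using A'p[OF yc(1)] DW(6)[OF yc(2)] by simp
    qed
    \<comment> \<open>A left kernel vector of \<open>A'\<close> is supported on \<open>X\<close>,
      and it annihilates \<open>M\<close> too, because the rows of \<open>M\<close> in
      \<open>X\<close> are the block of \<open>a\<close> times further factors.\<close>
    have "transpose_mat M *\<^sub>v p = 0\<^sub>v c"
    proof (rule eq_vecI)
      fix y assume "y < dim_vec (0\<^sub>v c :: real vec)"
      then have y: "y < c" "y < n" using c by auto
      have "(transpose_mat M *\<^sub>v p) $ y = (\<Sum>x<c. transpose_mat M $$ (y, x) * p $ x)"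
        by (rule mult_mat_vec_nth[OF _ p(1) y(1)]) (use Mc in auto)
      also have "\<dots> = (\<Sum>x<c. M $$ (x, y) * p $ x)" using Mc y by (intro sum.cong) auto
      also have "\<dots> = (\<Sum>x\<in>X. M $$ (x, y) * p $ x)"
        using XT pX by (intro sum.mono_neutral_right) auto
      also have "\<dots> = (\<Sum>x\<in>X. g $$ (v x, y) * p $ x)"
        using XT y le by (intro sum.cong) (auto simp: M X_def)
      also have "\<dots> = (\<Sum>x\<in>X. (\<Sum>i<n. a $$ (v x, i) * (s i * b $$ (w i, y))) * p $ x)"
      proof (intro sum.cong refl)
        fix x assume "x \<in> X"
        then have x: "x < c" "v x < n" using vn by (auto simp: X_def)
        have "g $$ (v x, y) = (g *\<^sub>v unit_vec n y) $ v x"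
          using x y double_coset_carrier[OF g] by simp
        also have "\<dots> = (\<Sum>i<n. a $$ (v x, i) * (s i * b $$ (w i, y)))"
          unfolding mvn[OF unit_vec_carrier x(2)] using y bc DW by (intro sum.cong) auto
        finally show "g $$ (v x, y) * p $ x = (\<Sum>i<n. a $$ (v x, i) * (s i * b $$ (w i, y))) * p $ x" by simp
      qed
      also have "\<dots> = (\<Sum>x\<in>X. \<Sum>i<n. s i * b $$ (w i, y) * (a $$ (v x, i) * p $ x))"
        unfolding sum_distrib_right by (intro sum.cong refl) (simp add: mult_ac)
      also have "\<dots> = (\<Sum>i<n. \<Sum>x\<in>X. s i * b $$ (w i, y) * (a $$ (v x, i) * p $ x))" by (rule sum.swap)
      also have "\<dots> = (\<Sum>i<n. s i * b $$ (w i, y) * (\<Sum>x\<in>X. a $$ (v x, i) * p $ x))"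
        by (simp add: sum_distrib_left)
      also have "\<dots> = (\<Sum>i<n. 0)"
      proof (intro sum.cong refl)
        fix i assume "i \<in> {..<n}"
        then have i: "i < n" by simp
        show "s i * b $$ (w i, y) * (\<Sum>x\<in>X. a $$ (v x, i) * p $ x) = 0"
        proof (cases "i \<le> w c")
          case True
          then have "a $$ (v x, i) = 0" if "x \<in> X" for x
            using that BplusD(2)[OF a, of "v x" i] vn[of x] by (auto simp: X_def)
          then show ?thesis by simp
        next
          case False
          show ?thesis
          proof (cases "w i \<le> y")
            case True
            then have "w i \<in> T" using False y DW(2)[OF i] by (simp add: T_def)
            then show ?thesis using pT[of "w i"] DW(2)[OF i] by simp
          next
            case False
            then have "b $$ (w i, y) = 0" using BplusD(2)[OF b, of "w i" y] DW(1)[OF i] by simp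
            then show ?thesis by simp
          qed
        qed
      qed
      finally show "(transpose_mat M *\<^sub>v p) $ y = 0\<^sub>v c $ y" using y by simp
    qed (use Mc in auto)
    then have "det (transpose_mat M) = 0"
      using det_0_iff_vec_prod_zero[of "transpose_mat M" c] Mc p by auto
    then show False using dM det_transpose[OF Mc] by simp
  qed
  define y where "y = b *\<^sub>v z"
  define y' where "y' = spm n w s *\<^sub>v y"
  have yc: "y \<in> carrier_vec n" "y' \<in> carrier_vec n"
    using bc z by (auto simp: y_def y'_def intro!: mult_mat_vec_carrier)
  have y'n: "y' $ r = s r * y $ w r" if "r < n" for r
    unfolding y'_def by (rule spm_mult_vec_nth[OF W yc(1) that])
  have y0: "y $ r = 0" if "c < r" "r < n" for r
    unfolding y_def using Bplus_mult_vec_zero[OF b z(1) z(3) that] .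
  have ycc: "y $ c = b $$ (c, c)"
    unfolding y_def using Bplus_mult_vec_top[OF b z(1) c z(3)] z(2) by simp
  \<comment> \<open>The part of \<open>b z\<close> on \<open>T\<close>; the equations at
    \<open>v x\<close> for \<open>x\<close> in \<open>X\<close> say exactly that the block
    annihilates it.\<close>
  define u where "u = vec c (\<lambda>x. if x \<in> T then y $ x else 0)"
  have "A' *\<^sub>v u = 0\<^sub>v c"
  proof (rule eq_vecI)
    fix x assume "x < dim_vec (0\<^sub>v c :: real vec)"
    then have x: "x < c" by simp
    have eq: "(A' *\<^sub>v u) $ x = (\<Sum>y<c. A' $$ (x, y) * u $ y)"
      by (rule mult_mat_vec_nth[OF A'c _ x]) (simp add: u_def)
    show "(A' *\<^sub>v u) $ x = 0\<^sub>v c $ x"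
    proof (cases "x \<in> X")
      case True
      have "(A' *\<^sub>v u) $ x = (\<Sum>i\<in>T. A' $$ (x, i) * u $ i)"
        unfolding eq using XT by (intro sum.mono_neutral_right) (auto simp: u_def)
      also have "\<dots> = (\<Sum>i\<in>T. a $$ (v x, w i) * (s (w i) * y $ w (w i)))"
        using XT True x DW c by (intro sum.cong) (auto simp: A'_def u_def T_def)
      also have "\<dots> = (\<Sum>r\<in>w ` T. a $$ (v x, r) * (s r * y $ w r))"
      proof (subst sum.reindex)
        show "inj_on w T" by (rule inj_on_inverseI[of _ w]) (use DW c in \<open>auto simp: T_def\<close>)
      qed simp
      also have "\<dots> = (\<Sum>r<n. a $$ (v x, r) * (s r * y $ w r))"
      proof (rule sum.mono_neutral_left)
        show "w ` T \<subseteq> {..<n}" using DW c by (auto simp: T_def)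
        show "\<forall>r\<in>{..<n} - w ` T. a $$ (v x, r) * (s r * y $ w r) = 0"
        proof
          fix r assume r: "r \<in> {..<n} - w ` T"
          then have rn: "r < n" by simp
          have "w r \<notin> T" using r DW(2)[OF rn] by force
          consider "r < w c" | "r = w c" | "w c < r" by linarith
          then show "a $$ (v x, r) * (s r * y $ w r) = 0"
          proof cases
            assume "w c < r"
            then have "c < w r" using \<open>w r \<notin> T\<close> DW[OF rn] by (auto simp: T_def not_less le_less)
            then show ?thesis using y0[of "w r"] DW(1)[OF rn] by simp
          qed (use BplusD(2)[OF a, of "v x" r] True vn[OF x] in \<open>auto simp: X_def\<close>)
        qed
      qed simp
      also have "\<dots> = (g *\<^sub>v z) $ v x" unfolding mvn[OF z(1) vn[OF x]] by (simp add: y_def)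
      also have "\<dots> = 0" using gz[OF x] True le by (auto simp: X_def)
      finally show ?thesis using x by simp
    next
      case False
      have fx: "f x \<notin> T" using bij_betwE[OF f] x False by auto
      have "A' $$ (x, y) * u $ y = 0" if "y < c" for y
        using that x fx False by (auto simp: A'_def u_def)
      then have "(A' *\<^sub>v u) $ x = (\<Sum>y<c. 0)" unfolding eq by (intro sum.cong) auto
      then show ?thesis using x by simp
    qed
  qed (use A'c in auto)
  moreover have "u \<in> carrier_vec c" by (simp add: u_def)
  ultimately have u0: "u = 0\<^sub>v c"
    using det_0_iff_vec_prod_zero[OF A'c] \<open>det A' \<noteq> 0\<close> by blast
  have yT: "y $ x = 0" if "x \<in> T" for x
    using arg_cong[OF u0, of "\<lambda>u. u $ x"] that by (auto simp: u_def T_def)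
  have y'0: "y' $ r = 0" if r: "w c < r" "r < n" for r
  proof -
    have "w r \<noteq> c" using r DW[OF r(2)] by auto
    then have "w r \<in> T \<or> c < w r" using r DW[OF r(2)] by (auto simp: T_def)
    then show ?thesis using y'n[OF r(2)] yT y0 DW(1)[OF r(2)] by auto
  qed
  have gzy: "g *\<^sub>v z = a *\<^sub>v y'" unfolding mv[OF z(1)] by (simp add: y_def y'_def)
  show "(g *\<^sub>v z) $ r = 0" if "w c < r" "r < n" for r
    unfolding gzy by (rule Bplus_mult_vec_zero[OF a yc(2) y'0 that])
  have wc: "w c < n" using DW c by simp
  have "(g *\<^sub>v z) $ w c = a $$ (w c, w c) * (s c * b $$ (c, c))"
    unfolding gzy using Bplus_mult_vec_top[OF a yc(2) wc y'0] y'n[OF wc] DW[OF c] ycc by simp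
  then have "s c * (g *\<^sub>v z) $ w c = (s c * s c) * (a $$ (w c, w c) * b $$ (c, c))" by simp
  also have "\<dots> > 0" using DW(5)[OF c] BplusD(3)[OF a wc] BplusD(3)[OF b c] by simp
  finally show "s c * (g *\<^sub>v z) $ w c > 0" .
qed

text \<open>
  Near \<open>V\<close> the defining equations of the vector form a perturbation of a diagonal system;
  the remaining equations follow from the rank conditions of the double coset.
\<close>

lemma double_coset_limit_vector:
  assumes V: "involution_data n v t" and W: "involution_data n w s"
    and G: "eventually (\<lambda>m. G m \<in> double_coset n (spm n w s)) Fl"
    and lim: "\<And>r c. r < n \<Longrightarrow> c < n \<Longrightarrow> ((\<lambda>m. G m $$ (r, c)) \<longlongrightarrow> spm n v t $$ (r, c)) Fl"
    and c: "c < n" and le: "v c \<le> w c"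
    and card: "card {x. x < c \<and> w c < v x} = card {x. x < c \<and> w c < w x}"
  shows "\<exists>Z. (\<forall>m. Z m \<in> carrier_vec n \<and> Z m $ c = 1 \<and> (\<forall>x. c < x \<longrightarrow> x < n \<longrightarrow> Z m $ x = 0)) \<and>
    eventually (\<lambda>m. (\<forall>r. w c < r \<longrightarrow> r < n \<longrightarrow> (G m *\<^sub>v Z m) $ r = 0) \<and>
        (\<forall>x<c. v c < v x \<longrightarrow> (G m *\<^sub>v Z m) $ v x = 0) \<and> s c * (G m *\<^sub>v Z m) $ w c > 0) Fl \<and>
    (\<forall>r<n. ((\<lambda>m. (G m *\<^sub>v Z m) $ r) \<longlongrightarrow> (if r = v c then t c else 0)) Fl)"
proof -
  note DV = involution_dataD[OF V] and DW = involution_dataD[OF W]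
  define M where "M g = mat c c (\<lambda>(x, y). if v c < v x then g $$ (v x, y) else if x = y then 1 else 0)" for g :: "real mat"
  define rhs where "rhs g y = (if v c < v y then - g $$ (v y, c) else 0)" for g :: "real mat" and y
  \<comment> \<open>The solution given by Cramer's rule, with coordinate \<open>c\<close> normalized
    to 1. It is defined for every \<open>m\<close>: where the determinant is 0, division gives 0 and
    the prescribed coordinates are unaffected.\<close>
  define Z where "Z m = vec n (\<lambda>x. if x < c then 1 / det (M (G m)) * (\<Sum>y<c. adj_mat (M (G m)) $$ (x, y) * rhs (G m) y)
     else if x = c then 1 else 0)" for m
  have Mc: "M g \<in> carrier_mat c c" for g by (simp add: M_def)
  have vn: "v x < n" if "x < c" for x using DV(1)[of x] that c by simp
  have vinj: "v x = v y \<longleftrightarrow> x = y" if "x \<le> c" "y \<le> c" for x y 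
    using DV(2)[of x] DV(2)[of y] that c by (metis order_le_less_trans)
  have Mlim: "((\<lambda>m. M (G m) $$ (x, y)) \<longlongrightarrow> M (spm n v t) $$ (x, y)) Fl" if "x < c" "y < c" for x y
    using that lim[OF vn[OF that(1)], of y] c by (auto simp: M_def)
  have dM: "det (M (spm n v t)) \<noteq> 0"
  proof -
    \<comment> \<open>At \<open>V\<close> the system is diagonal, since row \<open>v x\<close> of
      \<open>V\<close> has its only nonzero entry in column \<open>x\<close>.\<close>
    have e: "M (spm n v t) $$ (x, y) = (if x = y then if v c < v x then t x else 1 else 0)" if "x < c" "y < c" for x y
      using that vn c vinj[of x y] by (auto simp: M_def)
    have "upper_triangular (M (spm n v t))" using e by (auto simp: upper_triangular_def M_def)
    then have "det (M (spm n v t)) = prod_list (diag_mat (M (spm n v t)))"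
      by (rule det_upper_triangular[OF _ Mc])
    moreover have "0 \<notin> set (diag_mat (M (spm n v t)))"
      using e DV(6) c Mc[of "spm n v t"] by (auto simp: diag_mat_def)
    ultimately show ?thesis by (simp add: prod_list_zero_iff)
  qed
  have detlim: "((\<lambda>m. det (M (G m))) \<longlongrightarrow> det (M (spm n v t))) Fl" by (rule tendsto_det[OF Mc Mc Mlim])
  \<comment> \<open>Column \<open>c\<close> of \<open>V\<close> is concentrated in row
    \<open>v c\<close>, so the right-hand sides, taken from other rows, tend to 0 and the solution
    tends to \<open>e_c\<close>.\<close>
  have rhslim: "((\<lambda>m. rhs (G m) y) \<longlongrightarrow> 0) Fl" if "y < c" for y
  proof (cases "v c < v y")
    case True
    have "((\<lambda>m. - G m $$ (v y, c)) \<longlongrightarrow> - spm n v t $$ (v y, c)) Fl"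
      by (intro tendsto_minus lim vn[OF that] c)
    then show ?thesis using True c vn[OF that] by (simp add: rhs_def)
  qed (simp add: rhs_def)
  have Zc: "Z m \<in> carrier_vec n" for m by (simp add: Z_def)
  have Zlim: "((\<lambda>m. Z m $ x) \<longlongrightarrow> (if x = c then 1 else 0)) Fl" if "x < n" for x
  proof (cases "x < c")
    case True
    have "((\<lambda>m. 1 / det (M (G m)) * (\<Sum>y<c. adj_mat (M (G m)) $$ (x, y) * rhs (G m) y)) \<longlongrightarrow>
        1 / det (M (spm n v t)) * (\<Sum>y<c. adj_mat (M (spm n v t)) $$ (x, y) * 0)) Fl"
      by (intro tendsto_intros detlim dM tendsto_adj_mat[OF Mc Mc Mlim] rhslim True) auto
    then show ?thesis using True that by (simp add: Z_def)
  qed (use that in \<open>simp add: Z_def\<close>)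
  have GZlim: "((\<lambda>m. (G m *\<^sub>v Z m) $ r) \<longlongrightarrow> (if r = v c then t c else 0)) Fl" if r: "r < n" for r
  proof -
    have "((\<lambda>m. \<Sum>x<n. G m $$ (r, x) * Z m $ x) \<longlongrightarrow> (\<Sum>x<n. spm n v t $$ (r, x) * (if x = c then 1 else 0))) Fl"
      by (intro tendsto_intros lim Zlim r) auto
    moreover have "(\<Sum>x<n. spm n v t $$ (r, x) * (if x = c then 1 else 0)) = (if r = v c then t c else 0)"
      using r c by (simp add: if_distrib[of "(*) _"] cong: if_cong)
    moreover have "eventually (\<lambda>m. (\<Sum>x<n. G m $$ (r, x) * Z m $ x) = (G m *\<^sub>v Z m) $ r) Fl"
      using G by eventually_elim (simp add: mult_mat_vec_nth[OF double_coset_carrier Zc r] del: index_mult_mat_vec)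
    ultimately show ?thesis using tendsto_cong[of _ _ Fl] by force
  qed
  have "eventually (\<lambda>m. det (M (G m)) \<noteq> 0) Fl" by (rule tendsto_imp_eventually_ne[OF detlim dM])
  then have ev: "eventually (\<lambda>m. (\<forall>r. w c < r \<longrightarrow> r < n \<longrightarrow> (G m *\<^sub>v Z m) $ r = 0) \<and>
        (\<forall>x<c. v c < v x \<longrightarrow> (G m *\<^sub>v Z m) $ v x = 0) \<and> s c * (G m *\<^sub>v Z m) $ w c > 0) Fl"
    using G
  proof eventually_elim
    case (elim m)
    let ?M = "M (G m)"
    obtain B where B: "B \<in> carrier_mat c c" "?M * B = 1\<^sub>m c" "B = (1 / det ?M) \<cdot>\<^sub>m adj_mat ?M"
      using det_nonzero_inverse[OF Mc elim(1)] by metis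
    define q where "q = vec c (rhs (G m))"
    have Bq: "(B *\<^sub>v q) $ x = Z m $ x" if "x < c" for x
    proof -
      have "(B *\<^sub>v q) $ x = (\<Sum>y<c. B $$ (x, y) * q $ y)"
        by (rule mult_mat_vec_nth[OF B(1) _ that]) (simp add: q_def)
      also have "\<dots> = Z m $ x"
        using that c by (simp add: carrier_matD[OF adj_mat(1)[OF Mc]] Z_def B(3) q_def sum_distrib_left sum_divide_distrib)
      finally show ?thesis .
    qed
    have qc: "q \<in> carrier_vec c" by (simp add: q_def)
    have MBq: "?M *\<^sub>v (B *\<^sub>v q) = q" using assoc_mult_mat_vec[OF Mc[of "G m"] B(1) qc] B(2) qc by simp
    have gz: "(G m *\<^sub>v Z m) $ v x = 0" if x: "x < c" "v c < v x" for x
    proof -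
      have "B *\<^sub>v q \<in> carrier_vec c" by (rule mult_mat_vec_carrier[OF B(1) qc])
      then have "q $ x = (\<Sum>y<c. ?M $$ (x, y) * (B *\<^sub>v q) $ y)"
        using mult_mat_vec_nth[OF Mc[of "G m"] _ x(1), of "B *\<^sub>v q"] MBq by (simp only:)
      also have "\<dots> = (\<Sum>y<c. G m $$ (v x, y) * Z m $ y)"
        using x Bq by (intro sum.cong) (auto simp: M_def simp del: index_mult_mat_vec)
      finally have "(\<Sum>y<c. G m $$ (v x, y) * Z m $ y) = - G m $$ (v x, c)" using x by (simp add: q_def rhs_def)
      moreover have "(G m *\<^sub>v Z m) $ v x = (\<Sum>y<n. G m $$ (v x, y) * Z m $ y)"
        by (rule mult_mat_vec_nth[OF double_coset_carrier[OF elim(2)] Zc vn[OF x(1)]])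
      moreover have "(\<Sum>y<n. G m $$ (v x, y) * Z m $ y) = (\<Sum>y<Suc c. G m $$ (v x, y) * Z m $ y)"
        using c by (intro sum.mono_neutral_right) (auto simp: Z_def)
      ultimately show ?thesis using c by (simp add: Z_def)
    qed
    have z: "Z m $ c = 1" "\<And>x. c < x \<Longrightarrow> x < n \<Longrightarrow> Z m $ x = 0" using c by (auto simp: Z_def)
    show ?case
      using double_coset_system_solution[OF V W elim(2) c le card M_def elim(1) Zc z gz] gz by blast
  qed
  have "\<forall>m. Z m \<in> carrier_vec n \<and> Z m $ c = 1 \<and> (\<forall>x. c < x \<longrightarrow> x < n \<longrightarrow> Z m $ x = 0)"
    using c by (auto simp: Z_def)
  with ev GZlim show ?thesis by blast
qed



text \<open>The mirror image of \<open>double_coset_limit_vector\<close> under reversal of the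
  indices; symmetry of \<open>G m\<close> is what puts the reversed matrix into a double coset
  again.\<close>

lemma double_coset_limit_vector_dual:
  assumes V: "involution_data n v t" and W: "involution_data n w s"
    and G: "eventually (\<lambda>m. G m \<in> double_coset n (spm n w s) \<and> transpose_mat (G m) = G m) Fl"
    and lim: "\<And>r c. r < n \<Longrightarrow> c < n \<Longrightarrow> ((\<lambda>m. G m $$ (r, c)) \<longlongrightarrow> spm n v t $$ (r, c)) Fl"
    and c: "c < n" and le: "w c \<le> v c"
    and card: "card {x. c < x \<and> x < n \<and> v x < w c} = card {x. c < x \<and> x < n \<and> w x < w c}"
  shows "\<exists>Z. (\<forall>m. Z m \<in> carrier_vec n \<and> Z m $ c = 1 \<and> (\<forall>x<c. Z m $ x = 0)) \<and>
    eventually (\<lambda>m. (\<forall>r<w c. (G m *\<^sub>v Z m) $ r = 0) \<and>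
        (\<forall>x. c < x \<longrightarrow> x < n \<longrightarrow> v x < v c \<longrightarrow> (G m *\<^sub>v Z m) $ v x = 0) \<and> s c * (G m *\<^sub>v Z m) $ w c > 0) Fl \<and>
    (\<forall>r<n. ((\<lambda>m. (G m *\<^sub>v Z m) $ r) \<longlongrightarrow> (if r = v c then t c else 0)) Fl)"
proof -
  note DV = involution_dataD[OF V] and DW = involution_dataD[OF W]
  let ?v = "rev_perm n v" and ?w = "rev_perm n w" and ?s = "rev_sgn n s" and ?t = "rev_sgn n t"
  let ?c = "n - 1 - c"
  have cc: "n - 1 - ?c = c" "?c < n" using c by auto
  have wc: "w c < n" "v c < n" using DW(1)[OF c] DV(1)[OF c] by auto
  have wc': "?w ?c = n - 1 - w c" "?v ?c = n - 1 - v c" by (simp_all only: rev_perm_def cc)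
  have set_eq: "{x. x < ?c \<and> ?w ?c < rev_perm n u x} = (\<lambda>x. n - 1 - x) ` {x. c < x \<and> x < n \<and> u x < w c}"
    (is "?L = ?R") if u: "\<And>x. x < n \<Longrightarrow> u x < n" for u
  proof (intro equalityI subsetI)
    fix x assume x: "x \<in> ?L"
    then have "u (n - 1 - x) < n" using u[of "n - 1 - x"] c by auto
    then show "x \<in> ?R" using x wc cc c unfolding wc'
      by (intro image_eqI[of _ _ "n - 1 - x"]) (auto simp: rev_perm_def)
  next
    fix x assume "x \<in> ?R"
    then obtain y where y: "c < y" "y < n" "u y < w c" "x = n - 1 - y" by auto
    then have "n - 1 - x = y" by simp
    then show "x \<in> ?L" using y wc u[OF y(2)] unfolding wc' by (auto simp: rev_perm_def)
  qed
  have inj: "inj_on (\<lambda>x. n - 1 - x) {x. c < x \<and> x < n \<and> u x < w c}" for u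
    by (rule inj_on_inverseI[of _ "\<lambda>x. n - 1 - x"]) auto
  have card': "card {x. x < ?c \<and> ?w ?c < ?v x} = card {x. x < ?c \<and> ?w ?c < ?w x}"
  proof -
    have "{x. x < ?c \<and> ?w ?c < ?v x} = (\<lambda>x. n - 1 - x) ` {x. c < x \<and> x < n \<and> v x < w c}"
      by (rule set_eq) (rule DV(1))
    moreover have "{x. x < ?c \<and> ?w ?c < ?w x} = (\<lambda>x. n - 1 - x) ` {x. c < x \<and> x < n \<and> w x < w c}"
      by (rule set_eq) (rule DW(1))
    ultimately show ?thesis using card by (simp only: card_image[OF inj])
  qed
  have G': "eventually (\<lambda>m. rev_mat n (G m) \<in> double_coset n (spm n ?w ?s)) Fl"
    using G by eventually_elim (rule double_coset_rev[OF W], auto)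
  have lim': "((\<lambda>m. rev_mat n (G m) $$ (r, d)) \<longlongrightarrow> spm n ?v ?t $$ (r, d)) Fl" if "r < n" "d < n" for r d
    using lim[of "n - 1 - r" "n - 1 - d"] that rev_mat_nth[OF that, of "spm n v t"]
    unfolding rev_spm[OF V] by (simp add: rev_mat_nth[OF that])
  have le': "?v ?c \<le> ?w ?c" unfolding wc' using le by simp
  obtain Z' where Z': "\<forall>m. Z' m \<in> carrier_vec n \<and> Z' m $ ?c = 1 \<and> (\<forall>x. ?c < x \<longrightarrow> x < n \<longrightarrow> Z' m $ x = 0)"
    "eventually (\<lambda>m. (\<forall>r. ?w ?c < r \<longrightarrow> r < n \<longrightarrow> (rev_mat n (G m) *\<^sub>v Z' m) $ r = 0) \<and>
        (\<forall>x<?c. ?v ?c < ?v x \<longrightarrow> (rev_mat n (G m) *\<^sub>v Z' m) $ ?v x = 0) \<and> ?s ?c * (rev_mat n (G m) *\<^sub>v Z' m) $ ?w ?c > 0) Fl"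
    "\<forall>r<n. ((\<lambda>m. (rev_mat n (G m) *\<^sub>v Z' m) $ r) \<longlongrightarrow> (if r = ?v ?c then ?t ?c else 0)) Fl"
    using double_coset_limit_vector[OF rev_involution_data[OF V] rev_involution_data[OF W] G' lim' cc(2) le' card']
    by blast
  define Z where "Z m = rev_vec n (Z' m)" for m
  have Zc: "Z m \<in> carrier_vec n" for m by (simp add: Z_def)
  have GZ: "(rev_mat n (G m) *\<^sub>v Z' m) $ (n - 1 - r) = (G m *\<^sub>v Z m) $ r" if "G m \<in> carrier_mat n n" "r < n" for m r
  proof -
    have "rev_vec n (Z m) = Z' m" using Z'(1)[rule_format, of m] by (auto simp: Z_def rev_vec_def intro!: eq_vecI)
    then have "rev_mat n (G m) *\<^sub>v Z' m = rev_vec n (G m *\<^sub>v Z m)"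
      using rev_mat_mult_vec[OF that(1) Zc[of m]] by simp
    then show ?thesis using that(2) by simp
  qed
  have ev: "eventually (\<lambda>m. (\<forall>r<w c. (G m *\<^sub>v Z m) $ r = 0) \<and>
        (\<forall>x. c < x \<longrightarrow> x < n \<longrightarrow> v x < v c \<longrightarrow> (G m *\<^sub>v Z m) $ v x = 0) \<and> s c * (G m *\<^sub>v Z m) $ w c > 0) Fl"
    using Z'(2) G
  proof eventually_elim
    case (elim m)
    have Gc: "G m \<in> carrier_mat n n" using elim(2) double_coset_carrier by blast
    have 1: "(G m *\<^sub>v Z m) $ r = 0" if "r < w c" for r
      using elim(1) GZ[OF Gc, of r] that wc unfolding wc' by auto
    have 2: "(G m *\<^sub>v Z m) $ v x = 0" if x: "c < x" "x < n" "v x < v c" for x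
    proof -
      have vx: "v x < n" "n - 1 - (n - 1 - x) = x" using DV(1) x by auto
      have "n - 1 - x < ?c" "?v ?c < ?v (n - 1 - x)" "?v (n - 1 - x) = n - 1 - v x"
        using x vx wc unfolding wc' by (auto simp: rev_perm_def)
      then show ?thesis using elim(1) GZ[OF Gc vx(1)] by metis
    qed
    have 3: "s c * (G m *\<^sub>v Z m) $ w c > 0"
      using elim(1) GZ[OF Gc wc(1)] unfolding wc' rev_sgn_def cc by simp
    show ?case using 1 2 3 by blast
  qed
  have GZlim: "((\<lambda>m. (G m *\<^sub>v Z m) $ r) \<longlongrightarrow> (if r = v c then t c else 0)) Fl" if r: "r < n" for r
  proof -
    have "((\<lambda>m. (rev_mat n (G m) *\<^sub>v Z' m) $ (n - 1 - r)) \<longlongrightarrow> (if n - 1 - r = ?v ?c then ?t ?c else 0)) Fl"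
      using Z'(3) r by (auto simp del: One_nat_def)
    moreover have "n - 1 - r = ?v ?c \<longleftrightarrow> r = v c" using r wc unfolding wc' by auto
    moreover have "?t ?c = t c" by (simp only: rev_sgn_def cc)
    moreover have "eventually (\<lambda>m. (rev_mat n (G m) *\<^sub>v Z' m) $ (n - 1 - r) = (G m *\<^sub>v Z m) $ r) Fl"
      using G by eventually_elim (rule GZ[OF double_coset_carrier r], auto)
    ultimately show ?thesis using tendsto_cong[of _ _ Fl] by force
  qed
  have "\<forall>m. Z m \<in> carrier_vec n \<and> Z m $ c = 1 \<and> (\<forall>x<c. Z m $ x = 0)"
    using Z'(1) c by (auto simp: Z_def)
  with ev GZlim show ?thesis by blast
qed

text \<open>With the limit vector \<open>z\<close>, coordinate \<open>w c\<close> of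
  \<open>g z\<close> times \<open>s c\<close> is positive along the filter and tends to
  \<open>s c * t c\<close>, because \<open>g z\<close> tends to \<open>V e_c\<close>.\<close>

lemma limit_sign_agree:
  assumes V: "involution_data n v t" and W: "involution_data n w s" and Fl: "Fl \<noteq> bot"
    and G: "eventually (\<lambda>m. G m \<in> double_coset n (spm n w s)) Fl"
    and lim: "\<And>r c. r < n \<Longrightarrow> c < n \<Longrightarrow> ((\<lambda>m. G m $$ (r, c)) \<longlongrightarrow> spm n v t $$ (r, c)) Fl"
    and c: "c < n" and eq: "v c = w c"
    and card: "card {x. x < c \<and> w c < v x} = card {x. x < c \<and> w c < w x}"
  shows "s c = t c"
proof -
  obtain Z where Z: "eventually (\<lambda>m. (\<forall>r. w c < r \<longrightarrow> r < n \<longrightarrow> (G m *\<^sub>v Z m) $ r = 0) \<and>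
        (\<forall>x<c. v c < v x \<longrightarrow> (G m *\<^sub>v Z m) $ v x = 0) \<and> s c * (G m *\<^sub>v Z m) $ w c > 0) Fl"
    "\<forall>r<n. ((\<lambda>m. (G m *\<^sub>v Z m) $ r) \<longlongrightarrow> (if r = v c then t c else 0)) Fl"
    using double_coset_limit_vector[OF V W G lim c eq_refl[OF eq] card] by blast
  have "((\<lambda>m. s c * (G m *\<^sub>v Z m) $ w c) \<longlongrightarrow> s c * t c) Fl"
    using Z(2)[rule_format, of "w c"] involution_dataD(1)[OF W c] eq by (intro tendsto_mult tendsto_const) simp
  moreover have "eventually (\<lambda>m. 0 \<le> s c * (G m *\<^sub>v Z m) $ w c) Fl"
    using Z(1) by eventually_elim auto
  ultimately have "0 \<le> s c * t c" by (rule tendsto_lowerbound[OF _ _ Fl])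
  then show ?thesis using involution_dataD(4)[OF V c] involution_dataD(4)[OF W c] by auto
qed

text \<open>
  With \<open>z \<rightarrow> e\<^sub>i\<close> and \<open>z' \<rightarrow> e\<^sub>j\<close> from the two limit lemmas, orthogonality of \<open>z\<close> and \<open>z'\<close>, hence
  of \<open>g z\<close> and \<open>g z'\<close>, forces the two surviving products of coordinates to have opposite signs.
\<close>

lemma limit_sign_swap:
  assumes V: "involution_data n v t" and W: "involution_data n w s" and Fl: "Fl \<noteq> bot"
    and G: "eventually (\<lambda>m. G m \<in> double_coset n (spm n w s) \<and> G m \<in> orth_invol n q) Fl"
    and lim: "\<And>r c. r < n \<Longrightarrow> c < n \<Longrightarrow> ((\<lambda>m. G m $$ (r, c)) \<longlongrightarrow> spm n v t $$ (r, c)) Fl"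
    and ij: "i < j" "j < n" and k: "v i = k" "w j = k" and l: "v j = l" "w i = l" and kl: "k < l"
    and free: "\<And>m. i < m \<Longrightarrow> m < j \<Longrightarrow> \<not> (k < v m \<and> v m < l)"
    and card1: "{x. x < i \<and> l < v x} = {x. x < i \<and> l < w x}"
    and card2: "{x. j < x \<and> x < n \<and> v x < k} = {x. j < x \<and> x < n \<and> w x < k}"
  shows "t i * t j = - (s i * s j)"
proof -
  note DV = involution_dataD[OF V] and DW = involution_dataD[OF W]
  have i: "i < n" using ij by simp
  have G1: "eventually (\<lambda>m. G m \<in> double_coset n (spm n w s)) Fl" using G by eventually_elim auto
  have G2: "eventually (\<lambda>m. G m \<in> double_coset n (spm n w s) \<and> transpose_mat (G m) = G m) Fl"
    using G by eventually_elim (auto simp: orth_involD(4))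
  have le: "v i \<le> w i" "w j \<le> v j" using k l kl by auto
  have cards: "card {x. x < i \<and> w i < v x} = card {x. x < i \<and> w i < w x}"
    "card {x. j < x \<and> x < n \<and> v x < w j} = card {x. j < x \<and> x < n \<and> w x < w j}"
    using card1 card2 k l by auto
  obtain Z where ZZ: "\<forall>m. Z m \<in> carrier_vec n \<and> Z m $ i = 1 \<and> (\<forall>x. i < x \<longrightarrow> x < n \<longrightarrow> Z m $ x = 0)"
    "eventually (\<lambda>m. (\<forall>r. w i < r \<longrightarrow> r < n \<longrightarrow> (G m *\<^sub>v Z m) $ r = 0) \<and>
        (\<forall>x<i. v i < v x \<longrightarrow> (G m *\<^sub>v Z m) $ v x = 0) \<and> s i * (G m *\<^sub>v Z m) $ w i > 0) Fl"
    "\<forall>r<n. ((\<lambda>m. (G m *\<^sub>v Z m) $ r) \<longlongrightarrow> (if r = v i then t i else 0)) Fl"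
    using double_coset_limit_vector[OF V W G1 lim i le(1) cards(1)] by blast
  have Z: "Z m \<in> carrier_vec n" "i < x \<Longrightarrow> x < n \<Longrightarrow> Z m $ x = 0" for m x using ZZ(1) by auto
  obtain Y where YY: "\<forall>m. Y m \<in> carrier_vec n \<and> Y m $ j = 1 \<and> (\<forall>x<j. Y m $ x = 0)"
    "eventually (\<lambda>m. (\<forall>r<w j. (G m *\<^sub>v Y m) $ r = 0) \<and>
        (\<forall>x. j < x \<longrightarrow> x < n \<longrightarrow> v x < v j \<longrightarrow> (G m *\<^sub>v Y m) $ v x = 0) \<and> s j * (G m *\<^sub>v Y m) $ w j > 0) Fl"
    "\<forall>r<n. ((\<lambda>m. (G m *\<^sub>v Y m) $ r) \<longlongrightarrow> (if r = v j then t j else 0)) Fl"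
    using double_coset_limit_vector_dual[OF V W G2 lim ij(2) le(2) cards(2)] by blast
  have Y: "Y m \<in> carrier_vec n" "x < j \<Longrightarrow> Y m $ x = 0" for m x using YY(1) by auto
  have kn: "k < n" "l < n" using DV(1)[OF i] DV(1)[OF ij(2)] k l by auto
  have "((\<lambda>m. t i * (G m *\<^sub>v Z m) $ k) \<longlongrightarrow> t i * t i) Fl"
    using ZZ(3)[rule_format, OF kn(1)] k by (intro tendsto_mult tendsto_const) simp
  then have e1: "eventually (\<lambda>m. 0 < t i * (G m *\<^sub>v Z m) $ k) Fl"
    by (rule order_tendstoD) (simp add: DV(5)[OF i])
  have "((\<lambda>m. t j * (G m *\<^sub>v Y m) $ l) \<longlongrightarrow> t j * t j) Fl"
    using YY(3)[rule_format, OF kn(2)] l by (intro tendsto_mult tendsto_const) simp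
  then have e2: "eventually (\<lambda>m. 0 < t j * (G m *\<^sub>v Y m) $ l) Fl"
    by (rule order_tendstoD) (simp add: DV(5)[OF ij(2)])
  have "eventually (\<lambda>m. t i * t j = - (s i * s j)) Fl"
    using e1 e2 ZZ(2) YY(2) G
  proof eventually_elim
    case (elim m)
    define g where "g = G m"
    define z where "z = g *\<^sub>v Z m"
    define y where "y = g *\<^sub>v Y m"
    have g: "g \<in> carrier_mat n n" "transpose_mat g * g = 1\<^sub>m n"
      using orth_involD elim(5) by (auto simp: g_def)
    have zc: "z \<in> carrier_vec n" "y \<in> carrier_vec n" using g Z(1) Y(1) by (auto simp: z_def y_def)
    have "y \<bullet> z = (transpose_mat g *\<^sub>v y) \<bullet> Z m"
      unfolding z_def by (rule transpose_vec_mult_scalar[OF g(1) Z(1) zc(2), symmetric])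
    also have "transpose_mat g *\<^sub>v y = Y m"
      unfolding y_def using assoc_mult_mat_vec[of "transpose_mat g" n n g n "Y m"] g Y(1)[of m] by simp
    also have "Y m \<bullet> Z m = 0"
      unfolding scalar_prod_def
    proof (rule sum.neutral, intro ballI)
      fix x assume "x \<in> {0..<dim_vec (Z m)}"
      then have "x < n" using Z(1)[of m] by simp
      then show "Y m $ x * Z m $ x = 0" using Z(2)[of x m] Y(2)[of x m] ij by (cases "x < j") auto
    qed
    finally have "(\<Sum>r\<in>{0..<n}. y $ r * z $ r) = 0" using zc by (simp add: scalar_prod_def)
    moreover have "(\<Sum>r\<in>{0..<n}. y $ r * z $ r) = (\<Sum>r\<in>{k, l}. y $ r * z $ r)"
    proof (rule sum.mono_neutral_right)
      show "\<forall>r\<in>{0..<n} - {k, l}. y $ r * z $ r = 0"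
      proof
        fix r assume "r \<in> {0..<n} - {k, l}"
        then have r: "r < n" "r \<noteq> k" "r \<noteq> l" by auto
        note vr = DV[OF r(1)]
        consider "r < k" | "l < r" | "k < r" "r < l" using r by linarith
        then show "y $ r * z $ r = 0"
        proof cases
          case 1 then show ?thesis using elim(4) k by (simp add: y_def g_def)
        next
          case 2 then show ?thesis using elim(3) l r by (simp add: z_def g_def)
        next
          case 3
          \<comment> \<open>Between \<open>k\<close> and \<open>l\<close>, freeness keeps
            \<open>v r\<close> out of the interval from \<open>i\<close> to \<open>j\<close>. To its
            left the prescribed zeros of \<open>z\<close> apply, to its right those of
            \<open>y\<close>.\<close>
          have "v r \<noteq> i" "v r \<noteq> j" using vr(2) k l r by auto
          moreover have "\<not> (i < v r \<and> v r < j)" using free[of "v r"] vr(2) 3 by auto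
          ultimately consider "v r < i" | "j < v r" by linarith
          then show ?thesis
          proof cases
            case 1
            then have "z $ v (v r) = 0" using elim(3) k vr(2) 3 by (auto simp: z_def g_def)
            then show ?thesis using vr(2) by simp
          next
            case 2
            then have "y $ v (v r) = 0" using elim(4) l vr(1,2) 3 by (auto simp: y_def g_def)
            then show ?thesis using vr(2) by simp
          qed
        qed
      qed
    qed (use kn in auto)
    ultimately have 0: "y $ k * z $ k + y $ l * z $ l = 0" using kl by simp
    have p: "0 < t i * z $ k" "0 < t j * y $ l" "0 < s i * z $ l" "0 < s j * y $ k"
      using elim k l by (auto simp: z_def y_def g_def)
    have "0 < (t i * z $ k) * (s j * y $ k)" "0 < (t j * y $ l) * (s i * z $ l)"
      using p by (auto intro: mult_pos_pos)
    then have "0 < (t i * s j) * (y $ k * z $ k)" "0 < (t j * s i) * (y $ l * z $ l)"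
      by (simp_all add: mult_ac)
    then show ?case
      using 0 DV(4)[OF i] DV(4)[OF ij(2)] DW(4)[OF i] DW(4)[OF ij(2)] by (elim disjE) auto
  qed
  then show ?thesis using Fl by (simp add: eventually_const)
qed



section \<open>Paths in a cell\<close>

lemma mat_trace_mult_commute:
  assumes A: "A \<in> carrier_mat n n" and B: "B \<in> carrier_mat n n"
  shows "mat_trace (A * B) = mat_trace (B * A)"
proof -
  have "mat_trace (A * B) = (\<Sum>r<n. \<Sum>c<n. A $$ (r, c) * B $$ (c, r))"
    using A B by (simp add: mat_trace_def mult_mat_nth[OF A B] del: index_mult_mat(1))
  also have "\<dots> = (\<Sum>c<n. \<Sum>r<n. B $$ (c, r) * A $$ (r, c))"
    by (subst sum.swap) (simp add: mult.commute)
  also have "\<dots> = mat_trace (B * A)"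
    using A B by (simp add: mat_trace_def mult_mat_nth[OF B A] del: index_mult_mat(1))
  finally show ?thesis .
qed

lemma Bplus_inverse:
  assumes Z: "Z \<in> Bplus n"
  obtains B where "B \<in> Bplus n" "Z * B = 1\<^sub>m n" "B * Z = 1\<^sub>m n"
proof -
  note Zc = BplusD(1)[OF Z]
  have "det Z = prod_list (diag_mat Z)"
    by (rule det_upper_triangular[OF _ Zc]) (use Z in \<open>auto simp: Bplus_def\<close>)
  moreover have "0 \<notin> set (diag_mat Z)"
    using BplusD(3)[OF Z] Zc by (force simp: diag_mat_def)
  ultimately have "det Z \<noteq> 0" by (simp add: prod_list_zero_iff)
  then obtain B where B: "B \<in> carrier_mat n n" "Z * B = 1\<^sub>m n" "B * Z = 1\<^sub>m n"
    using det_nonzero_inverse[OF Zc] by metis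
  have ZB: "(Z *\<^sub>v col B c) $ r = (if r = c then 1 else 0)" if "r < n" "c < n" for r c
  proof -
    have "(Z * B) $$ (r, c) = (Z *\<^sub>v col B c) $ r" using that Zc B(1) by simp
    then show ?thesis unfolding B(2) using that by simp
  qed
  have Bc: "col B c \<in> carrier_vec n" for c using B by (auto simp: col_def)
  have low: "col B c $ r = 0" if "c < r" "r < n" for r c
    by (rule Bplus_mult_vec_zeroD[OF Z Bc _ that]) (use ZB that in auto)
  have "B $$ (r, c) = 0" if "r < n" "c < r" for r c using low[of c r] that B by simp
  moreover have "B $$ (c, c) > 0" if "c < n" for c
  proof -
    have "Z $$ (c, c) * B $$ (c, c) = 1"
      using Bplus_mult_vec_top[OF Z Bc that low] ZB[OF that that] B that by simp
    then show ?thesis using BplusD(3)[OF Z that] zero_less_mult_pos[of "Z $$ (c, c)" "B $$ (c, c)"] by simp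
  qed
  ultimately have "B \<in> Bplus n" using B by (auto simp: Bplus_def upper_triangular_def)
  then show ?thesis using B that by blast
qed

lemma orth_invol_spm:
  assumes "involution_data n v t" "card (neg_set n v t) = k"
  shows "spm n v t \<in> orth_invol n k"
  using assms spm_mult_self[OF assms(1)] by (simp add: orth_invol_def spm_sym mat_trace_spm)

text \<open>
  If \<open>g\<close> is symmetric and \<open>g Z = Z W\<close> for some \<open>Z \<in> B\<^sup>+\<close>, then \<open>g = Z W Z\<^sup>-\<^sup>1\<close> lies in the cell of \<open>W\<close>;
  here \<open>z c\<close> is column \<open>c\<close> of \<open>Z\<close>.
\<close>

lemma cell_memI:
  assumes W: "involution_data n w s" and g: "g \<in> carrier_mat n n" and sym: "transpose_mat g = g"
    and z0: "\<And>c r. c < r \<Longrightarrow> r < n \<Longrightarrow> z c r = 0" and zp: "\<And>c. c < n \<Longrightarrow> z c c > 0"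
    and gz: "\<And>c r. c < n \<Longrightarrow> r < n \<Longrightarrow> (\<Sum>x<n. g $$ (r, x) * z c x) = s c * z (w c) r"
  shows "g \<in> cell n (spm n w s)"
proof -
  note DW = involution_dataD[OF W]
  define Z where "Z = mat n n (\<lambda>(r, c). z c r)"
  let ?W = "spm n w s"
  have Z: "Z \<in> Bplus n" using z0 zp by (auto simp: Bplus_def upper_triangular_def Z_def)
  note Zc = BplusD(1)[OF Z]
  obtain B where B: "B \<in> Bplus n" "Z * B = 1\<^sub>m n" "B * Z = 1\<^sub>m n" using Bplus_inverse[OF Z] .
  note Bc = BplusD(1)[OF B(1)]
  have gZ: "g * Z = Z * ?W"
  proof (rule eq_matI)
    fix r c assume "r < dim_row (Z * ?W)" "c < dim_col (Z * ?W)"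
    then have rc: "r < n" "c < n" using Zc by auto
    have "(g * Z) $$ (r, c) = s c * z (w c) r"
      unfolding mult_mat_nth[OF g Zc rc] gz[OF rc(2,1), symmetric] using rc by (simp add: Z_def)
    also have "\<dots> = (\<Sum>x<n. if x = w c then s c * z (w c) r else 0)" using DW(1)[OF rc(2)] by simp
    also have "\<dots> = (\<Sum>x<n. Z $$ (r, x) * ?W $$ (x, c))"
      using rc by (intro sum.cong) (auto simp: Z_def)
    also have "\<dots> = (Z * ?W) $$ (r, c)" by (rule mult_mat_nth[OF Zc spm_carrier rc, symmetric])
    finally show "(g * Z) $$ (r, c) = (Z * ?W) $$ (r, c)" .
  qed (use g Zc in auto)
  have ZW: "Z * ?W \<in> carrier_mat n n" and WB: "?W * B \<in> carrier_mat n n" using Zc Bc by auto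
  have "g = g * (Z * B)" using B g by simp
  also have "\<dots> = g * Z * B" by (rule assoc_mult_mat[OF g Zc Bc, symmetric])
  finally have g1: "g = Z * ?W * B" unfolding gZ .
  then have dc: "g \<in> double_coset n ?W" unfolding double_coset_def using Z B by blast
  have g2: "g = Z * (?W * B)" unfolding g1 by (rule assoc_mult_mat[OF Zc spm_carrier Bc])
  have "mat_trace g = mat_trace (?W * B * Z)"
    unfolding g2 by (rule mat_trace_mult_commute[OF Zc WB])
  also have "?W * B * Z = ?W * (B * Z)" by (rule assoc_mult_mat[OF spm_carrier Bc Zc])
  finally have tr: "mat_trace g = mat_trace ?W" using B by simp
  have "g * g = (g * Z) * (?W * B)" by (subst (2) g2) (rule assoc_mult_mat[OF g Zc WB, symmetric])
  also have "\<dots> = Z * (?W * (?W * B))" unfolding gZ by (rule assoc_mult_mat[OF Zc spm_carrier WB])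
  also have "?W * (?W * B) = ?W * ?W * B" by (rule assoc_mult_mat[OF spm_carrier spm_carrier Bc, symmetric])
  finally have "g * g = 1\<^sub>m n" using spm_mult_self[OF W] B Bc by simp
  then show ?thesis
    using dc g sym tr by (simp add: cell_eq orth_invol_def invol_index_spm[OF W] mat_trace_spm[OF W])
qed

text \<open>Each kind couples the order of the indices and the values of \<open>w\<close> with a
  relation between signs, later derived from the closure relation. All of this is invariant under
  order preserving relabelling.\<close>

definition kind_ff :: "(nat \<Rightarrow> nat) \<Rightarrow> (nat \<Rightarrow> real) \<Rightarrow> (nat \<Rightarrow> nat) \<Rightarrow> (nat \<Rightarrow> real) \<Rightarrow> nat \<Rightarrow> nat \<Rightarrow> bool" where
  "kind_ff v t w s i j \<longleftrightarrow> i < j \<and> v i = i \<and> v j = j \<and> w i = j \<and> w j = i \<and> t j = - t i"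

definition kind_fe :: "(nat \<Rightarrow> nat) \<Rightarrow> (nat \<Rightarrow> real) \<Rightarrow> (nat \<Rightarrow> nat) \<Rightarrow> (nat \<Rightarrow> real) \<Rightarrow> nat \<Rightarrow> nat \<Rightarrow> bool" where
  "kind_fe v t w s i j \<longleftrightarrow> i < j \<and> j < v j \<and> v i = i \<and> w i = v j \<and> w (v j) = i \<and> w j = j \<and> s j = t i"

definition kind_ef :: "(nat \<Rightarrow> nat) \<Rightarrow> (nat \<Rightarrow> real) \<Rightarrow> (nat \<Rightarrow> nat) \<Rightarrow> (nat \<Rightarrow> real) \<Rightarrow> nat \<Rightarrow> nat \<Rightarrow> bool" where
  "kind_ef v t w s i j \<longleftrightarrow> i < v i \<and> v i < j \<and> v j = j \<and> w i = j \<and> w j = i \<and> w (v i) = v i \<and> s (v i) = t j"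

definition kind_ee_noncrossing ::
    "(nat \<Rightarrow> nat) \<Rightarrow> (nat \<Rightarrow> real) \<Rightarrow> (nat \<Rightarrow> nat) \<Rightarrow> (nat \<Rightarrow> real) \<Rightarrow> nat \<Rightarrow> nat \<Rightarrow> bool" where
  "kind_ee_noncrossing v t w s i j \<longleftrightarrow> i < j \<and> j < v i \<and> v i < v j \<and>
     w i = v j \<and> w j = v i \<and> w (v i) = j \<and> w (v j) = i \<and> t i * t j = - (s i * s j)"

definition kind_ee_crossing ::
    "(nat \<Rightarrow> nat) \<Rightarrow> (nat \<Rightarrow> real) \<Rightarrow> (nat \<Rightarrow> nat) \<Rightarrow> (nat \<Rightarrow> real) \<Rightarrow> nat \<Rightarrow> nat \<Rightarrow> bool" where
  "kind_ee_crossing v t w s i j \<longleftrightarrow> i < v i \<and> v i < j \<and> j < v j \<and>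
     w i = v j \<and> w (v j) = i \<and> w j = j \<and> w (v i) = v i \<and> s (v i) = - s j"

definition kind_ed :: "(nat \<Rightarrow> nat) \<Rightarrow> (nat \<Rightarrow> real) \<Rightarrow> (nat \<Rightarrow> nat) \<Rightarrow> (nat \<Rightarrow> real) \<Rightarrow> nat \<Rightarrow> nat \<Rightarrow> bool" where
  "kind_ed v t w s i j \<longleftrightarrow> i < v i \<and> v i < v j \<and> v j < j \<and>
     w i = v j \<and> w j = v i \<and> w (v i) = j \<and> w (v j) = i \<and> t i * t j = - (s i * s j)"

lemmas kind_defs = kind_ff_def kind_fe_def kind_ef_def kind_ee_noncrossing_def kind_ee_crossing_def kind_ed_def

text \<open>The closure relation enters only through its consequences \<open>off\<close> and
  \<open>kind\<close>. This allows a second interpretation of the locale for the restriction to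
  \<open>D\<close>, where closure is not given.\<close>

locale rise_config =
  fixes n :: nat and v :: "nat \<Rightarrow> nat" and t :: "nat \<Rightarrow> real"
    and w :: "nat \<Rightarrow> nat" and s :: "nat \<Rightarrow> real" and i j :: nat
  assumes V: "involution_data n v t" and W: "involution_data n w s"
    and ijn: "i < n" "j < n"
    and free: "\<And>m. i < m \<Longrightarrow> m < j \<Longrightarrow> \<not> (v i < v m \<and> v m < v j)"
    and off: "\<And>x. x < n \<Longrightarrow> x \<notin> {i, j, v i, v j} \<Longrightarrow> w x = v x \<and> s x = t x"
    and kind: "kind_ff v t w s i j \<or> kind_fe v t w s i j \<or> kind_ef v t w s i j \<or>
      kind_ee_noncrossing v t w s i j \<or> kind_ee_crossing v t w s i j \<or> kind_ed v t w s i j"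
begin

definition D :: "nat set" where "D = {i, j, v i, v j}"

lemmas DV = involution_dataD[OF V] and DW = involution_dataD[OF W]

lemma off_D: "x < n \<Longrightarrow> x \<notin> D \<Longrightarrow> w x = v x" "x < n \<Longrightarrow> x \<notin> D \<Longrightarrow> s x = t x"
  using off unfolding D_def by blast+

lemma D_lt: "x \<in> D \<Longrightarrow> x < n"
  using ijn DV(1)[OF ijn(1)] DV(1)[OF ijn(2)] by (auto simp: D_def)

lemma v_D: assumes "x < n" shows "v x \<in> D \<longleftrightarrow> x \<in> D"
proof -
  have "v y \<in> D" if "y \<in> D" for y
    using DV(2)[OF ijn(1)] DV(2)[OF ijn(2)] that by (auto simp: D_def)
  from this[of x] this[of "v x"] show ?thesis using DV(2)[OF assms] by auto
qed

lemma w_D: assumes "x < n" shows "w x \<in> D \<longleftrightarrow> x \<in> D"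
proof -
  have "w y \<in> D" if "y \<in> D" for y
    using kind that by (auto simp: kind_defs D_def)
  from this[of x] this[of "w x"] show ?thesis using DW(2)[OF assms] by auto
qed

text \<open>The summands differ only on \<open>D\<close>, where every kind balances the signs of the
  fixed points; the two sums are the traces of \<open>V\<close> and \<open>W\<close>.\<close>

lemma fixed_sum_eq: "(\<Sum>r<n. if r = v r then t r else 0) = (\<Sum>r<n. if r = w r then s r else 0)"
proof -
  have "(\<Sum>r<n. (if r = v r then t r else 0) - (if r = w r then s r else 0)) =
      (\<Sum>r\<in>D. (if r = v r then t r else 0) - (if r = w r then s r else 0))"
    using off_D D_lt by (intro sum.mono_neutral_right) (auto simp: D_def)
  also have "\<dots> = 0"
    using kind DV(2)[OF ijn(1)] DV(2)[OF ijn(2)] by (auto simp: kind_defs D_def insert_absorb insert_commute)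
  finally show ?thesis by (simp add: sum_subtractf)
qed

lemma card_eq: "card (neg_set n v t) = card (neg_set n w s)"
proof -
  have "mat_trace (spm n v t) = mat_trace (spm n w s)"
    using fixed_sum_eq by (simp add: mat_trace_def)
  then show ?thesis by (simp add: mat_trace_spm[OF V] mat_trace_spm[OF W])
qed

text \<open>Off \<open>D\<close> the matrices \<open>V\<close> and \<open>W\<close> agree, so the
  path is constant there and only the block \<open>\<gamma>\<close> moves. The triangular columns
  \<open>\<zeta>\<close> that intertwine the block with that of \<open>W\<close> are completed by
  unit vectors to fit \<open>cell_memI\<close>.\<close>

lemma cell_path_block:
  fixes \<gamma> :: "real \<Rightarrow> nat \<Rightarrow> nat \<Rightarrow> real"
  assumes sym: "\<And>\<tau> r c. r \<in> D \<Longrightarrow> c \<in> D \<Longrightarrow> \<gamma> \<tau> r c = \<gamma> \<tau> c r"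
    and cont: "\<And>r c. r \<in> D \<Longrightarrow> c \<in> D \<Longrightarrow> continuous_on {0..1} (\<lambda>\<tau>. \<gamma> \<tau> r c)"
    and \<gamma>0: "\<And>r c. r \<in> D \<Longrightarrow> c \<in> D \<Longrightarrow> \<gamma> 0 r c = (if r = w c then s c else 0)"
    and \<gamma>1: "\<And>r c. r \<in> D \<Longrightarrow> c \<in> D \<Longrightarrow> \<gamma> 1 r c = (if r = v c then t c else 0)"
    and ex: "\<And>\<tau>. 0 \<le> \<tau> \<Longrightarrow> \<tau> < 1 \<Longrightarrow> \<exists>\<zeta>. (\<forall>c\<in>D. \<forall>r\<in>D. c < r \<longrightarrow> \<zeta> c r = 0) \<and> (\<forall>c\<in>D. \<zeta> c c > 0) \<and>
      (\<forall>c\<in>D. \<forall>r\<in>D. (\<Sum>x\<in>D. \<gamma> \<tau> r x * \<zeta> c x) = s c * \<zeta> (w c) r)"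
  shows "\<exists>g. cell_path n (spm n v t) (spm n w s) g"
proof -
  define g where "g \<tau> = mat n n (\<lambda>(r, c). if r \<in> D \<and> c \<in> D then \<gamma> \<tau> r c else if r = v c then t c else 0)" for \<tau> :: real
  have g0: "g 0 = spm n w s"
  proof (rule eq_matI)
    fix r c assume "r < dim_row (spm n w s)" "c < dim_col (spm n w s)"
    then have rc: "r < n" "c < n" by auto
    show "g 0 $$ (r, c) = spm n w s $$ (r, c)"
    proof (cases "c \<in> D")
      case True
      then show ?thesis using rc \<gamma>0 w_D[OF rc(2)] v_D[OF rc(2)] by (cases "r \<in> D") (auto simp: g_def)
    next
      case False
      then have "w c = v c \<and> s c = t c" using off_D[OF rc(2)] by simp
      then show ?thesis using rc False by (simp add: g_def)
    qed
  qed (auto simp: g_def)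
  have g1: "g 1 = spm n v t"
    using \<gamma>1 by (intro eq_matI) (auto simp: g_def)
  have gsym: "transpose_mat (g \<tau>) = g \<tau>" for \<tau>
  proof (rule eq_matI)
    fix r c assume "r < dim_row (g \<tau>)" "c < dim_col (g \<tau>)"
    then have rc: "r < n" "c < n" by (auto simp: g_def)
    have "r = v c \<longleftrightarrow> c = v r" by (rule involution_data_eq_iff[OF V rc])
    then show "transpose_mat (g \<tau>) $$ (r, c) = g \<tau> $$ (r, c)"
      using rc sym[of r c \<tau>] DV(3)[OF rc(2)] DV(3)[OF rc(1)] by (auto simp: g_def)
  qed (auto simp: g_def)
  have cell: "g \<tau> \<in> cell n (spm n w s)" if \<tau>: "0 \<le> \<tau>" "\<tau> < 1" for \<tau>
  proof -
    obtain \<zeta> where \<zeta>: "\<forall>c\<in>D. \<forall>r\<in>D. c < r \<longrightarrow> \<zeta> c r = 0" "\<forall>c\<in>D. \<zeta> c c > 0"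
      "\<forall>c\<in>D. \<forall>r\<in>D. (\<Sum>x\<in>D. \<gamma> \<tau> r x * \<zeta> c x) = s c * \<zeta> (w c) r" using ex[OF \<tau>] by blast
    define z where "z c r = (if c \<in> D then if r \<in> D then \<zeta> c r else 0 else if r = c then 1 else (0::real))" for c r
    show ?thesis
    proof (rule cell_memI[OF W _ gsym, of _ z])
      show "g \<tau> \<in> carrier_mat n n" by (simp add: g_def)
      show "z c r = 0" if "c < r" "r < n" for c r using that \<zeta>(1) by (simp add: z_def)
      show "z c c > 0" if "c < n" for c using \<zeta>(2) by (simp add: z_def)
      fix c r assume rc: "c < n" "r < n"
      show "(\<Sum>x<n. g \<tau> $$ (r, x) * z c x) = s c * z (w c) r"
      proof (cases "c \<in> D")
        case True
        have wc: "w c \<in> D" using w_D[OF rc(1)] True by blast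
        have "(\<Sum>x<n. g \<tau> $$ (r, x) * z c x) = (\<Sum>x\<in>D. g \<tau> $$ (r, x) * z c x)"
          using D_lt True by (intro sum.mono_neutral_right) (auto simp: z_def)
        also have "\<dots> = (\<Sum>x\<in>D. if r \<in> D then \<gamma> \<tau> r x * \<zeta> c x else 0)"
        proof (intro sum.cong refl)
          fix x assume x: "x \<in> D"
          have "r = v x \<Longrightarrow> r \<in> D" using v_D[OF D_lt[OF x]] x by blast
          then show "g \<tau> $$ (r, x) * z c x = (if r \<in> D then \<gamma> \<tau> r x * \<zeta> c x else 0)"
            using x True rc(2) D_lt[OF x] by (auto simp: g_def z_def)
        qed
        also have "\<dots> = s c * z (w c) r"
        proof (cases "r \<in> D")
          case r: True
          then show ?thesis using \<zeta>(3) True wc by (simp add: z_def)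
        next
          case r: False
          then show ?thesis using wc by (simp add: z_def)
        qed
        finally show ?thesis .
      next
        case False
        then have wc: "w c \<notin> D" "w c = v c" "s c = t c" using w_D[OF rc(1)] off_D[OF rc(1)] by auto
        have "(\<Sum>x<n. g \<tau> $$ (r, x) * z c x) = (\<Sum>x<n. if x = c then g \<tau> $$ (r, c) else 0)"
          using False by (intro sum.cong) (auto simp: z_def)
        also have "\<dots> = g \<tau> $$ (r, c)" using rc by simp
        also have "\<dots> = (if r = v c then t c else 0)" using False rc by (simp add: g_def)
        also have "\<dots> = s c * z (w c) r" using wc by (simp add: z_def)
        finally show ?thesis .
      qed
    qed
  qed
  have idx: "invol_index n (spm n w s) = card (neg_set n w s)" by (rule invol_index_spm[OF W])
  have "cell_path n (spm n v t) (spm n w s) g"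
    unfolding cell_path_def mat_path_def
  proof (intro conjI ballI allI impI)
    show "g 0 = spm n w s" "g 1 = spm n v t" by (rule g0, rule g1)
    show "g \<tau> \<in> carrier_mat n n" for \<tau> by (simp add: g_def)
    show "g \<tau> \<in> cell n (spm n w s)" if "\<tau> \<in> {0..<1}" for \<tau> using cell that by simp
    show "g \<tau> \<in> orth_invol n (invol_index n (spm n w s))" if "\<tau> \<in> {0..1}" for \<tau>
    proof (cases "\<tau> = 1")
      case True
      then show ?thesis using orth_invol_spm[OF V card_eq] by (simp add: g1 idx)
    next
      case False
      then show ?thesis using cell[of \<tau>] that by (simp add: cell_eq)
    qed
    show "continuous_on {0..1} (\<lambda>\<tau>. g \<tau> $$ (r, c))" if "r < n" "c < n" for r c
    proof (cases "r \<in> D \<and> c \<in> D")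
      case True
      then have "(\<lambda>\<tau>. g \<tau> $$ (r, c)) = (\<lambda>\<tau>. \<gamma> \<tau> r c)" using that by (simp add: g_def)
      then show ?thesis using cont True by (simp only:)
    next
      case False
      then have "(\<lambda>\<tau>. g \<tau> $$ (r, c)) = (\<lambda>\<tau>. if r = v c then t c else 0)" using that by (auto simp: g_def)
      then show ?thesis
        using continuous_on_const[of "{0..1}" "if r = v c then t c else 0"] by (simp only:)
    qed
  qed
  then show ?thesis by blast
qed

end



text \<open>\<open>\<eta>\<close> times the product of the reflections in orthogonal vectors
  \<open>x\<close> and \<open>y\<close> with squared lengths \<open>Nx\<close> and
  \<open>Ny\<close>. For \<open>y = 0\<close> and \<open>Ny = 0\<close> the last term is 0 and a
  single reflection remains.\<close>

definition reflection_entry ::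
    "real \<Rightarrow> (nat \<Rightarrow> real) \<Rightarrow> real \<Rightarrow> (nat \<Rightarrow> real) \<Rightarrow> real \<Rightarrow> nat \<Rightarrow> nat \<Rightarrow> real" where
  "reflection_entry \<eta> x Nx y Ny r c =
     \<eta> * ((if r = c then 1 else 0) - 2 * x r * x c / Nx - 2 * y r * y c / Ny)"

lemma reflection_sum:
  assumes S: "finite S" and r: "r \<in> S"
  shows "(\<Sum>q\<in>S. reflection_entry \<eta> x Nx y Ny r q * z q) =
    \<eta> * (z r - 2 * (\<Sum>q\<in>S. x q * z q) / Nx * x r - 2 * (\<Sum>q\<in>S. y q * z q) / Ny * y r)"
proof -
  define a b where ab: "a = 2 / Nx * x r" "b = 2 / Ny * y r"
  have "(\<Sum>q\<in>S. reflection_entry \<eta> x Nx y Ny r q * z q) =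
      (\<Sum>q\<in>S. \<eta> * ((if r = q then z r else 0) - a * (x q * z q) - b * (y q * z q)))"
    by (intro sum.cong refl) (auto simp: reflection_entry_def ab algebra_simps)
  also have "\<dots> = \<eta> * (z r - a * (\<Sum>q\<in>S. x q * z q) - b * (\<Sum>q\<in>S. y q * z q))"
    using S r by (simp add: sum_subtractf sum_distrib_left[symmetric])
  finally show ?thesis by (simp add: ab mult_ac)
qed

lemma reflection_sym: "reflection_entry \<eta> x Nx y Ny r c = reflection_entry \<eta> x Nx y Ny c r"
  by (simp add: reflection_entry_def mult_ac)

lemma reflection_involution:
  assumes S: "finite S" and r: "r \<in> S" and a: "a \<in> S" and \<eta>: "\<eta> * \<eta> = 1"
    and Nx: "(\<Sum>q\<in>S. x q * x q) = Nx" "Nx \<noteq> 0"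
    and Ny: "(\<Sum>q\<in>S. y q * y q) = Ny" "Ny \<noteq> 0 \<or> (\<forall>q\<in>S. y q = 0)"
    and xy: "(\<Sum>q\<in>S. x q * y q) = 0"
  shows "(\<Sum>q\<in>S. reflection_entry \<eta> x Nx y Ny r q * reflection_entry \<eta> x Nx y Ny q a) = (if r = a then 1 else 0)"
proof -
  have yx: "(\<Sum>q\<in>S. y q * x q) = 0" using xy by (simp add: mult.commute)
  have X: "(\<Sum>q\<in>S. x q * reflection_entry \<eta> x Nx y Ny q a) = - \<eta> * x a"
    using reflection_sum[OF S a, of \<eta> x Nx y Ny x] Nx yx by (simp add: mult.commute reflection_sym[of _ _ _ _ _ a])
  have Y: "(\<Sum>q\<in>S. y q * reflection_entry \<eta> x Nx y Ny q a) = - \<eta> * y a"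
    using reflection_sum[OF S a, of \<eta> x Nx y Ny y] Ny xy a by (auto simp: mult.commute reflection_sym[of _ _ _ _ _ a])
  have "(\<Sum>q\<in>S. reflection_entry \<eta> x Nx y Ny r q * reflection_entry \<eta> x Nx y Ny q a) =
      \<eta> * (reflection_entry \<eta> x Nx y Ny r a - 2 * (- \<eta> * x a) / Nx * x r - 2 * (- \<eta> * y a) / Ny * y r)"
    unfolding reflection_sum[OF S r] X Y ..
  also have "\<dots> = (\<eta> * \<eta>) * (if r = a then 1 else 0)"
    by (simp add: reflection_entry_def algebra_simps)
  finally show ?thesis using \<eta> by simp
qed

context rise_config
begin

text \<open>A circular arc from the block of \<open>W\<close> to that of \<open>V\<close>. Its
  points square to 1 when the two blocks anticommute, which is what the sign relations of the kinds
  \<open>ff\<close>, non-crossing \<open>ee\<close> and \<open>ed\<close> provide.\<close>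

definition mix :: "real \<Rightarrow> nat \<Rightarrow> nat \<Rightarrow> real" where
  "mix \<tau> r c = \<tau> * (if r = v c then t c else 0) + sqrt (1 - \<tau>\<^sup>2) * (if r = w c then s c else 0)"

lemma cell_path_mix:
  assumes "\<And>\<tau> q. 0 \<le> \<tau> \<Longrightarrow> \<tau> < 1 \<Longrightarrow> 0 < q \<Longrightarrow> q * q = 1 - \<tau> * \<tau> \<Longrightarrow>
      (\<And>r c. mix \<tau> r c = \<tau> * (if r = v c then t c else 0) + q * (if r = w c then s c else 0)) \<Longrightarrow>
      \<exists>\<zeta>. (\<forall>c\<in>D. \<forall>r\<in>D. c < r \<longrightarrow> \<zeta> c r = 0) \<and> (\<forall>c\<in>D. \<zeta> c c > 0) \<and>
      (\<forall>c\<in>D. \<forall>r\<in>D. (\<Sum>x\<in>D. mix \<tau> r x * \<zeta> c x) = s c * \<zeta> (w c) r)"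
  shows "\<exists>g. cell_path n (spm n v t) (spm n w s) g"
proof (rule cell_path_block[of mix])
  fix r c assume rc: "r \<in> D" "c \<in> D"
  show "mix \<tau> r c = mix \<tau> c r" for \<tau>
    using involution_data_eq_iff[OF V D_lt[OF rc(1)] D_lt[OF rc(2)]]
      involution_data_eq_iff[OF W D_lt[OF rc(1)] D_lt[OF rc(2)]]
      DV(3)[OF D_lt[OF rc(1)]] DV(3)[OF D_lt[OF rc(2)]] DW(3)[OF D_lt[OF rc(1)]] DW(3)[OF D_lt[OF rc(2)]]
    by (auto simp: mix_def)
  show "continuous_on {0..1} (\<lambda>\<tau>. mix \<tau> r c)"
    unfolding mix_def by (intro continuous_intros)
next
  fix \<tau> :: real assume \<tau>: "0 \<le> \<tau>" "\<tau> < 1"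
  have "\<tau>\<^sup>2 < 1" using \<tau> by (simp add: abs_square_less_1)
  then have "0 < sqrt (1 - \<tau>\<^sup>2)" "sqrt (1 - \<tau>\<^sup>2) * sqrt (1 - \<tau>\<^sup>2) = 1 - \<tau> * \<tau>"
    by (auto simp: power2_eq_square)
  then show "\<exists>\<zeta>. (\<forall>c\<in>D. \<forall>r\<in>D. c < r \<longrightarrow> \<zeta> c r = 0) \<and> (\<forall>c\<in>D. \<zeta> c c > 0) \<and>
      (\<forall>c\<in>D. \<forall>r\<in>D. (\<Sum>x\<in>D. mix \<tau> r x * \<zeta> c x) = s c * \<zeta> (w c) r)"
    by (rule assms[OF \<tau>]) (simp add: mix_def)
qed (auto simp: mix_def)

text \<open>When the blocks do not anticommute, eigenvectors are moved instead of matrices. The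
  condition on \<open>Ny\<close> covers one reflection and two at once. The involution property is
  passed to \<open>ex\<close>, where it allows one column to be the image of another.\<close>

lemma cell_path_reflection:
  assumes \<eta>: "\<eta> * \<eta> = 1"
    and xx: "\<And>\<tau>. (\<Sum>q\<in>D. x \<tau> q * x \<tau> q) = Nx \<tau>" and Nx: "\<And>\<tau>. Nx \<tau> \<noteq> 0"
    and yy: "\<And>\<tau>. (\<Sum>q\<in>D. y \<tau> q * y \<tau> q) = Ny \<tau>"
    and Ny: "\<And>\<tau>. Ny \<tau> \<noteq> 0 \<or> (\<forall>\<tau>. \<forall>q\<in>D. y \<tau> q = 0)"
    and xy: "\<And>\<tau>. (\<Sum>q\<in>D. x \<tau> q * y \<tau> q) = 0"
    and cx: "\<And>r. r \<in> D \<Longrightarrow> continuous_on {0..1} (\<lambda>\<tau>. x \<tau> r)" and cy: "\<And>r. r \<in> D \<Longrightarrow> continuous_on {0..1} (\<lambda>\<tau>. y \<tau> r)"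
    and cN: "continuous_on {0..1} Nx" "continuous_on {0..1} Ny"
    and 0: "\<And>r c. r \<in> D \<Longrightarrow> c \<in> D \<Longrightarrow> reflection_entry \<eta> (x 0) (Nx 0) (y 0) (Ny 0) r c = (if r = w c then s c else 0)"
    and 1: "\<And>r c. r \<in> D \<Longrightarrow> c \<in> D \<Longrightarrow> reflection_entry \<eta> (x 1) (Nx 1) (y 1) (Ny 1) r c = (if r = v c then t c else 0)"
    and ex: "\<And>\<tau> :: real. 0 \<le> \<tau> \<Longrightarrow> \<tau> < 1 \<Longrightarrow>
      (\<And>r a. r \<in> D \<Longrightarrow> a \<in> D \<Longrightarrow> (\<Sum>q\<in>D. reflection_entry \<eta> (x \<tau>) (Nx \<tau>) (y \<tau>) (Ny \<tau>) r q *
        reflection_entry \<eta> (x \<tau>) (Nx \<tau>) (y \<tau>) (Ny \<tau>) q a) = (if r = a then 1 else 0)) \<Longrightarrow>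
      \<exists>\<zeta>. (\<forall>c\<in>D. \<forall>r\<in>D. c < r \<longrightarrow> \<zeta> c r = 0) \<and> (\<forall>c\<in>D. \<zeta> c c > 0) \<and>
      (\<forall>c\<in>D. \<forall>r\<in>D. (\<Sum>q\<in>D. reflection_entry \<eta> (x \<tau>) (Nx \<tau>) (y \<tau>) (Ny \<tau>) r q * \<zeta> c q) = s c * \<zeta> (w c) r)"
  shows "\<exists>g. cell_path n (spm n v t) (spm n w s) g"
proof (rule cell_path_block[of "\<lambda>\<tau>. reflection_entry \<eta> (x \<tau>) (Nx \<tau>) (y \<tau>) (Ny \<tau>)", OF reflection_sym _ 0 1])
  have finD: "finite D" by (simp add: D_def)
  fix r c assume rc: "r \<in> D" "c \<in> D"
  show "continuous_on {0..1} (\<lambda>\<tau>. reflection_entry \<eta> (x \<tau>) (Nx \<tau>) (y \<tau>) (Ny \<tau>) r c)"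
  proof (cases "\<forall>\<tau>. \<forall>q\<in>D. y \<tau> q = 0")
    case True
    then have "reflection_entry \<eta> (x \<tau>) (Nx \<tau>) (y \<tau>) (Ny \<tau>) r c = \<eta> * ((if r = c then 1 else 0) - 2 * x \<tau> r * x \<tau> c / Nx \<tau>)" for \<tau>
      using rc by (simp add: reflection_entry_def)
    then show ?thesis using Nx by (simp only:) (intro continuous_intros cx rc cN, auto)
  next
    case False
    then show ?thesis unfolding reflection_entry_def using Nx Ny by (intro continuous_intros cx cy rc cN) auto
  qed
next
  have finD: "finite D" by (simp add: D_def)
  fix \<tau> :: real assume \<tau>: "0 \<le> \<tau>" "\<tau> < 1"
  show "\<exists>\<zeta>. (\<forall>c\<in>D. \<forall>r\<in>D. c < r \<longrightarrow> \<zeta> c r = 0) \<and> (\<forall>c\<in>D. \<zeta> c c > 0) \<and>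
      (\<forall>c\<in>D. \<forall>r\<in>D. (\<Sum>q\<in>D. reflection_entry \<eta> (x \<tau>) (Nx \<tau>) (y \<tau>) (Ny \<tau>) r q * \<zeta> c q) = s c * \<zeta> (w c) r)"
    by (rule ex[OF \<tau>], rule reflection_involution[OF finD _ _ \<eta> xx Nx yy _ xy]) (use Ny[of \<tau>] in auto)
qed

section \<open>Explicit paths for the six kinds of rises\<close>

lemma path_ff: assumes k: "kind_ff v t w s i j" shows "\<exists>g. cell_path n (spm n v t) (spm n w s) g"
proof (rule cell_path_mix)
  fix \<tau> q :: real assume \<tau>: "0 \<le> \<tau>" "\<tau> < 1" and q: "0 < q" "q * q = 1 - \<tau> * \<tau>"
    and mix: "\<And>r c. mix \<tau> r c = \<tau> * (if r = v c then t c else 0) + q * (if r = w c then s c else 0)"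
  have D: "D = {i, j}" and K: "i < j" "v i = i" "v j = j" "w i = j" "w j = i" "t j = - t i" and ne: "i \<noteq> j"
    using k by (auto simp: kind_ff_def D_def)
  have sj: "s j = s i" using DW(3)[OF ijn(1)] K by simp
  note S = DV(4)[OF ijn(1)] DW(4)[OF ijn(1)]
  \<comment> \<open>Column \<open>j = w i\<close> is \<open>s i\<close> times the image of column
    \<open>i\<close>. Since the block is an involution, the equations for both columns then hold.
    The other kinds reuse such pairs.\<close>
  define \<zeta> where "\<zeta> c r = (if c = i then if r = i then 1 else 0 else if r = i then s i * \<tau> * t i else q)" for c r
  have "(\<Sum>x\<in>D. mix \<tau> r x * \<zeta> c x) = s c * \<zeta> (w c) r" if "r \<in> D" "c \<in> D" for r c
    using S that q ne ne[symmetric] unfolding D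
    by (elim disjE insertE emptyE; simp add: K mix \<zeta>_def sj)
  then show "\<exists>\<zeta>. (\<forall>c\<in>D. \<forall>r\<in>D. c < r \<longrightarrow> \<zeta> c r = 0) \<and> (\<forall>c\<in>D. \<zeta> c c > 0) \<and>
      (\<forall>c\<in>D. \<forall>r\<in>D. (\<Sum>x\<in>D. mix \<tau> r x * \<zeta> c x) = s c * \<zeta> (w c) r)"
    using K q by (intro exI[of _ \<zeta>]) (auto simp: \<zeta>_def D)
qed

lemma path_ee_noncrossing:
  assumes K: "kind_ee_noncrossing v t w s i j" shows "\<exists>g. cell_path n (spm n v t) (spm n w s) g"
proof (rule cell_path_mix)
  fix \<tau> q :: real assume \<tau>: "0 \<le> \<tau>" "\<tau> < 1" and q: "0 < q" "q * q = 1 - \<tau> * \<tau>"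
    and mix: "\<And>r c. mix \<tau> r c = \<tau> * (if r = v c then t c else 0) + q * (if r = w c then s c else 0)"
  define k l where kl: "k = v i" "l = v j"
  have ord: "i < j" "j < k" "k < l" and w: "w i = l" "w j = k" "w k = j" "w l = i" and v: "v i = k" "v j = l" "v k = i" "v l = j"
    and rel: "t i * t j = - (s i * s j)"
    using K DV(2)[OF ijn(1)] DV(2)[OF ijn(2)] by (auto simp: kind_ee_noncrossing_def kl)
  have D: "D = {i, j, k, l}" by (simp add: D_def kl)
  have ne: "i \<noteq> j" "i \<noteq> k" "i \<noteq> l" "j \<noteq> k" "j \<noteq> l" "k \<noteq> l" using ord by auto
  have sg: "t k = t i" "t l = t j" "s l = s i" "s k = s j"
    using DV(3)[OF ijn(1)] DV(3)[OF ijn(2)] DW(3)[OF ijn(1)] DW(3)[OF ijn(2)] v w by auto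
  note sq = DW(5)[OF ijn(1)] DW(5)[OF ijn(2)] DV(5)[OF ijn(1)] DV(5)[OF ijn(2)]
  have sum4: "(\<Sum>x\<in>D. f x) = f i + f j + f k + f l" for f :: "nat \<Rightarrow> real"
    unfolding D using ne by simp
  \<comment> \<open>Columns \<open>i\<close> and \<open>l\<close> form an image pair. The image of
    \<open>e_j\<close> has an entry in row \<open>l\<close>, too low for column \<open>k\<close>;
    the multiple of \<open>e_i\<close> added to column \<open>j\<close> cancels it, so that column
    \<open>k\<close> becomes \<open>e_k\<close>.\<close>
  define \<zeta> where "\<zeta> c r = (if c = i then if r = i then 1 else 0
     else if c = j then if r = j then q else if r = i then - \<tau> * t j * s i else 0
     else if c = k then if r = k then 1 else 0
     else if r = k then s i * \<tau> * t i else if r = l then q else 0)" for c r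
  have eqs: "\<forall>c\<in>D. \<forall>r\<in>D. (\<Sum>x\<in>D. mix \<tau> r x * \<zeta> c x) = s c * \<zeta> (w c) r"
    unfolding sum4 unfolding D
    by (simp only: ball_simps v w mix \<zeta>_def sg ne ne[symmetric] simp_thms if_True if_False; intro conjI;
      ((simp; fail) | (insert q(2) rel sq; Groebner_Basis.algebra)))
  show "\<exists>\<zeta>. (\<forall>c\<in>D. \<forall>r\<in>D. c < r \<longrightarrow> \<zeta> c r = 0) \<and> (\<forall>c\<in>D. \<zeta> c c > 0) \<and>
      (\<forall>c\<in>D. \<forall>r\<in>D. (\<Sum>x\<in>D. mix \<tau> r x * \<zeta> c x) = s c * \<zeta> (w c) r)"
  proof (intro exI[of _ \<zeta>] conjI eqs)
    show "\<forall>c\<in>D. \<forall>r\<in>D. c < r \<longrightarrow> \<zeta> c r = 0" using ord by (simp add: D \<zeta>_def)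
    show "\<forall>c\<in>D. \<zeta> c c > 0" using ord q(1) by (simp add: D \<zeta>_def)
  qed
qed

lemma path_ed:
  assumes K: "kind_ed v t w s i j" shows "\<exists>g. cell_path n (spm n v t) (spm n w s) g"
proof (rule cell_path_mix)
  fix \<tau> q :: real assume \<tau>: "0 \<le> \<tau>" "\<tau> < 1" and q: "0 < q" "q * q = 1 - \<tau> * \<tau>"
    and mix: "\<And>r c. mix \<tau> r c = \<tau> * (if r = v c then t c else 0) + q * (if r = w c then s c else 0)"
  define k l where kl: "k = v i" "l = v j"
  have ord: "i < k" "k < l" "l < j" and w: "w i = l" "w j = k" "w k = j" "w l = i" and v: "v i = k" "v j = l" "v k = i" "v l = j"
    and rel: "t i * t j = - (s i * s j)"
    using K DV(2)[OF ijn(1)] DV(2)[OF ijn(2)] by (auto simp: kind_ed_def kl)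
  have D: "D = {i, j, k, l}" by (simp add: D_def kl)
  have ne: "i \<noteq> j" "i \<noteq> k" "i \<noteq> l" "j \<noteq> k" "j \<noteq> l" "k \<noteq> l" using ord by auto
  have sg: "t k = t i" "t l = t j" "s l = s i" "s k = s j"
    using DV(3)[OF ijn(1)] DV(3)[OF ijn(2)] DW(3)[OF ijn(1)] DW(3)[OF ijn(2)] v w by auto
  note sq = DW(5)[OF ijn(1)] DW(5)[OF ijn(2)] DV(5)[OF ijn(1)] DV(5)[OF ijn(2)]
  have sum4: "(\<Sum>x\<in>D. f x) = f i + f j + f k + f l" for f :: "nat \<Rightarrow> real"
    unfolding D using ne by simp
  \<comment> \<open>Columns \<open>l\<close> and \<open>j\<close> are, up to sign, the images of the
    unit vectors in columns \<open>i\<close> and \<open>k\<close>; the order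
    \<open>i < k < l < j\<close> makes them triangular.\<close>
  define \<zeta> where "\<zeta> c r = (if c = i then if r = i then 1 else 0
     else if c = k then if r = k then 1 else 0
     else if c = l then if r = k then s i * \<tau> * t i else if r = l then q else 0
     else if r = i then s j * \<tau> * t i else if r = j then q else 0)" for c r
  have eqs: "\<forall>c\<in>D. \<forall>r\<in>D. (\<Sum>x\<in>D. mix \<tau> r x * \<zeta> c x) = s c * \<zeta> (w c) r"
    unfolding sum4 unfolding D
    by (simp only: ball_simps v w mix \<zeta>_def sg ne ne[symmetric] simp_thms if_True if_False; intro conjI;
      ((simp; fail) | (insert q(2) rel sq; Groebner_Basis.algebra)))
  show "\<exists>\<zeta>. (\<forall>c\<in>D. \<forall>r\<in>D. c < r \<longrightarrow> \<zeta> c r = 0) \<and> (\<forall>c\<in>D. \<zeta> c c > 0) \<and>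
      (\<forall>c\<in>D. \<forall>r\<in>D. (\<Sum>x\<in>D. mix \<tau> r x * \<zeta> c x) = s c * \<zeta> (w c) r)"
  proof (intro exI[of _ \<zeta>] conjI eqs)
    show "\<forall>c\<in>D. \<forall>r\<in>D. c < r \<longrightarrow> \<zeta> c r = 0" using ord by (simp add: D \<zeta>_def)
    show "\<forall>c\<in>D. \<zeta> c c > 0" using ord q(1) by (simp add: D \<zeta>_def)
  qed
qed

lemma path_fe: assumes K: "kind_fe v t w s i j" shows "\<exists>g. cell_path n (spm n v t) (spm n w s) g"
proof -
  define k where k: "k = v j"
  have ord: "i < j" "j < k" and v: "v i = i" "v j = k" "v k = j" and w: "w i = k" "w k = i" "w j = j" and sj: "s j = t i"
    using K DV(2)[OF ijn(2)] by (auto simp: kind_fe_def k)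
  have D: "D = {i, j, k}" using v by (auto simp: D_def)
  have ne: "i \<noteq> j" "i \<noteq> k" "j \<noteq> k" using ord by auto
  have sg: "t k = t j" "s k = s i" using DV(3)[OF ijn(2)] DW(3)[OF ijn(1)] v w by auto
  note S = DV(4)[OF ijn(1)] DV(4)[OF ijn(2)] DW(4)[OF ijn(1)]
  have sum3: "(\<Sum>x\<in>D. f x) = f i + f j + f k" for f :: "nat \<Rightarrow> real"
    unfolding D using ne by simp
  \<comment> \<open>At \<open>\<tau> = 0\<close> the reflection in \<open>u\<close> exchanges
    \<open>e_i\<close> and \<open>e_k\<close> up to sign, like \<open>W\<close>; at
    \<open>\<tau> = 1\<close> it exchanges \<open>e_j\<close> and \<open>e_k\<close>, like
    \<open>V\<close>. The factor \<open>t i\<close> is the eigenvalue on the orthogonal complement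
    of \<open>u\<close>.\<close>
  define u where "u \<tau> r = (if r = i then 1 - \<tau> else if r = j then \<tau> * s i * t j else - t i * s i)" for \<tau> r
  define N where "N \<tau> = (1 - \<tau>)\<^sup>2 + \<tau>\<^sup>2 + 1" for \<tau> :: real
  have N: "N \<tau> > 0" for \<tau> unfolding N_def by (simp add: add_nonneg_pos)
  have u: "u \<tau> i = 1 - \<tau>" "u \<tau> j = \<tau> * s i * t j" "u \<tau> k = - t i * s i" for \<tau> using ne by (auto simp: u_def)
  show ?thesis
  proof (rule cell_path_reflection[where \<eta> = "t i" and x = u and Nx = N and y = "\<lambda>_ _. 0" and Ny = "\<lambda>_. 0"])
    show "t i * t i = 1" by (rule DV(5)[OF ijn(1)])
    show "(\<Sum>q\<in>D. u \<tau> q * u \<tau> q) = N \<tau>" for \<tau>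
      unfolding sum3 u N_def using S by (elim disjE; simp add: power2_eq_square algebra_simps)
    show "N \<tau> \<noteq> 0" for \<tau> using N[of \<tau>] by simp
    show "continuous_on {0..1} (\<lambda>\<tau>. u \<tau> r)" if "r \<in> D" for r
      using that unfolding D by (elim insertE emptyE; simp only: u; intro continuous_intros)
    show "continuous_on {0..1} N" unfolding N_def by (intro continuous_intros)
    show "reflection_entry (t i) (u 0) (N 0) (\<lambda>_. 0) 0 r c = (if r = w c then s c else 0)" if "r \<in> D" "c \<in> D" for r c
      using S that ne ne[symmetric] unfolding D
      by (elim disjE insertE emptyE; simp add: reflection_entry_def u N_def w sg sj)
    show "reflection_entry (t i) (u 1) (N 1) (\<lambda>_. 0) 0 r c = (if r = v c then t c else 0)" if "r \<in> D" "c \<in> D" for r c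
      using S that ne ne[symmetric] unfolding D
      by (elim disjE insertE emptyE; simp add: reflection_entry_def u N_def v sg)
    fix \<tau> :: real assume \<tau>: "0 \<le> \<tau>" "\<tau> < 1"
    define \<gamma> where "\<gamma> = reflection_entry (t i) (u \<tau>) (N \<tau>) (\<lambda>_. 0) 0"
    assume inv: "\<And>r a. r \<in> D \<Longrightarrow> a \<in> D \<Longrightarrow> (\<Sum>q\<in>D. reflection_entry (t i) (u \<tau>) (N \<tau>) (\<lambda>_. 0) 0 r q *
        reflection_entry (t i) (u \<tau>) (N \<tau>) (\<lambda>_. 0) 0 q a) = (if r = a then 1 else 0)"
    \<comment> \<open>Column \<open>j\<close> is orthogonal to \<open>u\<close>, hence an
      eigenvector for \<open>t i = s j\<close>; column \<open>k\<close> is the signed image of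
      column \<open>i\<close>. The diagonal entry of the latter,
      \<open>2 * (1 - \<tau>) / N \<tau>\<close>, becomes 0 only at \<open>\<tau> = 1\<close>, where
      the path leaves the cell.\<close>
    define \<zeta> where "\<zeta> c r = (if c = i then if r = i then 1 else 0
      else if c = j then if r = j then u \<tau> i else if r = i then - u \<tau> j else 0 else s i * \<gamma> r i)" for c r
    have iD: "i \<in> D" by (simp add: D)
    have "(\<Sum>x\<in>D. \<gamma> r x * \<zeta> i x) = s i * \<zeta> (w i) r" if "r \<in> D" for r
      unfolding sum3 using ne S(3) by (auto simp: \<zeta>_def w)
    moreover have "(\<Sum>x\<in>D. \<gamma> r x * \<zeta> j x) = s j * \<zeta> (w j) r" if "r \<in> D" for r
      unfolding \<gamma>_def by (subst reflection_sum[OF _ that]) (use ne ne[symmetric] in \<open>simp_all add: D sum3[unfolded D] \<zeta>_def w sj\<close>)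
    moreover have "(\<Sum>x\<in>D. \<gamma> r x * \<zeta> k x) = s k * \<zeta> (w k) r" if "r \<in> D" for r
    proof -
      have "(\<Sum>x\<in>D. \<gamma> r x * \<zeta> k x) = s i * (\<Sum>x\<in>D. \<gamma> r x * \<gamma> x i)"
        unfolding sum_distrib_left using ne by (intro sum.cong) (auto simp: \<zeta>_def)
      then show ?thesis using inv[OF that iD] by (simp add: \<gamma>_def[symmetric] w sg \<zeta>_def)
    qed
    ultimately have eqs: "\<forall>c\<in>D. \<forall>r\<in>D. (\<Sum>x\<in>D. \<gamma> r x * \<zeta> c x) = s c * \<zeta> (w c) r" by (auto simp: D)
    have "\<zeta> k k = 2 * (1 - \<tau>) / N \<tau>"
      using ne ne[symmetric] S by (elim disjE; simp add: \<zeta>_def \<gamma>_def reflection_entry_def u diff_divide_distrib)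
    then have "\<forall>c\<in>D. \<zeta> c c > 0" using \<tau> N[of \<tau>] ne by (simp add: D \<zeta>_def u)
    moreover have "\<forall>c\<in>D. \<forall>r\<in>D. c < r \<longrightarrow> \<zeta> c r = 0" using ord by (simp add: D \<zeta>_def)
    ultimately show "\<exists>\<zeta>. (\<forall>c\<in>D. \<forall>r\<in>D. c < r \<longrightarrow> \<zeta> c r = 0) \<and> (\<forall>c\<in>D. \<zeta> c c > 0) \<and>
      (\<forall>c\<in>D. \<forall>r\<in>D. (\<Sum>x\<in>D. reflection_entry (t i) (u \<tau>) (N \<tau>) (\<lambda>_. 0) 0 r x * \<zeta> c x) = s c * \<zeta> (w c) r)"
      using eqs unfolding \<gamma>_def by blast
  qed simp_all
qed

lemma path_ef: assumes K: "kind_ef v t w s i j" shows "\<exists>g. cell_path n (spm n v t) (spm n w s) g"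
proof -
  define k where k: "k = v i"
  have ord: "i < k" "k < j" and v: "v i = k" "v k = i" "v j = j" and w: "w i = j" "w j = i" "w k = k" and sk: "s k = t j"
    using K DV(2)[OF ijn(1)] by (auto simp: kind_ef_def k)
  have D: "D = {i, k, j}" using v by (auto simp: D_def)
  have ne: "i \<noteq> j" "i \<noteq> k" "j \<noteq> k" using ord by auto
  have sg: "t k = t i" "s j = s i" using DV(3)[OF ijn(1)] DW(3)[OF ijn(1)] v w by auto
  note S = DV(4)[OF ijn(1)] DV(4)[OF ijn(2)] DW(4)[OF ijn(1)]
  have sum3: "(\<Sum>x\<in>D. f x) = f i + f k + f j" for f :: "nat \<Rightarrow> real"
    unfolding D using ne by simp
  \<comment> \<open>Here \<open>e_i\<close> is exchanged with \<open>e_j\<close> at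
    \<open>\<tau> = 0\<close> and with \<open>e_k\<close> at \<open>\<tau> = 1\<close>, up to sign,
    and \<open>t j\<close> is the eigenvalue on the complement of \<open>u\<close>.\<close>
  define u where "u \<tau> r = (if r = i then 1 else if r = k then - t j * t i * \<tau> else - t j * s i * (1 - \<tau>))" for \<tau> r
  define N where "N \<tau> = (1 - \<tau>)\<^sup>2 + \<tau>\<^sup>2 + 1" for \<tau> :: real
  have N: "N \<tau> > 0" for \<tau> unfolding N_def by (simp add: add_nonneg_pos)
  have u: "u \<tau> i = 1" "u \<tau> k = - t j * t i * \<tau>" "u \<tau> j = - t j * s i * (1 - \<tau>)" for \<tau> using ne by (auto simp: u_def)
  show ?thesis
  proof (rule cell_path_reflection[where \<eta> = "t j" and x = u and Nx = N and y = "\<lambda>_ _. 0" and Ny = "\<lambda>_. 0"])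
    show "t j * t j = 1" by (rule DV(5)[OF ijn(2)])
    show "(\<Sum>q\<in>D. u \<tau> q * u \<tau> q) = N \<tau>" for \<tau>
      unfolding sum3 u N_def using S by (elim disjE; simp add: power2_eq_square algebra_simps)
    show "N \<tau> \<noteq> 0" for \<tau> using N[of \<tau>] by simp
    show "continuous_on {0..1} (\<lambda>\<tau>. u \<tau> r)" if "r \<in> D" for r
      using that unfolding D by (elim insertE emptyE; simp only: u; intro continuous_intros)
    show "continuous_on {0..1} N" unfolding N_def by (intro continuous_intros)
    show "reflection_entry (t j) (u 0) (N 0) (\<lambda>_. 0) 0 r c = (if r = w c then s c else 0)" if "r \<in> D" "c \<in> D" for r c
      using S that ne ne[symmetric] unfolding D
      by (elim disjE insertE emptyE; simp add: reflection_entry_def u N_def w sg sk)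
    show "reflection_entry (t j) (u 1) (N 1) (\<lambda>_. 0) 0 r c = (if r = v c then t c else 0)" if "r \<in> D" "c \<in> D" for r c
      using S that ne ne[symmetric] unfolding D
      by (elim disjE insertE emptyE; simp add: reflection_entry_def u N_def v sg)
    fix \<tau> :: real assume \<tau>: "0 \<le> \<tau>" "\<tau> < 1"
    define \<gamma> where "\<gamma> = reflection_entry (t j) (u \<tau>) (N \<tau>) (\<lambda>_. 0) 0"
    assume inv: "\<And>r a. r \<in> D \<Longrightarrow> a \<in> D \<Longrightarrow> (\<Sum>q\<in>D. reflection_entry (t j) (u \<tau>) (N \<tau>) (\<lambda>_. 0) 0 r q *
        reflection_entry (t j) (u \<tau>) (N \<tau>) (\<lambda>_. 0) 0 q a) = (if r = a then 1 else 0)"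
    define \<zeta> where "\<zeta> c r = (if c = i then if r = i then 1 else 0
      else if c = k then if r = k then u \<tau> i else if r = i then - u \<tau> k else 0 else s i * \<gamma> r i)" for c r
    have iD: "i \<in> D" by (simp add: D)
    have "(\<Sum>x\<in>D. \<gamma> r x * \<zeta> i x) = s i * \<zeta> (w i) r" if "r \<in> D" for r
      unfolding sum3 using ne S(3) by (auto simp: \<zeta>_def w)
    moreover have "(\<Sum>x\<in>D. \<gamma> r x * \<zeta> k x) = s k * \<zeta> (w k) r" if "r \<in> D" for r
      unfolding \<gamma>_def by (subst reflection_sum[OF _ that]) (use ne ne[symmetric] in \<open>simp_all add: D sum3[unfolded D] \<zeta>_def w sk\<close>)
    moreover have "(\<Sum>x\<in>D. \<gamma> r x * \<zeta> j x) = s j * \<zeta> (w j) r" if "r \<in> D" for r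
    proof -
      have "(\<Sum>x\<in>D. \<gamma> r x * \<zeta> j x) = s i * (\<Sum>x\<in>D. \<gamma> r x * \<gamma> x i)"
        unfolding sum_distrib_left using ne by (intro sum.cong) (auto simp: \<zeta>_def)
      then show ?thesis using inv[OF that iD] by (simp add: \<gamma>_def[symmetric] w sg \<zeta>_def)
    qed
    ultimately have eqs: "\<forall>c\<in>D. \<forall>r\<in>D. (\<Sum>x\<in>D. \<gamma> r x * \<zeta> c x) = s c * \<zeta> (w c) r" by (auto simp: D)
    have "\<zeta> j j = 2 * (1 - \<tau>) / N \<tau>"
      using ne ne[symmetric] S by (elim disjE; simp add: \<zeta>_def \<gamma>_def reflection_entry_def u diff_divide_distrib)
    then have "\<forall>c\<in>D. \<zeta> c c > 0" using \<tau> N[of \<tau>] ne by (simp add: D \<zeta>_def u)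
    moreover have "\<forall>c\<in>D. \<forall>r\<in>D. c < r \<longrightarrow> \<zeta> c r = 0" using ord by (simp add: D \<zeta>_def)
    ultimately show "\<exists>\<zeta>. (\<forall>c\<in>D. \<forall>r\<in>D. c < r \<longrightarrow> \<zeta> c r = 0) \<and> (\<forall>c\<in>D. \<zeta> c c > 0) \<and>
      (\<forall>c\<in>D. \<forall>r\<in>D. (\<Sum>x\<in>D. reflection_entry (t j) (u \<tau>) (N \<tau>) (\<lambda>_. 0) 0 r x * \<zeta> c x) = s c * \<zeta> (w c) r)"
      using eqs unfolding \<gamma>_def by blast
  qed simp_all
qed

lemma path_ee_crossing:
  assumes K: "kind_ee_crossing v t w s i j" shows "\<exists>g. cell_path n (spm n v t) (spm n w s) g"
proof -
  define k l where kl: "k = v i" "l = v j"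
  have ord: "i < k" "k < j" "j < l" and w: "w i = l" "w l = i" "w j = j" "w k = k"
    and v: "v i = k" "v j = l" "v k = i" "v l = j" and sk: "s k = - s j"
    using K DV(2)[OF ijn(1)] DV(2)[OF ijn(2)] by (auto simp: kind_ee_crossing_def kl)
  have D: "D = {i, k, j, l}" by (auto simp: D_def kl)
  have ne: "i \<noteq> j" "i \<noteq> k" "i \<noteq> l" "j \<noteq> k" "j \<noteq> l" "k \<noteq> l" using ord by auto
  have sg: "t k = t i" "t l = t j" "s l = s i"
    using DV(3)[OF ijn(1)] DV(3)[OF ijn(2)] DW(3)[OF ijn(1)] v w by auto
  note S = DV(4)[OF ijn(1)] DV(4)[OF ijn(2)] DW(4)[OF ijn(1)] DW(4)[OF ijn(2)]
  have sum4: "(\<Sum>x\<in>D. f x) = f i + f k + f j + f l" for f :: "nat \<Rightarrow> real"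
    unfolding D using ne by simp
  \<comment> \<open>\<open>x\<close> and \<open>y\<close> span the eigenspace of
    \<open>- s j\<close> on \<open>D\<close>; \<open>p\<close> is an eigenvector for
    \<open>s j\<close>. The entry of \<open>y\<close> at \<open>k\<close> makes it orthogonal to
    \<open>x\<close>, and the factor \<open>1 + \<tau>\<^sup>2\<close> makes \<open>p\<close>
    orthogonal to \<open>y\<close> although it uses only \<open>i\<close>, \<open>k\<close> and
    \<open>j\<close>. Since \<open>s k = - s j\<close>, the vectors \<open>x\<close> and
    \<open>p\<close> can serve as columns \<open>k\<close> and \<open>j\<close>.\<close>
  define x where "x \<tau> r = (if r = i then - s j * t i * \<tau> else if r = k then 1 else 0)" for \<tau> r
  define y where "y \<tau> r = (if r = i then - (1 - \<tau>) else if r = k then - (1 - \<tau>) * (s j * t i * \<tau>)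
    else if r = j then - t j * s i * \<tau> else s j * s i)" for \<tau> r
  define p where "p \<tau> r = (if r = i then - t j * s i * \<tau> else if r = k then - s j * t i * t j * s i * \<tau>\<^sup>2
    else if r = j then (1 - \<tau>) * (1 + \<tau>\<^sup>2) else 0)" for \<tau> r
  define Nx where "Nx \<tau> = 1 + \<tau>\<^sup>2" for \<tau> :: real
  define Ny where "Ny \<tau> = (1 - \<tau>)\<^sup>2 * (1 + \<tau>\<^sup>2) + \<tau>\<^sup>2 + 1" for \<tau> :: real
  have Nx: "Nx \<tau> > 0" and Ny: "Ny \<tau> > 0" for \<tau> unfolding Nx_def Ny_def by (simp_all add: add_nonneg_pos add_pos_nonneg)
  have x: "x \<tau> i = - s j * t i * \<tau>" "x \<tau> k = 1" "x \<tau> j = 0" "x \<tau> l = 0" for \<tau> using ne by (auto simp: x_def)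
  have y: "y \<tau> i = - (1 - \<tau>)" "y \<tau> k = - (1 - \<tau>) * (s j * t i * \<tau>)" "y \<tau> j = - t j * s i * \<tau>" "y \<tau> l = s j * s i" for \<tau>
    using ne by (auto simp: y_def)
  have p: "p \<tau> i = - t j * s i * \<tau>" "p \<tau> k = - s j * t i * t j * s i * \<tau>\<^sup>2" "p \<tau> j = (1 - \<tau>) * (1 + \<tau>\<^sup>2)" "p \<tau> l = 0" for \<tau>
    using ne by (auto simp: p_def)
  have xx: "(\<Sum>q\<in>D. x \<tau> q * x \<tau> q) = Nx \<tau>" for \<tau>
    unfolding sum4 x Nx_def using S by (elim disjE; simp add: power2_eq_square)
  have xy: "(\<Sum>q\<in>D. x \<tau> q * y \<tau> q) = 0" for \<tau>
    unfolding sum4 x y using S by (elim disjE; simp)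
  have yx: "(\<Sum>q\<in>D. y \<tau> q * x \<tau> q) = 0" for \<tau> using xy[of \<tau>] by (simp add: mult.commute)
  have xp: "(\<Sum>q\<in>D. x \<tau> q * p \<tau> q) = 0" for \<tau>
    unfolding sum4 x p using S by (elim disjE; simp add: power2_eq_square)
  have yp: "(\<Sum>q\<in>D. y \<tau> q * p \<tau> q) = 0" for \<tau>
    unfolding sum4 y p using S by (elim disjE; simp add: power2_eq_square algebra_simps)
  have \<eta>: "s j * s j = 1" by (rule DW(5)[OF ijn(2)])
  show ?thesis
  proof (rule cell_path_reflection[where \<eta> = "s j" and x = x and Nx = Nx and y = y and Ny = Ny])
    show "s j * s j = 1" by (rule \<eta>)
    show "(\<Sum>q\<in>D. x \<tau> q * x \<tau> q) = Nx \<tau>" "(\<Sum>q\<in>D. x \<tau> q * y \<tau> q) = 0" for \<tau> by (rule xx, rule xy)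
    show "(\<Sum>q\<in>D. y \<tau> q * y \<tau> q) = Ny \<tau>" for \<tau>
      unfolding sum4 y Ny_def using S by (elim disjE; simp add: power2_eq_square algebra_simps)
    show "Nx \<tau> \<noteq> 0" "Ny \<tau> \<noteq> 0 \<or> (\<forall>\<tau>. \<forall>q\<in>D. y \<tau> q = 0)" for \<tau> using Nx[of \<tau>] Ny[of \<tau>] by simp_all
    show "continuous_on {0..1} (\<lambda>\<tau>. x \<tau> r)" if "r \<in> D" for r
      using that unfolding D by (elim insertE emptyE; simp only: x; intro continuous_intros)
    show "continuous_on {0..1} (\<lambda>\<tau>. y \<tau> r)" if "r \<in> D" for r
      using that unfolding D by (elim insertE emptyE; simp only: y; intro continuous_intros)
    show "continuous_on {0..1} Nx" "continuous_on {0..1} Ny" unfolding Nx_def Ny_def by (intro continuous_intros)+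
    have ends0: "\<forall>r\<in>D. \<forall>c\<in>D. reflection_entry (s j) (x 0) (Nx 0) (y 0) (Ny 0) r c = (if r = w c then s c else 0)"
      unfolding D reflection_entry_def Nx_def Ny_def
      by (simp only: ball_simps x y w sg sk ne ne[symmetric] simp_thms if_True if_False; intro conjI;
        ((simp; fail) | (insert S; elim disjE; simp)))
    show "reflection_entry (s j) (x 0) (Nx 0) (y 0) (Ny 0) r c = (if r = w c then s c else 0)" if "r \<in> D" "c \<in> D" for r c
      using ends0 that by blast
    have ends1: "\<forall>r\<in>D. \<forall>c\<in>D. reflection_entry (s j) (x 1) (Nx 1) (y 1) (Ny 1) r c = (if r = v c then t c else 0)"
      unfolding D reflection_entry_def Nx_def Ny_def
      by (simp only: ball_simps x y v sg sk ne ne[symmetric] simp_thms if_True if_False; intro conjI;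
        ((simp; fail) | (insert S; elim disjE; simp)))
    show "reflection_entry (s j) (x 1) (Nx 1) (y 1) (Ny 1) r c = (if r = v c then t c else 0)" if "r \<in> D" "c \<in> D" for r c
      using ends1 that by blast
    fix \<tau> :: real assume \<tau>: "0 \<le> \<tau>" "\<tau> < 1"
    define \<gamma> where "\<gamma> = reflection_entry (s j) (x \<tau>) (Nx \<tau>) (y \<tau>) (Ny \<tau>)"
    assume inv: "\<And>r a. r \<in> D \<Longrightarrow> a \<in> D \<Longrightarrow> (\<Sum>q\<in>D. reflection_entry (s j) (x \<tau>) (Nx \<tau>) (y \<tau>) (Ny \<tau>) r q *
        reflection_entry (s j) (x \<tau>) (Nx \<tau>) (y \<tau>) (Ny \<tau>) q a) = (if r = a then 1 else 0)"
    define \<zeta> where "\<zeta> c r = (if c = i then if r = i then 1 else 0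
      else if c = k then x \<tau> r else if c = j then p \<tau> r else s i * \<gamma> r i)" for c r
    have \<zeta>: "\<zeta> i = (\<lambda>r. if r = i then 1 else 0)" "\<zeta> k = x \<tau>" "\<zeta> j = p \<tau>" "\<zeta> l = (\<lambda>r. s i * \<gamma> r i)"
      using ne ne[symmetric] by (simp_all add: \<zeta>_def fun_eq_iff)
    have iD: "i \<in> D" and finD: "finite D" by (simp_all add: D)
    have "(\<Sum>q\<in>D. \<gamma> r q * \<zeta> i q) = s i * \<zeta> (w i) r" if "r \<in> D" for r
      unfolding sum4 using ne S(3) by (auto simp: \<zeta> w)
    moreover have "(\<Sum>q\<in>D. \<gamma> r q * \<zeta> k q) = s k * \<zeta> (w k) r" if "r \<in> D" for r
      unfolding \<gamma>_def w \<zeta> reflection_sum[OF finD that] xx yx using Nx[of \<tau>] by (simp add: sk)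
    moreover have "(\<Sum>q\<in>D. \<gamma> r q * \<zeta> j q) = s j * \<zeta> (w j) r" if "r \<in> D" for r
      unfolding \<gamma>_def w \<zeta> reflection_sum[OF finD that] xp yp by simp
    moreover have "(\<Sum>q\<in>D. \<gamma> r q * \<zeta> l q) = s l * \<zeta> (w l) r" if "r \<in> D" for r
    proof -
      have "(\<Sum>q\<in>D. \<gamma> r q * \<zeta> l q) = s i * (\<Sum>q\<in>D. \<gamma> r q * \<gamma> q i)"
        unfolding sum_distrib_left \<zeta> by (intro sum.cong) auto
      then show ?thesis using inv[OF that iD] by (simp add: \<gamma>_def[symmetric] w sg \<zeta>)
    qed
    ultimately have eqs: "\<forall>c\<in>D. \<forall>r\<in>D. (\<Sum>q\<in>D. \<gamma> r q * \<zeta> c q) = s c * \<zeta> (w c) r" by (auto simp: D)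
    have "\<zeta> l l = 2 * (1 - \<tau>) / Ny \<tau>"
      using ne ne[symmetric] S(3,4) by (elim disjE; simp add: \<zeta> \<gamma>_def reflection_entry_def x y diff_divide_distrib)
    moreover have "p \<tau> j > 0" using \<tau> by (simp add: p add_pos_nonneg)
    ultimately have "\<forall>c\<in>D. \<zeta> c c > 0" using \<tau> Ny[of \<tau>] by (simp add: D \<zeta> x)
    moreover have "\<forall>c\<in>D. \<forall>r\<in>D. c < r \<longrightarrow> \<zeta> c r = 0" using ord by (simp add: D \<zeta> x p)
    ultimately show "\<exists>\<zeta>. (\<forall>c\<in>D. \<forall>r\<in>D. c < r \<longrightarrow> \<zeta> c r = 0) \<and> (\<forall>c\<in>D. \<zeta> c c > 0) \<and>
      (\<forall>c\<in>D. \<forall>r\<in>D. (\<Sum>q\<in>D. reflection_entry (s j) (x \<tau>) (Nx \<tau>) (y \<tau>) (Ny \<tau>) r q * \<zeta> c q) = s c * \<zeta> (w c) r)"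
      using eqs unfolding \<gamma>_def by blast
  qed
qed

lemma cell_path_exists: "\<exists>g. cell_path n (spm n v t) (spm n w s) g"
  using kind path_ff path_fe path_ef path_ee_noncrossing path_ee_crossing path_ed by blast

end



section \<open>Sign formulas\<close>

lemma neg_eigenspace_diff:
  assumes g: "g \<in> carrier_mat n n" and x: "x \<in> neg_eigenspace n g" and y: "y \<in> neg_eigenspace n g"
  shows "a \<cdot>\<^sub>v x - y \<in> neg_eigenspace n g"
proof -
  note xD = neg_eigenspaceD[OF x] and yD = neg_eigenspaceD[OF y]
  have "g *\<^sub>v (a \<cdot>\<^sub>v x - y) = a \<cdot>\<^sub>v (g *\<^sub>v x) - g *\<^sub>v y"
    using mult_minus_distrib_mat_vec[OF g, of "a \<cdot>\<^sub>v x" y] mult_mat_vec[OF g xD(1), of a] xD(1) yD(1) by simp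
  also have "\<dots> = - (a \<cdot>\<^sub>v x - y)" unfolding xD(2) yD(2) using xD(1) yD(1) by (auto intro!: eq_vecI)
  finally show ?thesis using xD(1) yD(1) by (simp add: neg_eigenspace_def)
qed

text \<open>Cramer's rule for the transpose: \<open>F *\<^sub>v \<beta>\<close> at \<open>r\<close>
  is the coefficient of the replaced row when row \<open>r\<close> of \<open>F\<close> is expanded
  in the selected rows, and only this coefficient contributes to the new determinant.\<close>

lemma sel_rows_replace_det:
  assumes F: "F \<in> carrier_mat n (length xs)" and xs: "distinct xs" and a: "a < length xs" and r: "r < n"
    and \<beta>: "\<beta> \<in> carrier_vec (length xs)" "sel_rows \<tau> xs F *\<^sub>v \<beta> = unit_vec (length xs) a"
    and nz: "det (sel_rows \<tau> xs F) \<noteq> 0"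
  shows "det (sel_rows (\<tau>(xs ! a := r)) xs F) = (F *\<^sub>v \<beta>) $ r * det (sel_rows \<tau> xs F)"
proof -
  let ?k = "length xs" and ?S = "sel_rows \<tau> xs F"
  obtain B where B: "B \<in> carrier_mat ?k ?k" "?S * B = 1\<^sub>m ?k" "B * ?S = 1\<^sub>m ?k"
    using det_nonzero_inverse[OF sel_rows_carrier nz] by metis
  have ST: "transpose_mat ?S \<in> carrier_mat ?k ?k" and BT: "transpose_mat B \<in> carrier_mat ?k ?k" using B by auto
  have rc: "row F r \<in> carrier_vec ?k" using F r by auto
  define \<rho> where "\<rho> = transpose_mat B *\<^sub>v row F r"
  have \<rho>: "\<rho> \<in> carrier_vec ?k" unfolding \<rho>_def by (rule mult_mat_vec_carrier[OF BT rc])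
  have "transpose_mat ?S * transpose_mat B = transpose_mat (B * ?S)"
    by (rule transpose_mult[OF B(1) sel_rows_carrier, symmetric])
  then have S\<rho>: "transpose_mat ?S *\<^sub>v \<rho> = row F r"
    unfolding \<rho>_def using assoc_mult_mat_vec[OF ST BT rc] B(3) rc by simp
  have "transpose_mat (sel_rows (\<tau>(xs ! a := r)) xs F) = replace_col (transpose_mat ?S) (transpose_mat ?S *\<^sub>v \<rho>) a"
    unfolding S\<rho> using F r a xs nth_eq_iff_index_eq[OF xs]
    by (intro eq_matI) (auto simp: replace_col_def)
  then have "det (sel_rows (\<tau>(xs ! a := r)) xs F) = \<rho> $ a * det (transpose_mat ?S)"
    using cramer_lemma_mat[OF ST \<rho> a] det_transpose[OF sel_rows_carrier, of "\<tau>(xs ! a := r)" xs F] by simp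
  also have "det (transpose_mat ?S) = det ?S" by (rule det_transpose[OF sel_rows_carrier])
  also have "\<rho> $ a = unit_vec ?k a \<bullet> \<rho>" using \<rho> a by simp
  also have "\<dots> = (?S *\<^sub>v \<beta>) \<bullet> \<rho>" by (simp add: \<beta>(2))
  also have "\<dots> = \<rho> \<bullet> (?S *\<^sub>v \<beta>)" using \<rho> \<beta> by (intro comm_scalar_prod[of _ ?k]) auto
  also have "\<dots> = (transpose_mat ?S *\<^sub>v \<rho>) \<bullet> \<beta>"
    by (rule transpose_vec_mult_scalar[OF sel_rows_carrier \<beta>(1) \<rho>, symmetric])
  also have "\<dots> = (F *\<^sub>v \<beta>) $ r" unfolding S\<rho> using F r by simp
  finally show ?thesis .
qed

context rise_config
begin

lemma hit_off_D:
  assumes d: "d \<in> neg_set n v t" "d \<notin> D" and \<tau>: "\<And>c. c < n \<Longrightarrow> c \<notin> D \<Longrightarrow> \<tau> c = c \<or> \<tau> c = w c"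
  shows "\<exists>c\<in>neg_set n w s. \<tau> c = d \<or> \<tau> c = v d"
proof -
  have dn: "d < n" using d neg_set_lt by blast
  have "d \<in> neg_set n w s" using d off_D[OF dn] by (simp add: neg_set_def)
  then show ?thesis using \<tau>[OF dn d(2)] off_D[OF dn d(2)] by auto
qed

text \<open>Freeness, applied to \<open>c\<close> and to \<open>w c\<close>, pushes \<open>c\<close>
  to the left of \<open>i\<close>. At these rows \<open>g z\<close> vanishes by the prescribed zeros
  of the limit vector, which is how they are removed in \<open>orient_sign_ed\<close>.\<close>

lemma ed_row_vanish:
  assumes K: "kind_ed v t w s i j" and c: "c \<in> neg_set n w s" "c \<noteq> i" and r: "v i \<le> w c" "w c \<le> v j"
  shows "c < i" "v i < v c" "v c = w c"
proof -
  define k l where kl: "k = v i" "l = v j"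
  have ord: "i < k" "k < l" "l < j" and w: "w i = l" "w j = k" "w k = j" "w l = i"
    using K by (auto simp: kind_ed_def kl)
  have cn: "c < n" using c neg_set_lt by blast
  have cj: "c \<noteq> j" using c w ord by (auto simp: neg_set_def)
  have ck: "c \<noteq> k" "c \<noteq> l" using r w ord by (auto simp: kl)
  have cD: "c \<notin> D" using c cj ck by (auto simp: D_def kl)
  show vw: "v c = w c" using off_D[OF cn cD] by simp
  have rne: "w c \<noteq> k" "w c \<noteq> l" using DW(2)[OF cn] w c cj by auto
  have kr: "k < w c" "w c < l" using r rne by (auto simp: kl)
  then show "v i < v c" using vw by (simp add: kl)
  have "v (w c) = c" using DV(2)[OF cn] vw by simp
  then have "\<not> (k < c \<and> c < l)" using free[of "w c"] kr ord by (auto simp: kl)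
  moreover have "\<not> (i < c \<and> c < j)" using free[of c] kr vw by (auto simp: kl)
  moreover have "c \<le> w c" using c by (auto simp: neg_set_def)
  ultimately show "c < i" using c(2) ck kr ord by linarith
qed

text \<open>Moving the row of \<open>i\<close> from \<open>v j\<close> to \<open>v i\<close> leaves
  one row in each of the two orbits of \<open>v\<close> in \<open>D\<close>: \<open>v i\<close> in
  that of \<open>i\<close>, and \<open>w (v i) = j\<close> in that of \<open>j\<close>.\<close>

lemma ed_hit:
  assumes K: "kind_ed v t w s i j" and d: "d \<in> neg_set n v t"
  shows "\<exists>c\<in>neg_set n w s. (w(i := v i)) c = d \<or> (w(i := v i)) c = v d"
proof (cases "d \<in> D")
  case True
  have vv: "v (v i) = i" "v (v j) = j" using DV(2) ijn by auto
  have iI: "i \<in> neg_set n w s" "v i \<in> neg_set n w s"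
    using ijn DV(1)[OF ijn(1)] K by (auto simp: neg_set_def kind_ed_def)
  have "d = i \<or> d = v j" using True d K vv by (auto simp: D_def neg_set_def kind_ed_def)
  then show ?thesis
  proof
    assume "d = i"
    then show ?thesis using iI by (intro bexI[of _ i]) auto
  next
    assume "d = v j"
    then show ?thesis using iI K vv by (intro bexI[of _ "v i"]) (auto simp: kind_ed_def)
  qed
next
  case False
  show ?thesis by (rule hit_off_D[OF d False]) (auto simp: D_def)
qed

text \<open>Two minors are compared near the end of the path: \<open>f\<close> is nonzero on the
  cell, \<open>h\<close> is nonzero at \<open>V\<close>. Their ratio \<open>h / f\<close> equals the
  ratio of the coordinates \<open>k\<close> and \<open>l\<close> of an eigenvector with signs
  \<open>- t i\<close> and \<open>- s i\<close> there, whence the factor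
  \<open>s i * t i\<close>.\<close>

lemma orient_sign_ed:
  assumes K: "kind_ed v t w s i j" and perm: "v permutes {..<n}" "w permutes {..<n}"
  shows "orient_sign n (spm n v t) (spm n w s) =
    (if (s i * t i) * frame_det w (neg_list n w s) w s (neg_list n w s) *
        frame_det (w(i := v i)) (neg_list n w s) v t (neg_list n v t) > 0 then 1 else -1)"
proof -
  define k l where kl: "k = v i" "l = v j"
  have ord: "i < k" "k < l" "l < j" and w: "w i = l" "w j = k" "w k = j" "w l = i" and v: "v i = k" "v j = l" "v k = i" "v l = j"
    using K DV(2)[OF ijn(1)] DV(2)[OF ijn(2)] by (auto simp: kind_ed_def kl)
  have kn: "k < n" "l < n" using ord ijn by auto
  have D: "D = {i, j, k, l}" by (simp add: D_def kl)
  let ?xs = "neg_list n w s" and ?ys = "neg_list n v t" and ?k = "card (neg_set n w s)"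
  define \<tau>' where "\<tau>' = w(i := k)"
  have iI: "i \<in> neg_set n w s" using ijn w ord by (simp add: neg_set_def)
  have wn: "w c < n" if "c \<in> set ?xs" for c using that DW(1) neg_set_lt[of c n w s] by simp
  have \<tau>'n: "\<tau>' c < n" if "c \<in> set ?xs" for c using wn[OF that] kn by (simp add: \<tau>'_def)
  have nzW: "frame_det w ?xs w s ?xs \<noteq> 0" by (rule frame_det_nonzero[OF W _ wn]) auto
  have nzV: "frame_det \<tau>' ?xs v t ?ys \<noteq> 0"
  proof (rule frame_det_nonzero[OF V _ \<tau>'n])
    fix d assume d: "d \<in> neg_set n v t"
    show "\<exists>c\<in>set ?xs. \<tau>' c = d \<or> \<tau>' c = v d"
      using ed_hit[OF K d] by (simp add: \<tau>'_def kl)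
  qed (use card_eq in auto)
  obtain g0 where g0: "cell_path n (spm n v t) (spm n w s) g0" using cell_path_exists by blast
  show ?thesis unfolding kl(1)[symmetric] \<tau>'_def[symmetric]
  proof (rule orient_sign_eqI[OF V perm(1) W perm(2) g0 _ refl])
    show "s i * t i * frame_det w ?xs w s ?xs * frame_det \<tau>' ?xs v t ?ys \<noteq> 0"
      using nzW nzV DV(6)[OF ijn(1)] DW(6)[OF ijn(1)] by simp
    fix g F P Q
    assume g: "cell_path n (spm n v t) (spm n w s) g" and F: "mat_path n ?k F"
      "\<And>x. x \<in> {0..1} \<Longrightarrow> ordered_basis n (neg_eigenspace n (g x)) (F x)"
      and P: "P \<in> carrier_mat ?k ?k" and Q: "Q \<in> carrier_mat ?k ?k" and dP: "det P > 0"
      and F0: "F 0 = frame_mat n w s * P" and F1: "F 1 = frame_mat n v t * Q"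
    note gD = cell_pathD[OF g]
    have fV: "frame_mat n v t \<in> carrier_mat n (length ?xs)" using card_eq frame_mat_carrier[of n v t] by auto
    have fW: "frame_mat n w s \<in> carrier_mat n (length ?xs)" by auto
    define f where "f x = det (sel_rows w ?xs (F x))" for x
    define h where "h x = det (sel_rows \<tau>' ?xs (F x))" for x
    have f0: "f 0 = frame_det w ?xs w s ?xs * det P"
      unfolding f_def F0 using sel_rows_mult[OF fW _ wn, of P] P det_mult[OF sel_rows_carrier[of w ?xs "frame_mat n w s"], of P]
        sel_rows_frame_mat[of ?xs n w s w, OF _ wn] by simp
    have h1: "h 1 = frame_det \<tau>' ?xs v t ?ys * det Q"
      unfolding h_def F1 using sel_rows_mult[OF fV _ \<tau>'n, of Q] Q det_mult[OF sel_rows_carrier[of \<tau>' ?xs "frame_mat n v t"], of Q]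
        sel_rows_frame_mat[of ?xs n v t \<tau>', OF _ \<tau>'n] card_eq by simp
    have dQ: "det Q \<noteq> 0"
    proof (rule ordered_basis_change_det[OF frame_mat_ordered_basis[OF V]])
      show "ordered_basis n (neg_eigenspace n (spm n v t)) (frame_mat n v t * Q)"
        using F(2)[of 1] F1 gD(2) by simp
    qed (use card_eq Q in auto)
    have Fc: "F x \<in> carrier_mat n (length ?xs)" if "x \<in> {0..1}" for x using F(1) that by (simp add: mat_path_def)
    have fnz: "f x \<noteq> 0" if x: "0 \<le> x" "x < 1" for x
    proof -
      have x': "x \<in> {0..1}" using x by simp
      show ?thesis unfolding f_def
        by (rule sel_rows_det_nonzero[OF W gD(4)[OF x] orth_involD(4)[OF gD(3)[OF x']] F(2)[OF x']])
          (use Fc[OF x'] in auto)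
    qed
    have fcont: "continuous_on {0..1} f"
      unfolding f_def by (rule continuous_on_sel_rows_det[OF _ wn]) (use F in auto)
    have hcont: "continuous_on {0..1} h"
      unfolding h_def by (rule continuous_on_sel_rows_det[OF _ \<tau>'n]) (use F in auto)
    have left: "at_left (1::real) = at 1 within {0..1}" by (rule at_within_Icc_at_left[symmetric]) simp
    have ev01: "eventually (\<lambda>x::real. 0 \<le> x \<and> x < 1) (at_left 1)"
      by (subst eventually_at_left[of "0::real"]) (auto intro!: exI[of _ 0])
    have evG: "eventually (\<lambda>x. g x \<in> double_coset n (spm n w s)) (at_left 1)"
      using ev01 by eventually_elim (use gD(4) in auto)
    have lim: "((\<lambda>x. g x $$ (r, c)) \<longlongrightarrow> spm n v t $$ (r, c)) (at_left 1)" if "r < n" "c < n" for r c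
      using bspec[OF gD(5)[OF that, unfolded continuous_on_def], of 1] gD(2) unfolding left by simp
    have le: "v i \<le> w i" using v w ord by simp
    have cards: "card {x. x < i \<and> w i < v x} = card {x. x < i \<and> w i < w x}"
    proof -
      have "w x = v x" if "x < i" for x
        using off_D(1)[of x] that ord ijn by (auto simp: D)
      then show ?thesis by (metis (no_types, lifting))
    qed
    obtain Z where Z: "\<forall>x. Z x \<in> carrier_vec n \<and> Z x $ i = 1 \<and> (\<forall>r. i < r \<longrightarrow> r < n \<longrightarrow> Z x $ r = 0)"
      "eventually (\<lambda>x. (\<forall>r. w i < r \<longrightarrow> r < n \<longrightarrow> (g x *\<^sub>v Z x) $ r = 0) \<and>
          (\<forall>c<i. v i < v c \<longrightarrow> (g x *\<^sub>v Z x) $ v c = 0) \<and> s i * (g x *\<^sub>v Z x) $ w i > 0) (at_left 1)"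
      "\<forall>r<n. ((\<lambda>x. (g x *\<^sub>v Z x) $ r) \<longlongrightarrow> (if r = v i then t i else 0)) (at_left 1)"
      using double_coset_limit_vector[OF V W evG lim ijn(1) le cards] by blast
    have "((\<lambda>x. t i * (g x *\<^sub>v Z x) $ k) \<longlongrightarrow> t i * t i) (at_left 1)"
      using Z(3)[rule_format, OF kn(1)] v by (intro tendsto_mult tendsto_const) simp
    then have evk: "eventually (\<lambda>x. 0 < t i * (g x *\<^sub>v Z x) $ k) (at_left 1)"
      by (rule order_tendstoD) (simp add: DV(5)[OF ijn(1)])
    have "(h \<longlongrightarrow> h 1) (at_left 1)" using bspec[OF hcont[unfolded continuous_on_def], of 1] unfolding left by simp
    moreover have h1nz: "h 1 \<noteq> 0" using nzV dQ h1 by simp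
    ultimately have "((\<lambda>x. h 1 * h x) \<longlongrightarrow> h 1 * h 1) (at_left 1)" by (intro tendsto_mult tendsto_const)
    then have evh: "eventually (\<lambda>x. 0 < h 1 * h x) (at_left 1)"
      by (rule order_tendstoD) (use h1nz in \<open>auto simp: zero_less_mult_iff linorder_neq_iff\<close>)
    \<comment> \<open>The inequality does not involve \<open>x\<close>, so a single parameter close
      to 1 suffices; constancy of the sign of \<open>f\<close> links it to the start of the
      path.\<close>
    have "eventually (\<lambda>x. 0 < (s i * t i) * f 0 * h 1) (at_left (1::real))"
      using ev01 Z(2) evk evh
    proof eventually_elim
      case (elim x)
      then have x: "0 \<le> x" "x < 1" and x': "x \<in> {0..1}" by auto
      have gc: "g x \<in> carrier_mat n n" and gg: "g x * g x = 1\<^sub>m n" using orth_involD[OF gD(3)[OF x']] by auto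
      define z where "z = Z x"
      have z: "z \<in> carrier_vec n" "\<And>r. i < r \<Longrightarrow> r < n \<Longrightarrow> z $ r = 0" using Z(1) by (auto simp: z_def)
      \<comment> \<open>The projection of \<open>z\<close> onto the eigenspace; above
        \<open>i\<close>, where \<open>z\<close> vanishes, it is \<open>- g z / 2\<close> and
        inherits the zeros and signs of \<open>g z\<close>.\<close>
      define y where "y = (1/2) \<cdot>\<^sub>v (z - g x *\<^sub>v z)"
      have yE: "y \<in> neg_eigenspace n (g x)" unfolding y_def by (rule neg_projection_mem[OF gc gg z(1)])
      have yr: "y $ r = - (g x *\<^sub>v z) $ r / 2" if "i < r" "r < n" for r
        using that z gc by (simp add: y_def del: index_mult_mat_vec)
      obtain a where a: "a < length ?xs" "?xs ! a = i" using iI neg_list_props(1)[of n w s] by (metis in_set_conv_nth)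
      let ?S = "sel_rows w ?xs (F x)"
      have dS: "det ?S \<noteq> 0" using fnz[OF x] by (simp add: f_def)
      obtain B where B: "B \<in> carrier_mat (length ?xs) (length ?xs)" "?S * B = 1\<^sub>m (length ?xs)"
        using det_nonzero_inverse[OF sel_rows_carrier dS] by metis
      define \<beta> where "\<beta> = B *\<^sub>v unit_vec (length ?xs) a"
      have \<beta>: "\<beta> \<in> carrier_vec (length ?xs)" unfolding \<beta>_def by (rule mult_mat_vec_carrier[OF B(1) unit_vec_carrier])
      have S\<beta>: "?S *\<^sub>v \<beta> = unit_vec (length ?xs) a"
        unfolding \<beta>_def using assoc_mult_mat_vec[OF sel_rows_carrier B(1) unit_vec_carrier, of w "F x" a] B(2) by simp
      \<comment> \<open>The eigenvector that is 1 in row \<open>w i = l\<close> and 0 in all other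
        selected rows.\<close>
      define fv where "fv = F x *\<^sub>v \<beta>"
      have fvE: "fv \<in> neg_eigenspace n (g x)" unfolding fv_def
        by (rule neg_eigenspace_combination[OF gc Fc[OF x'] _ \<beta>])
          (use F(2)[OF x'] Fc[OF x'] in \<open>auto simp: ordered_basis_def\<close>)
      have fvw: "fv $ w c = (if c = i then 1 else 0)" if c: "c \<in> neg_set n w s" for c
      proof -
        obtain b where b: "b < length ?xs" "?xs ! b = c" using c neg_list_props(1)[of n w s] by (metis in_set_conv_nth)
        have "fv $ w c = (?S *\<^sub>v \<beta>) $ b"
          using sel_rows_mult_vec[OF Fc[OF x'] \<beta> b(1), of w] wn[of c] c b(2) by (simp add: fv_def)
        also have "\<dots> = (if b = a then 1 else 0)" unfolding S\<beta> using b(1) a(1) by simp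
        also have "b = a \<longleftrightarrow> c = i" using a b nth_eq_iff_index_eq[OF neg_list_props(2) b(1) a(1)] by simp
        finally show ?thesis .
      qed
      \<comment> \<open>\<open>d\<close> vanishes in all selected rows from \<open>k\<close> on,
        hence also in row \<open>k\<close>. So \<open>y\<close> and \<open>fv\<close> have the same
        ratio of coordinates \<open>k\<close> and \<open>l\<close>.\<close>
      define d where "d = y $ l \<cdot>\<^sub>v fv - y"
      have dE: "d \<in> neg_eigenspace n (g x)" unfolding d_def by (rule neg_eigenspace_diff[OF gc fvE yE])
      note yc = neg_eigenspaceD(1)[OF yE] and fvc = neg_eigenspaceD(1)[OF fvE]
      have "d $ k = 0"
      proof (rule double_coset_eigenvector_vanish_above[OF W gD(4)[OF x] dE, of k])
        fix c assume c: "c \<in> neg_set n w s" "k \<le> w c"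
        have wc: "w c < n" using DW(1) neg_set_lt[OF c(1)] by simp
        show "d $ w c = 0"
        proof (cases "c = i")
          case True
          then show ?thesis using fvw[OF c(1)] wc yc fvc w by (simp add: d_def)
        next
          case False
          have "(g x *\<^sub>v z) $ w c = 0"
          proof (cases "w c \<le> l")
            case True
            note e = ed_row_vanish[OF K c(1) False]
            have "c < i" "v i < v c" "v c = w c" using e c(2) True v by auto
            then show ?thesis using elim(2) by (auto simp: z_def)
          next
            case False
            then show ?thesis using elim(2) w wc by (auto simp: z_def)
          qed
          then have "y $ w c = 0" using yr[of "w c"] c(2) ord wc by simp
          then show ?thesis using fvw[OF c(1)] wc yc fvc False by (simp add: d_def)
        qed
      qed (use kn in auto)
      then have yk: "y $ k = y $ l * fv $ k" using kn yc fvc by (simp add: d_def)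
      have "h x = fv $ k * f x"
        unfolding h_def f_def \<tau>'_def fv_def a(2)[symmetric]
        using sel_rows_replace_det[OF Fc[OF x'] neg_list_props(2) a(1) kn(1) \<beta> S\<beta> dS] a(2) by simp
      then have hx: "h x * y $ l = y $ k * f x" using yk by simp
      have p1: "t i * y $ k < 0" using elim(3) yr[of k] ord kn by (simp add: z_def)
      have p2: "s i * y $ l < 0" using elim(2) yr[of l] ord kn w by (simp add: z_def)
      have q1: "0 < f 0 * f x"
        by (rule nonzero_continuous_sign[OF x(1) continuous_on_subset[OF fcont]]) (use fnz x in auto)
      have q2: "0 < h 1 * h x" by (rule elim(4))
      have q3: "0 < (s i * t i) * f x * h x"
      proof -
        have "((s i * t i) * f x * h x) * (y $ l * y $ l) = (t i * y $ k) * (s i * y $ l) * (f x * f x)"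
          using hx by (simp add: algebra_simps)
        moreover have "(t i * y $ k) * (s i * y $ l) * (f x * f x) > 0"
        proof (rule mult_pos_pos)
          show "(t i * y $ k) * (s i * y $ l) > 0" by (rule mult_neg_neg[OF p1 p2])
          show "f x * f x > 0" using fnz[OF x] by (auto simp: zero_less_mult_iff linorder_neq_iff)
        qed
        moreover have "y $ l \<noteq> 0" using p2 by auto
        then have "y $ l * y $ l > 0" by (auto simp: zero_less_mult_iff linorder_neq_iff)
        ultimately show ?thesis by (metis zero_less_mult_pos2)
      qed
      have "0 < (f 0 * f x) * (h 1 * h x) * ((s i * t i) * f x * h x)"
        by (rule mult_pos_pos[OF mult_pos_pos[OF q1 q2] q3])
      also have "\<dots> = ((s i * t i) * f 0 * h 1) * ((f x * h x) * (f x * h x))" by (simp add: algebra_simps)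
      finally have pr: "0 < ((s i * t i) * f 0 * h 1) * ((f x * h x) * (f x * h x))" .
      then have "f x * h x \<noteq> 0" by auto
      then have "(f x * h x) * (f x * h x) > 0" using not_real_square_gt_zero by blast
      then show ?case by (rule zero_less_mult_pos2[OF pr])
    qed
    then have "0 < (s i * t i) * f 0 * h 1" by (simp add: eventually_const trivial_limit_at_left_real)
    also have "\<dots> = (s i * t i * frame_det w ?xs w s ?xs * frame_det \<tau>' ?xs v t ?ys * det Q) * det P"
      unfolding f0 h1 by (simp add: algebra_simps)
    finally show "s i * t i * frame_det w ?xs w s ?xs * frame_det \<tau>' ?xs v t ?ys * det Q > 0"
      using dP by (simp add: zero_less_mult_iff)
  qed
qed

text \<open>
  In all cases the sign is read off from two minors; the row maps \<open>\<tau>\<close>, \<open>\<tau>'\<close> move indices outside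
  \<open>D\<close> at most along \<open>w\<close>, and \<open>\<kappa>\<close> depends only on the restriction to \<open>D\<close>.
\<close>

definition sign_recipe :: "(nat \<Rightarrow> nat) \<Rightarrow> (nat \<Rightarrow> nat) \<Rightarrow> real \<Rightarrow> bool" where
  "sign_recipe \<tau> \<tau>' \<kappa> \<longleftrightarrow>
     (if kind_ed v t w s i j then \<tau> = w \<and> \<tau>' = w(i := v i) \<and> \<kappa> = s i * t i
      else if kind_ff v t w s i j \<and> t i = 1 \<or> kind_fe v t w s i j \<and> t i = 1 \<or>
        kind_ef v t w s i j \<and> t j = -1 \<or> kind_ee_crossing v t w s i j \<and> s j = 1
      then \<tau> = w \<and> \<tau>' = w \<and> \<kappa> = 1 else \<tau> = (\<lambda>c. c) \<and> \<tau>' = (\<lambda>c. c) \<and> \<kappa> = 1)"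

text \<open>Orbits dictate the row map. For \<open>ff\<close> with \<open>t i = 1\<close> the only
  negative orbit of \<open>v\<close> in \<open>D\<close> is that of \<open>j\<close>, reached by
  \<open>w i\<close> but not by \<open>i\<close>. For crossing \<open>ee\<close> with
  \<open>s j = 1\<close> the set \<open>I_W\<close> meets \<open>D\<close> in \<open>i\<close> and
  \<open>v i\<close>, one orbit of \<open>v\<close>, and \<open>w\<close> spreads them over both
  orbits. The other cases are alike.\<close>

lemma sign_recipe_hit:
  assumes R: "sign_recipe \<tau> \<tau>' \<kappa>" and ned: "\<not> kind_ed v t w s i j" and d: "d \<in> neg_set n v t"
  shows "\<exists>c\<in>neg_set n w s. \<tau> c = d \<or> \<tau> c = v d"
proof (cases "d \<in> D")
  case False
  have "\<tau> c = c \<or> \<tau> c = w c" for c using R ned by (auto simp: sign_recipe_def split: if_splits)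
  then show ?thesis using hit_off_D[OF d False, of \<tau>] by blast
next
  case True
  note S = DV(4)[OF ijn(1)] DV(4)[OF ijn(2)] DW(4)[OF ijn(1)] DW(4)[OF ijn(2)]
  have vv: "v (v i) = i" "v (v j) = j" using DV(2) ijn by auto
  have vn: "v i < n" "v j < n" using DV(1) ijn by auto
  have tt: "t (v i) = t i" "t (v j) = t j" using DV(3) ijn by auto
  have neg: "c \<in> neg_set n w s \<longleftrightarrow> c < n \<and> (c < w c \<or> w c = c \<and> s c = -1)" for c by (simp add: neg_set_def)
  have dd: "d < v d \<or> v d = d \<and> t d = -1" using d by (simp add: neg_set_def)
  have dcase: "d = i \<or> d = j \<or> d = v i \<or> d = v j" using True by (simp add: D_def)
  consider "kind_ff v t w s i j" | "kind_fe v t w s i j" | "kind_ef v t w s i j"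
    | "kind_ee_noncrossing v t w s i j" | "kind_ee_crossing v t w s i j" using kind ned by blast
  then show ?thesis
  proof cases
    case 1
    then have "\<tau> i = d \<or> \<tau> i = v d" "i \<in> neg_set n w s"
      using R ned dcase dd S(1) ijn unfolding sign_recipe_def neg by (auto simp: kind_defs)
    then show ?thesis by blast
  next
    case 2
    have iI: "i \<in> neg_set n w s" and jI: "t i = -1 \<Longrightarrow> j \<in> neg_set n w s" using 2 ijn unfolding neg by (auto simp: kind_defs)
    have "d = i \<and> t i = -1 \<or> d = j" using 2 dcase dd vv by (auto simp: kind_defs)
    moreover have "\<tau> = (if t i = 1 then w else (\<lambda>c. c))" using R ned 2 unfolding sign_recipe_def by (auto simp: kind_defs)
    moreover have "w i = v j" using 2 by (simp add: kind_defs)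
    ultimately show ?thesis using iI jI S(1) by auto
  next
    case 3
    have iI: "i \<in> neg_set n w s" and kI: "t j = -1 \<Longrightarrow> v i \<in> neg_set n w s" using 3 ijn vn unfolding neg by (auto simp: kind_defs)
    have "d = j \<and> t j = -1 \<or> d = i" using 3 dcase dd vv by (auto simp: kind_defs)
    moreover have "\<tau> = (if t j = -1 then w else (\<lambda>c. c))" using R ned 3 unfolding sign_recipe_def by (auto simp: kind_defs)
    moreover have "w i = j" "w (v i) = v i" using 3 by (simp_all add: kind_defs)
    ultimately show ?thesis using iI kI S(2) by auto
  next
    case 4
    have iI: "i \<in> neg_set n w s" and jI: "j \<in> neg_set n w s" using 4 ijn unfolding neg by (auto simp: kind_defs)
    have "d = i \<or> d = j" using 4 dcase dd vv by (auto simp: kind_defs)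
    moreover have "\<tau> = (\<lambda>c. c)" using R ned 4 unfolding sign_recipe_def by (auto simp: kind_defs)
    ultimately show ?thesis using iI jI by auto
  next
    case 5
    have iI: "i \<in> neg_set n w s" and jI: "s j = -1 \<Longrightarrow> j \<in> neg_set n w s" and kI: "s j = 1 \<Longrightarrow> v i \<in> neg_set n w s"
      using 5 ijn vn unfolding neg by (auto simp: kind_defs)
    have "d = i \<or> d = j" using 5 dcase dd vv by (auto simp: kind_defs)
    moreover have "\<tau> = (if s j = 1 then w else (\<lambda>c. c))" using R ned 5 unfolding sign_recipe_def by (auto simp: kind_defs)
    moreover have "w i = v j" "w (v i) = v i" using 5 by (simp_all add: kind_defs)
    ultimately show ?thesis using iI jI kI S(4) by auto
  qed
qed

lemma sign_recipe_lt:
  assumes "sign_recipe \<tau> \<tau>' \<kappa>" "c < n"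
  shows "\<tau> c < n" "\<tau>' c < n"
  using assms DW(1) DV(1)[OF ijn(1)] by (auto simp: sign_recipe_def split: if_splits)

text \<open>Since the row maps preserve \<open>D\<close> and agree off \<open>D\<close>, the
  reordered minors become block diagonal with equal rows in the block off \<open>D\<close>.\<close>

lemma sign_recipe_D:
  assumes "sign_recipe \<tau> \<tau>' \<kappa>" "c < n"
  shows "\<tau> c \<in> D \<longleftrightarrow> c \<in> D" "\<tau>' c \<in> D \<longleftrightarrow> c \<in> D" "c \<notin> D \<Longrightarrow> \<tau>' c = \<tau> c"
  using assms w_D by (auto simp: sign_recipe_def D_def split: if_splits)

lemma sign_recipe_nonzero:
  assumes R: "sign_recipe \<tau> \<tau>' \<kappa>"
  shows "\<kappa> \<noteq> 0" "frame_det \<tau> (neg_list n w s) w s (neg_list n w s) \<noteq> 0"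
    "frame_det \<tau>' (neg_list n w s) v t (neg_list n v t) \<noteq> 0"
proof -
  have \<tau>: "\<tau> c = c \<or> \<tau> c = w c" for c using R by (auto simp: sign_recipe_def split: if_splits)
  have lt: "\<tau> c < n" "\<tau>' c < n" if "c \<in> set (neg_list n w s)" for c
    using sign_recipe_lt[OF R, of c] that neg_set_lt[of c n w s] by auto
  show "\<kappa> \<noteq> 0" using R DV(6)[OF ijn(1)] DW(6)[OF ijn(1)] by (auto simp: sign_recipe_def split: if_splits)
  show "frame_det \<tau> (neg_list n w s) w s (neg_list n w s) \<noteq> 0"
    by (rule frame_det_nonzero[OF W _ lt(1)]) (use \<tau> in auto)
  show "frame_det \<tau>' (neg_list n w s) v t (neg_list n v t) \<noteq> 0"
  proof (rule frame_det_nonzero[OF V _ lt(2)])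
    show "\<exists>c\<in>set (neg_list n w s). \<tau>' c = d \<or> \<tau>' c = v d" if d: "d \<in> neg_set n v t" for d
    proof (cases "kind_ed v t w s i j")
      case True
      then show ?thesis using R ed_hit[OF True d] by (simp add: sign_recipe_def)
    next
      case False
      then have "\<tau>' = \<tau>" using R by (auto simp: sign_recipe_def split: if_splits)
      then show ?thesis using sign_recipe_hit[OF R False d] by simp
    qed
  qed (simp_all add: card_eq)
qed

lemma orient_sign_formula:
  assumes R: "sign_recipe \<tau> \<tau>' \<kappa>" and perm: "v permutes {..<n}" "w permutes {..<n}"
  shows "orient_sign n (spm n v t) (spm n w s) =
    (if \<kappa> * frame_det \<tau> (neg_list n w s) w s (neg_list n w s) *
        frame_det \<tau>' (neg_list n w s) v t (neg_list n v t) > 0 then 1 else -1)"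
proof (cases "kind_ed v t w s i j")
  case True
  then show ?thesis using orient_sign_ed[OF True perm] R by (simp add: sign_recipe_def)
next
  case False
  have \<tau>: "\<tau> = w \<or> \<tau> = (\<lambda>c. c)" and eq: "\<tau>' = \<tau>" "\<kappa> = 1"
    using R False by (auto simp: sign_recipe_def split: if_splits)
  obtain g0 where g0: "cell_path n (spm n v t) (spm n w s) g0" using cell_path_exists by blast
  have "frame_det \<tau> (neg_list n w s) v t (neg_list n v t) \<noteq> 0"
    using sign_recipe_nonzero(3)[OF R] eq by simp
  then show ?thesis unfolding eq using orient_sign_transversal[OF V perm(1) W perm(2) g0 \<tau>] by simp
qed

end



section \<open>Restriction to the rise\<close>

lemma permuted_list:
  assumes xs: "distinct xs" "distinct xs'" "set xs = set xs'"
  obtains \<pi> where "\<pi> permutes {..<length xs}" "\<And>a. a < length xs \<Longrightarrow> xs' ! a = xs ! \<pi> a" "length xs' = length xs"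
proof -
  have "mset xs' = mset xs" using xs by (simp add: set_eq_iff_mset_eq_distinct)
  then obtain \<pi> where \<pi>: "\<pi> permutes {..<length xs}" "permute_list \<pi> xs = xs'" by (rule mset_eq_permutation)
  have len: "length xs' = length xs" using \<pi>(2) by (metis length_permute_list)
  have "xs' ! a = xs ! \<pi> a" if "a < length xs" for a
    using permute_list_nth[OF \<pi>(1) that] \<pi>(2) by simp
  then show ?thesis using \<pi>(1) len that by blast
qed

text \<open>A shuffle permutes the elements of \<open>I\<close>, while rows of a determinant are
  permuted by position. Conjugation with the sorted enumeration of \<open>I\<close> passes between
  the two and preserves the sign.\<close>

lemma shuffle_perm_positions:
  fixes I D :: "nat set"
  assumes I: "finite I"
  obtains \<pi> where "\<pi> permutes {..<card I}"
    "\<And>a. a < card I \<Longrightarrow> (sorted_list_of_set (I \<inter> D) @ sorted_list_of_set (I - D)) ! a = sorted_list_of_set I ! \<pi> a"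
    "sign (shuffle_perm D I) = sign \<pi>"
proof -
  let ?xs = "sorted_list_of_set I" and ?ys = "sorted_list_of_set (I \<inter> D) @ sorted_list_of_set (I - D)"
  have xs: "distinct ?xs" "distinct ?ys" "set ?xs = set ?ys" and len: "length ?xs = card I"
    using I by auto
  obtain \<pi> where \<pi>: "\<pi> permutes {..<card I}" "\<And>a. a < card I \<Longrightarrow> ?ys ! a = ?xs ! \<pi> a" "length ?ys = card I"
    using permuted_list[OF xs] len by metis
  define \<rho> where "\<rho> = map_permutation {..<card I} (nth ?xs) \<pi>"
  have bij: "bij_betw (nth ?xs) {..<card I} I" using bij_betw_nth[OF xs(1) refl refl] I len by simp
  have inj: "inj_on (nth ?xs) {..<card I}" using bij by (simp add: bij_betw_def)
  have \<rho>: "\<rho> permutes I" unfolding \<rho>_def by (rule map_permutation_permutes[OF bij \<pi>(1)])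
  have map: "map \<rho> ?xs = ?ys"
  proof (rule nth_equalityI)
    show "length (map \<rho> ?xs) = length ?ys" using \<pi>(3) len by simp
    fix a assume "a < length (map \<rho> ?xs)"
    then have a: "a < card I" using len by simp
    have "\<rho> (?xs ! a) = ?xs ! \<pi> a" unfolding \<rho>_def by (rule map_permutation_apply[OF inj]) (use a in simp)
    then show "map \<rho> ?xs ! a = ?ys ! a" using \<pi>(2)[OF a] a len by simp
  qed
  have "shuffle_perm D I = \<rho>" unfolding shuffle_perm_def
  proof (rule the_equality)
    show "\<rho> permutes I \<and> map \<rho> ?xs = ?ys" using \<rho> map by blast
    fix \<rho>' assume \<rho>': "\<rho>' permutes I \<and> map \<rho>' ?xs = ?ys"
    show "\<rho>' = \<rho>"
    proof
      fix c show "\<rho>' c = \<rho> c"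
      proof (cases "c \<in> I")
        case True
        then have "c \<in> set ?xs" using I by simp
        moreover have "map \<rho>' ?xs = map \<rho> ?xs" using \<rho>' map by simp
        ultimately show ?thesis by (meson map_eq_conv)
      next
        case False
        then show ?thesis using permutes_not_in[OF \<rho>] permutes_not_in[OF conjunct1[OF \<rho>']] by simp
      qed
    qed
  qed
  moreover have "sign \<rho> = sign \<pi>" unfolding \<rho>_def by (rule sign_map_permutation[OF inj \<pi>(1)]) simp
  ultimately show ?thesis using \<pi>(1,2) that by simp
qed

lemma det_permute_lists:
  fixes f :: "nat \<Rightarrow> nat \<Rightarrow> real"
  assumes \<pi>: "\<pi> permutes {..<k}" and \<sigma>: "\<sigma> permutes {..<k}"
    and xs: "\<And>a. a < k \<Longrightarrow> xs' ! a = xs ! \<pi> a" and ys: "\<And>b. b < k \<Longrightarrow> ys' ! b = ys ! \<sigma> b"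
  shows "det (mat k k (\<lambda>(a, b). f (ys' ! b) (xs' ! a))) =
    of_int (sign \<pi>) * of_int (sign \<sigma>) * det (mat k k (\<lambda>(a, b). f (ys ! b) (xs ! a)))"
proof -
  have \<pi>': "\<pi> permutes {0..<k}" and \<sigma>': "\<sigma> permutes {0..<k}" using \<pi> \<sigma> by (simp_all add: lessThan_atLeast0)
  have \<pi>n: "\<pi> a < k" if "a < k" for a using permutes_in_image[OF \<pi>, of a] that by simp
  have \<sigma>n: "\<sigma> a < k" if "a < k" for a using permutes_in_image[OF \<sigma>, of a] that by simp
  let ?A = "mat k k (\<lambda>(a, b). f (ys ! b) (xs ! a))"
  let ?B = "mat k k (\<lambda>(b, a). f (ys ! b) (xs' ! a))"
  have "mat k k (\<lambda>(a, b). f (ys' ! b) (xs' ! a)) = transpose_mat (mat k k (\<lambda>(b, a). ?B $$ (\<sigma> b, a)))"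
    using ys \<sigma>n by (intro eq_matI) auto
  then have "det (mat k k (\<lambda>(a, b). f (ys' ! b) (xs' ! a))) = det (mat k k (\<lambda>(b, a). ?B $$ (\<sigma> b, a)))"
    using det_transpose[of "mat k k (\<lambda>(b, a). ?B $$ (\<sigma> b, a))" k] by simp
  also have "\<dots> = of_int (sign \<sigma>) * det ?B" by (rule det_permute_rows[OF _ \<sigma>']) simp
  also have "det ?B = det (transpose_mat ?B)" by (rule det_transpose[symmetric, of _ k]) simp
  also have "transpose_mat ?B = mat k k (\<lambda>(a, b). ?A $$ (\<pi> a, b))"
    using xs \<pi>n by (intro eq_matI) auto
  also have "det \<dots> = of_int (sign \<pi>) * det ?A" by (rule det_permute_rows[OF _ \<pi>']) simp
  finally show ?thesis by simp
qed

lemma frame_det_shuffle: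
  assumes xs: "xs = sorted_list_of_set I" "xs' = sorted_list_of_set (I \<inter> D) @ sorted_list_of_set (I - D)" "finite I"
    and ys: "ys = sorted_list_of_set J" "ys' = sorted_list_of_set (J \<inter> D) @ sorted_list_of_set (J - D)" "finite J"
    and card: "card I = card J"
  shows "frame_det \<tau> xs' v t ys' = of_int (sign (shuffle_perm D I) * sign (shuffle_perm D J)) * frame_det \<tau> xs v t ys"
proof -
  obtain \<pi> where \<pi>: "\<pi> permutes {..<card I}" "\<And>a. a < card I \<Longrightarrow> xs' ! a = xs ! \<pi> a" "sign (shuffle_perm D I) = sign \<pi>"
    using shuffle_perm_positions[OF xs(3), of D] xs by metis
  obtain \<sigma> where \<sigma>: "\<sigma> permutes {..<card I}" "\<And>a. a < card I \<Longrightarrow> ys' ! a = ys ! \<sigma> a" "sign (shuffle_perm D J) = sign \<sigma>"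
    using shuffle_perm_positions[OF ys(3), of D] ys card by metis
  have len: "length xs = card I" "length xs' = card I"
    using xs card_Int_Diff[of I D] by auto
  show ?thesis unfolding frame_det_def len \<pi>(3) \<sigma>(3)
    using det_permute_lists[OF \<pi>(1) \<sigma>(1), of xs' xs ys' ys "\<lambda>d c. frame_entry v t d (\<tau> c)"] \<pi>(2) \<sigma>(2) by simp
qed

lemma frame_det_append:
  assumes len: "length as = length bs"
    and 1: "\<And>c d. c \<in> set as \<Longrightarrow> d \<in> set bs' \<Longrightarrow> frame_entry v t d (\<tau> c) = 0"
    and 2: "\<And>c d. c \<in> set as' \<Longrightarrow> d \<in> set bs \<Longrightarrow> frame_entry v t d (\<tau> c) = 0"
    and len': "length as' = length bs'"
  shows "frame_det \<tau> (as @ as') v t (bs @ bs') = frame_det \<tau> as v t bs * frame_det \<tau> as' v t bs'"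
proof -
  let ?k = "length as" and ?l = "length as'"
  let ?A = "mat ?k ?k (\<lambda>(a, b). frame_entry v t (bs ! b) (\<tau> (as ! a)))"
  let ?D = "mat ?l ?l (\<lambda>(a, b). frame_entry v t (bs' ! b) (\<tau> (as' ! a)))"
  have "mat (length (as @ as')) (length (as @ as')) (\<lambda>(a, b). frame_entry v t ((bs @ bs') ! b) (\<tau> ((as @ as') ! a)))
      = four_block_mat ?A (0\<^sub>m ?k ?l) (0\<^sub>m ?l ?k) ?D"
    using len len' 1 2 by (intro eq_matI) (auto simp: nth_append)
  then show ?thesis unfolding frame_det_def
    by (simp only:) (rule det_four_block_mat_upper_right_zero[where n = ?k and m = ?l], auto)
qed

lemma sorted_list_of_set_image:
  assumes I: "finite I" and p: "\<And>x y. x \<in> I \<Longrightarrow> y \<in> I \<Longrightarrow> x < y \<Longrightarrow> p x < (p y :: nat)"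
  shows "sorted_list_of_set (p ` I) = map p (sorted_list_of_set (I :: nat set))"
proof (rule sorted_distinct_set_unique)
  have inj: "inj_on p I" using p by (metis inj_onI linorder_neqE_nat less_irrefl)
  show "distinct (map p (sorted_list_of_set I))" using inj I by (simp add: distinct_map)
  have strict: "sorted_wrt (<) (sorted_list_of_set I)" by simp
  have "sorted_wrt (\<lambda>x y. p x < p y) (sorted_list_of_set I)"
  proof (rule sorted_wrt_mono_rel[OF _ strict])
    fix x y assume "x \<in> set (sorted_list_of_set I)" "y \<in> set (sorted_list_of_set I)" "x < y"
    then show "p x < p y" using p I by simp
  qed
  then have "sorted_wrt (<) (map p (sorted_list_of_set I))" by (simp add: sorted_wrt_map)
  then show "sorted (map p (sorted_list_of_set I))" by (rule strict_sorted_imp_sorted)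
qed (use I in auto)

section \<open>The configuration on D, relabelled by ranks\<close>

context rise_config
begin

text \<open>The order preserving bijection from \<open>D\<close> to \<open>{..<card D}\<close>,
  inverse to \<open>pick D\<close>.\<close>

definition pos :: "nat \<Rightarrow> nat" where "pos x = card {a \<in> D. a < x}"
text \<open>The identity from \<open>card D\<close> on, as \<open>permutes\<close> requires.\<close>

definition rv :: "nat \<Rightarrow> nat" where "rv a = (if a < card D then pos (v (pick D a)) else a)"
definition rw :: "nat \<Rightarrow> nat" where "rw a = (if a < card D then pos (w (pick D a)) else a)"
definition rt :: "nat \<Rightarrow> real" where "rt a = t (pick D a)"
definition rs :: "nat \<Rightarrow> real" where "rs a = s (pick D a)"

lemma finite_D: "finite D" by (simp add: D_def)

lemma pick_pos: "x \<in> D \<Longrightarrow> pick D (pos x) = x"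
  unfolding pos_def by (rule pick_card_in_set)

lemma pos_lt: "x \<in> D \<Longrightarrow> pos x < card D"
  unfolding pos_def by (rule psubset_card_mono[OF finite_D]) auto

lemma pick_mem: "a < card D \<Longrightarrow> pick D a \<in> D"
  by (rule pick_in_set_le)

lemma pos_pick: "a < card D \<Longrightarrow> pos (pick D a) = a"
  unfolding pos_def by (rule card_pick_le)

lemma pos_eq_iff: assumes "x \<in> D" "y \<in> D" shows "pos x = pos y \<longleftrightarrow> x = y"
proof
  assume "pos x = pos y"
  then have "pick D (pos x) = pick D (pos y)" by (rule arg_cong)
  then show "x = y" unfolding pick_pos[OF assms(1)] pick_pos[OF assms(2)] .
qed simp

lemma pos_less_iff: assumes "x \<in> D" "y \<in> D" shows "pos x < pos y \<longleftrightarrow> x < y"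
proof -
  have mono: "x < y" if "pos x < pos y" "x \<in> D" "y \<in> D" for x y
    using pick_mono_le[OF pos_lt[OF that(3)] that(1)] pick_pos[OF that(2)] pick_pos[OF that(3)] by simp
  consider "pos x < pos y" | "pos x = pos y" | "pos y < pos x" by linarith
  then show ?thesis using mono[of x y] mono[of y x] pos_eq_iff[OF assms] assms by cases auto
qed

lemma v_mem: "x \<in> D \<Longrightarrow> v x \<in> D" and w_mem: "x \<in> D \<Longrightarrow> w x \<in> D"
  using v_D w_D D_lt by blast+

lemma restrict_pos [simp]:
  assumes "x \<in> D"
  shows "rv (pos x) = pos (v x)" "rw (pos x) = pos (w x)" "rt (pos x) = t x" "rs (pos x) = s x"
  using pos_lt[OF assms] pick_pos[OF assms] by (simp_all add: rv_def rw_def rt_def rs_def)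

lemma ij_mem: "i \<in> D" "j \<in> D" by (simp_all add: D_def)

lemma restrict_data: "involution_data (card D) rv rt" "involution_data (card D) rw rs"
proof -
  show "involution_data (card D) rv rt"
    unfolding involution_data_def
  proof (intro allI impI)
    fix a assume a: "a < card D"
    define x where "x = pick D a"
    have x: "x \<in> D" "a = pos x" using pick_mem[OF a] pos_pick[OF a] by (auto simp: x_def)
    show "rv a < card D \<and> rv (rv a) = a \<and> rt (rv a) = rt a \<and> (rt a = 1 \<or> rt a = - 1)"
      unfolding x(2) using x(1) v_mem[OF x(1)] pos_lt[OF v_mem[OF x(1)]] DV[OF D_lt[OF x(1)]] by simp
  qed
  show "involution_data (card D) rw rs"
    unfolding involution_data_def
  proof (intro allI impI)
    fix a assume a: "a < card D"
    define x where "x = pick D a"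
    have x: "x \<in> D" "a = pos x" using pick_mem[OF a] pos_pick[OF a] by (auto simp: x_def)
    show "rw a < card D \<and> rw (rw a) = a \<and> rs (rw a) = rs a \<and> (rs a = 1 \<or> rs a = - 1)"
      unfolding x(2) using x(1) w_mem[OF x(1)] pos_lt[OF w_mem[OF x(1)]] DW[OF D_lt[OF x(1)]] by simp
  qed
qed

lemma restrict_permutes: "rv permutes {..<card D}" "rw permutes {..<card D}"
proof -
  have "p permutes {..<m}" if "involution_data m p q" "\<And>a. \<not> a < m \<Longrightarrow> p a = a" for m p q
  proof (rule bij_imp_permutes)
    show "bij_betw p {..<m} {..<m}"
      by (rule bij_betwI[of _ _ _ p]) (use involution_dataD[OF that(1)] in auto)
  qed (use that(2) in auto)
  then show "rv permutes {..<card D}" "rw permutes {..<card D}"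
    using restrict_data by (auto simp: rv_def rw_def)
qed

lemma restrict_kinds:
  "kind_ff rv rt rw rs (pos i) (pos j) \<longleftrightarrow> kind_ff v t w s i j"
  "kind_fe rv rt rw rs (pos i) (pos j) \<longleftrightarrow> kind_fe v t w s i j"
  "kind_ef rv rt rw rs (pos i) (pos j) \<longleftrightarrow> kind_ef v t w s i j"
  "kind_ee_noncrossing rv rt rw rs (pos i) (pos j) \<longleftrightarrow> kind_ee_noncrossing v t w s i j"
  "kind_ee_crossing rv rt rw rs (pos i) (pos j) \<longleftrightarrow> kind_ee_crossing v t w s i j"
  "kind_ed rv rt rw rs (pos i) (pos j) \<longleftrightarrow> kind_ed v t w s i j"
  using ij_mem by (simp_all add: kind_defs v_mem w_mem pos_less_iff pos_eq_iff)

text \<open>An index strictly between \<open>pos i\<close> and \<open>pos j\<close> is the rank of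
  an element of \<open>D\<close> between \<open>i\<close> and \<open>j\<close>, so freeness is
  inherited. No index of the small configuration lies outside its rise.\<close>

lemma restrict_config: "rise_config (card D) rv rt rw rs (pos i) (pos j)"
proof
  show "involution_data (card D) rv rt" "involution_data (card D) rw rs" by (rule restrict_data)+
  show "pos i < card D" "pos j < card D" using pos_lt ij_mem by auto
  show "\<not> (rv (pos i) < rv m \<and> rv m < rv (pos j))" if m: "pos i < m" "m < pos j" for m
  proof -
    have a: "m < card D" using m pos_lt[OF ij_mem(2)] by simp
    define x where "x = pick D m"
    have x: "x \<in> D" "m = pos x" using pick_mem[OF a] pos_pick[OF a] by (auto simp: x_def)
    show ?thesis using m free[of x] x ij_mem by (simp add: pos_less_iff v_mem)
  qed
  show "rw x = rv x \<and> rs x = rt x" if "x < card D" "x \<notin> {pos i, pos j, rv (pos i), rv (pos j)}" for x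
  proof -
    have "x = pos (pick D x)" "pick D x \<in> D" using that pos_pick pick_mem by auto
    then show ?thesis using that ij_mem by (auto simp: D_def)
  qed
  show "kind_ff rv rt rw rs (pos i) (pos j) \<or> kind_fe rv rt rw rs (pos i) (pos j) \<or>
    kind_ef rv rt rw rs (pos i) (pos j) \<or> kind_ee_noncrossing rv rt rw rs (pos i) (pos j) \<or>
    kind_ee_crossing rv rt rw rs (pos i) (pos j) \<or> kind_ed rv rt rw rs (pos i) (pos j)"
    unfolding restrict_kinds by (rule kind)
qed

lemma submatrix_restrict:
  "submatrix (spm n v t) D D = spm (card D) rv rt" "submatrix (spm n w s) D D = spm (card D) rw rs"
proof -
  have card: "card {x. x < n \<and> x \<in> D} = card D" by (rule arg_cong[of _ _ card]) (use D_lt in auto)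
  have lt: "pick D a < n" if "a < card D" for a using D_lt pick_mem[OF that] by blast
  have "a = rv b \<longleftrightarrow> pick D a = v (pick D b)" "a = rw b \<longleftrightarrow> pick D a = w (pick D b)" if "a < card D" "b < card D" for a b
    using that pos_eq_iff[OF pick_mem[OF that(1)] v_mem[OF pick_mem[OF that(2)]]]
      pos_eq_iff[OF pick_mem[OF that(1)] w_mem[OF pick_mem[OF that(2)]]] by (auto simp: rv_def rw_def pos_pick)
  then show "submatrix (spm n v t) D D = spm (card D) rv rt" "submatrix (spm n w s) D D = spm (card D) rw rs"
    using lt by (auto simp: submatrix_def card rt_def rs_def intro!: eq_matI)
qed

lemma neg_list_restrict:
  "neg_list (card D) rv rt = map pos (sorted_list_of_set (neg_set n v t \<inter> D))"
  "neg_list (card D) rw rs = map pos (sorted_list_of_set (neg_set n w s \<inter> D))"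
proof -
  have eq: "neg_set (card D) ru rq = pos ` (neg_set n u q \<inter> D)"
    if u: "\<And>x. x \<in> D \<Longrightarrow> ru (pos x) = pos (u x)" "\<And>x. x \<in> D \<Longrightarrow> rq (pos x) = q x" "\<And>x. x \<in> D \<Longrightarrow> u x \<in> D"
    for ru rq u and q :: "nat \<Rightarrow> real"
  proof (intro equalityI subsetI)
    fix a assume a: "a \<in> neg_set (card D) ru rq"
    then have ac: "a < card D" by (simp add: neg_set_def)
    define x where "x = pick D a"
    have x: "x \<in> D" "a = pos x" using pick_mem[OF ac] pos_pick[OF ac] by (auto simp: x_def)
    have "x \<in> neg_set n u q" using a u x D_lt by (auto simp: neg_set_def pos_less_iff pos_eq_iff)
    then show "a \<in> pos ` (neg_set n u q \<inter> D)" using x by blast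
  next
    fix a assume "a \<in> pos ` (neg_set n u q \<inter> D)"
    then obtain x where x: "x \<in> D" "a = pos x" "x \<in> neg_set n u q" by blast
    then show "a \<in> neg_set (card D) ru rq" using u pos_lt by (auto simp: neg_set_def pos_less_iff pos_eq_iff)
  qed
  show "neg_list (card D) rv rt = map pos (sorted_list_of_set (neg_set n v t \<inter> D))"
    unfolding neg_list_def
    by (subst eq[of rv v rt t], (simp_all add: v_mem)[3], subst sorted_list_of_set_image) (auto simp: pos_less_iff)
  show "neg_list (card D) rw rs = map pos (sorted_list_of_set (neg_set n w s \<inter> D))"
    unfolding neg_list_def
    by (subst eq[of rw w rs s], (simp_all add: w_mem)[3], subst sorted_list_of_set_image) (auto simp: pos_less_iff)
qed

lemma frame_det_restrict:
  assumes "set as \<subseteq> D" "set bs \<subseteq> D" "length as = length bs"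
    and \<tau>: "\<And>c. c \<in> D \<Longrightarrow> \<tau> c \<in> D \<and> \<tau>r (pos c) = pos (\<tau> c)"
    and u: "\<And>x. x \<in> D \<Longrightarrow> ru (pos x) = pos (u x)" "\<And>x. x \<in> D \<Longrightarrow> rq (pos x) = q x" "\<And>x. x \<in> D \<Longrightarrow> u x \<in> D"
  shows "frame_det \<tau>r (map pos as) ru rq (map pos bs) = frame_det \<tau> as u q bs"
proof -
  have "frame_entry ru rq (pos d) (\<tau>r (pos c)) = frame_entry u q d (\<tau> c)" if "c \<in> D" "d \<in> D" for c d
    using that \<tau>[OF that(1)] u by (simp add: frame_entry_def pos_eq_iff)
  moreover have "as ! a \<in> D" "bs ! a \<in> D" if "a < length as" for a using assms(1-3) that by (auto simp: subset_iff)
  ultimately show ?thesis unfolding frame_det_def using assms(3)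
    by (auto intro!: arg_cong[of _ _ det] eq_matI)
qed

text \<open>Sorting rows and columns costs the shuffle sign of \<open>I_W\<close> twice in the minor
  at \<open>W\<close>, but the signs of \<open>I_W\<close> and \<open>I_V\<close> once each in the
  minor at \<open>V\<close>. The block \<open>C\<close> off \<open>D\<close> occurs in both minors,
  hence as a square in their product, and the blocks on \<open>D\<close> are the minors of the small
  configuration.\<close>

theorem orient_sign_restrict:
  assumes perm: "v permutes {..<n}" "w permutes {..<n}"
  shows "orient_sign n (spm n v t) (spm n w s) =
    orient_sign (card D) (spm (card D) rv rt) (spm (card D) rw rs) *
    sign (shuffle_perm D (neg_set n v t)) * sign (shuffle_perm D (neg_set n w s))"
proof -
  interpret r: rise_config "card D" rv rt rw rs "pos i" "pos j" by (rule restrict_config)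
  have "\<exists>\<tau> \<tau>' \<kappa>. if P then \<tau> = w \<and> \<tau>' = w(i := v i) \<and> \<kappa> = s i * t i
      else if Q then \<tau> = w \<and> \<tau>' = w \<and> \<kappa> = 1 else \<tau> = (\<lambda>c. c) \<and> \<tau>' = (\<lambda>c. c) \<and> \<kappa> = 1" for P Q
    by (cases P; cases Q; simp)
  then have "\<exists>\<tau> \<tau>' \<kappa>. sign_recipe \<tau> \<tau>' \<kappa>" unfolding sign_recipe_def .
  then obtain \<tau> \<tau>' \<kappa> where R: "sign_recipe \<tau> \<tau>' \<kappa>" by blast
  obtain \<tau>r \<tau>r' where R': "r.sign_recipe \<tau>r \<tau>r' \<kappa>"
    and \<tau>r: "\<And>c. c \<in> D \<Longrightarrow> \<tau>r (pos c) = pos (\<tau> c)" "\<And>c. c \<in> D \<Longrightarrow> \<tau>r' (pos c) = pos (\<tau>' c)"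
  proof -
    define b1 b2 where b: "b1 = kind_ed v t w s i j" "b2 = (kind_ff v t w s i j \<and> t i = 1 \<or> kind_fe v t w s i j \<and> t i = 1 \<or>
        kind_ef v t w s i j \<and> t j = -1 \<or> kind_ee_crossing v t w s i j \<and> s j = 1)"
    have sr: "sign_recipe \<tau> \<tau>' \<kappa> \<longleftrightarrow> (if b1 then \<tau> = w \<and> \<tau>' = w(i := v i) \<and> \<kappa> = s i * t i
      else if b2 then \<tau> = w \<and> \<tau>' = w \<and> \<kappa> = 1 else \<tau> = (\<lambda>c. c) \<and> \<tau>' = (\<lambda>c. c) \<and> \<kappa> = 1)"
      unfolding sign_recipe_def b ..
    have rr: "r.sign_recipe \<alpha> \<alpha>' \<kappa>' \<longleftrightarrow> (if b1 then \<alpha> = rw \<and> \<alpha>' = rw(pos i := rv (pos i)) \<and> \<kappa>' = s i * t i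
      else if b2 then \<alpha> = rw \<and> \<alpha>' = rw \<and> \<kappa>' = 1 else \<alpha> = (\<lambda>c. c) \<and> \<alpha>' = (\<lambda>c. c) \<and> \<kappa>' = 1)" for \<alpha> \<alpha>' \<kappa>'
      unfolding r.sign_recipe_def restrict_kinds restrict_pos(3,4)[OF ij_mem(1)] restrict_pos(3,4)[OF ij_mem(2)] b ..
    define \<tau>r where "\<tau>r = (if b1 \<or> b2 then rw else (\<lambda>c. c))"
    define \<tau>r' where "\<tau>r' = (if b1 then rw(pos i := rv (pos i)) else \<tau>r)"
    have "r.sign_recipe \<tau>r \<tau>r' \<kappa>" using R unfolding sr rr \<tau>r'_def \<tau>r_def by (cases b1; cases b2; simp)
    moreover have "\<tau>r (pos c) = pos (\<tau> c)" "\<tau>r' (pos c) = pos (\<tau>' c)" if "c \<in> D" for c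
      using R that ij_mem unfolding sr \<tau>r'_def \<tau>r_def by (cases b1; cases b2; simp add: pos_eq_iff)+
    ultimately show ?thesis by (rule that)
  qed
  let ?xs = "neg_list n w s" and ?ys = "neg_list n v t" and ?I = "neg_set n w s" and ?J = "neg_set n v t"
  let ?a = "sorted_list_of_set (?I \<inter> D)" and ?b = "sorted_list_of_set (?J \<inter> D)" and ?c = "sorted_list_of_set (?I - D)"
  have IJ: "?J - D = ?I - D" using off_D by (auto simp: neg_set_def)
  have cardD: "card (?I \<inter> D) = card (?J \<inter> D)"
    using card_eq card_Int_Diff[of ?I D] card_Int_Diff[of ?J D] IJ by simp
  have sets: "set ?a = ?I \<inter> D" "set ?b = ?J \<inter> D" "set ?c = ?I - D" by auto
  have lens: "length ?a = length ?b" using cardD by simp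
  have In: "c < n" if "c \<in> ?I \<or> c \<in> ?J" for c using that neg_set_lt by blast
  define A where "A = frame_det \<tau> ?a w s ?a"
  define B where "B = frame_det \<tau>' ?a v t ?b"
  define C where "C = frame_det \<tau> ?c w s ?c"
  define \<sigma> where "\<sigma> = sign (shuffle_perm D ?I) * sign (shuffle_perm D ?J)"
  have zero: "frame_entry u q d r = 0" if "d < n" "r \<in> D \<longleftrightarrow> d \<notin> D" "u d \<in> D \<longleftrightarrow> d \<in> D" for u q d r
    using that by (auto simp: frame_entry_def)
  have fW: "frame_det \<tau> ?xs w s ?xs = A * C"
  proof -
    have "frame_det \<tau> (?a @ ?c) w s (?a @ ?c) =
        of_int (sign (shuffle_perm D ?I) * sign (shuffle_perm D ?I)) * frame_det \<tau> ?xs w s ?xs"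
      by (rule frame_det_shuffle) (simp_all add: neg_list_def)
    also have "sign (shuffle_perm D ?I) * sign (shuffle_perm D ?I) = 1" by (simp add: sign_def)
    finally have "frame_det \<tau> ?xs w s ?xs = frame_det \<tau> (?a @ ?c) w s (?a @ ?c)" by simp
    also have "\<dots> = A * C" unfolding A_def C_def
      by (rule frame_det_append) (use sets In w_D sign_recipe_D[OF R] in \<open>auto intro!: zero\<close>)
    finally show ?thesis .
  qed
  have fV: "of_int \<sigma> * frame_det \<tau>' ?xs v t ?ys = B * C"
  proof -
    have e1: "frame_det \<tau>' (?a @ ?c) v t (?b @ ?c) = of_int \<sigma> * frame_det \<tau>' ?xs v t ?ys"
      unfolding \<sigma>_def by (rule frame_det_shuffle) (simp_all add: neg_list_def IJ card_eq)
    have e2: "frame_det \<tau>' (?a @ ?c) v t (?b @ ?c) = B * frame_det \<tau>' ?c v t ?c" unfolding B_def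
      by (rule frame_det_append[OF lens]) (use sets In v_D IJ sign_recipe_D[OF R] in \<open>auto intro!: zero\<close>)
    have e3: "frame_det \<tau>' ?c v t ?c = C"
    proof -
      define cs where "cs = ?c"
      have "frame_entry v t d (\<tau>' c) = frame_entry w s d (\<tau> c)" if cd: "c \<in> set cs" "d \<in> set cs" for c d
      proof -
        have "c < n" "d < n" "c \<notin> D" "d \<notin> D" using cd In by (auto simp: cs_def)
        then show ?thesis using sign_recipe_D(3)[OF R, of c] off_D[of d] by (simp add: frame_entry_def)
      qed
      then have "mat (length cs) (length cs) (\<lambda>(a, b). frame_entry v t (cs ! b) (\<tau>' (cs ! a))) =
          mat (length cs) (length cs) (\<lambda>(a, b). frame_entry w s (cs ! b) (\<tau> (cs ! a)))"
        by (intro eq_matI) auto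
      then show ?thesis unfolding C_def frame_det_def cs_def[symmetric] by (rule arg_cong)
    qed
    show ?thesis using e1 unfolding e2 e3 by (rule sym)
  qed
  have \<tau>D: "\<tau> c \<in> D" "\<tau>' c \<in> D" if "c \<in> D" for c using sign_recipe_D(1,2)[OF R D_lt[OF that]] that by simp_all
  have small: "orient_sign (card D) (spm (card D) rv rt) (spm (card D) rw rs) = (if \<kappa> * A * B > 0 then 1 else -1)"
  proof -
    have "frame_det \<tau>r (map pos ?a) rw rs (map pos ?a) = A" unfolding A_def
      by (rule frame_det_restrict) (use sets \<tau>D \<tau>r w_mem in auto)
    moreover have "frame_det \<tau>r' (map pos ?a) rv rt (map pos ?b) = B" unfolding B_def
      by (rule frame_det_restrict) (use sets \<tau>D \<tau>r v_mem lens in auto)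
    ultimately show ?thesis
      using r.orient_sign_formula[OF R' restrict_permutes] by (simp add: neg_list_restrict)
  qed
  have big: "orient_sign n (spm n v t) (spm n w s) =
      (if \<kappa> * frame_det \<tau> ?xs w s ?xs * frame_det \<tau>' ?xs v t ?ys > 0 then 1 else -1)"
    by (rule orient_sign_formula[OF R perm])
  note nz = sign_recipe_nonzero[OF R]
  have s1: "sign (shuffle_perm D ?I) = 1 \<or> sign (shuffle_perm D ?I) = -1" "sign (shuffle_perm D ?J) = 1 \<or> sign (shuffle_perm D ?J) = -1"
    by (simp_all add: sign_def)
  then have \<sigma>: "\<sigma> = 1 \<or> \<sigma> = -1" by (auto simp: \<sigma>_def)
  have "frame_det \<tau>' ?xs v t ?ys = of_int \<sigma> * (B * C)" using fV \<sigma> by auto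
  then have prod: "\<kappa> * frame_det \<tau> ?xs w s ?xs * frame_det \<tau>' ?xs v t ?ys = of_int \<sigma> * (\<kappa> * A * B) * (C * C)"
    unfolding fW by simp
  have nzs: "A \<noteq> 0" "B \<noteq> 0" "C \<noteq> 0" using nz fW fV \<sigma> by auto
  define X where "X = \<kappa> * A * B"
  have Xn: "X \<noteq> 0" using nz(1) nzs by (simp add: X_def)
  have Cn: "C * C > 0" using nzs(3) not_real_square_gt_zero by blast
  have "orient_sign n (spm n v t) (spm n w s) = (if X > 0 then 1 else -1) * \<sigma>"
    using \<sigma>
  proof
    assume "\<sigma> = 1"
    then show ?thesis unfolding big prod X_def[symmetric]
      using Cn zero_less_mult_pos2[of X "C * C"] mult_pos_pos[of X "C * C"] by auto
  next
    assume "\<sigma> = -1"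
    then show ?thesis unfolding big prod X_def[symmetric]
      using Cn Xn zero_less_mult_pos2[of "- X" "C * C"] mult_pos_pos[of "- X" "C * C"] by auto
  qed
  then show ?thesis unfolding small X_def \<sigma>_def by (simp add: mult_ac)
qed

end



section \<open>Signs forced by the closure relation\<close>

text \<open>The six kinds without their sign relations, which still have to be derived from the
  closure relation.\<close>

definition rise_shape :: "(nat \<Rightarrow> nat) \<Rightarrow> (nat \<Rightarrow> nat) \<Rightarrow> nat \<Rightarrow> nat \<Rightarrow> bool" where
  "rise_shape v w i j \<longleftrightarrow>
     i < j \<and> v i = i \<and> v j = j \<and> w i = j \<and> w j = i \<or>
     i < j \<and> j < v j \<and> v i = i \<and> w i = v j \<and> w (v j) = i \<and> w j = j \<or>
     i < v i \<and> v i < j \<and> v j = j \<and> w i = j \<and> w j = i \<and> w (v i) = v i \<or>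
     i < j \<and> j < v i \<and> v i < v j \<and> w i = v j \<and> w j = v i \<and> w (v i) = j \<and> w (v j) = i \<or>
     i < v i \<and> v i < j \<and> j < v j \<and> w i = v j \<and> w (v j) = i \<and> w j = j \<and> w (v i) = v i \<or>
     i < v i \<and> v i < v j \<and> v j < j \<and> w i = v j \<and> w j = v i \<and> w (v i) = j \<and> w (v j) = i"

lemma suitable_rise_shape:
  assumes su: "suitable_rise n v i j" and vv: "v (v i) = i" "v (v j) = j" and w: "w = v \<circ> co i j v"
  shows "rise_shape v w i j" "x \<notin> {i, j, v i, v j} \<Longrightarrow> w x = v x"
proof -
  have ij: "i < j" "v i < v j" using su by (auto simp: suitable_rise_def free_rise_def)
  \<comment> \<open>For an \<open>ee\<close> rise \<open>v i = j\<close> is impossible, since then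
    \<open>v j = i < j\<close>.\<close>
  consider "v i = i" "v j = j" | "v i = i" "j < v j" | "i < v i" "v j = j"
    | "i < v i" "j < v j" "v i < j" | "i < v i" "j < v j" "j < v i" | "i < v i" "v j < j"
    using su vv ij unfolding suitable_rise_def type_d_def type_e_def type_f_def by (metis linorder_neqE_nat less_irrefl)
  then have "rise_shape v w i j \<and> (x \<notin> {i, j, v i, v j} \<longrightarrow> w x = v x)"
  proof cases
    case 1
    then have "co i j v = cycle_of_list [i, j]" by (simp add: co_def type_f_def)
    then show ?thesis using 1 ij vv w by (auto simp: rise_shape_def transpose_def)
  next
    case 2
    then have "co i j v = cycle_of_list [i, j, v j]" by (simp add: co_def type_f_def type_e_def)
    then show ?thesis using 2 ij vv w by (auto simp: rise_shape_def transpose_def)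
  next
    case 3
    then have "co i j v = cycle_of_list [i, j, v i]" by (simp add: co_def type_f_def type_e_def)
    then show ?thesis using 3 ij vv w by (auto simp: rise_shape_def transpose_def)
  next
    case 4
    then have "co i j v = cycle_of_list [i, j, v j, v i]" by (simp add: co_def type_f_def type_e_def)
    then show ?thesis using 4 ij vv w by (auto simp: rise_shape_def transpose_def)
  next
    case 5
    then have "co i j v = cycle_of_list [i, j] \<circ> cycle_of_list [v i, v j]" by (simp add: co_def type_f_def type_e_def)
    then show ?thesis using 5 ij vv w by (auto simp: rise_shape_def transpose_def)
  next
    case 6
    then have "co i j v = cycle_of_list [i, j] \<circ> cycle_of_list [v i, v j]" by (simp add: co_def type_f_def type_e_def)
    then show ?thesis using 6 ij vv w by (auto simp: rise_shape_def transpose_def)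
  qed
  then show "rise_shape v w i j" "x \<notin> {i, j, v i, v j} \<Longrightarrow> w x = v x" by auto
qed

text \<open>Counts the points of a graph to the left of \<open>c\<close> and above \<open>q\<close>.
  Replacing the corners \<open>(a, p)\<close> and \<open>(b, r)\<close> of a rectangle by the other
  two is noticed only from a point \<open>(c, q)\<close> inside it.\<close>

lemma of_bool_exchange:
  fixes a b c p q r :: nat
  assumes "a < b" "p < r" "\<not> (a < c \<and> c < b \<and> p < q \<and> q < r)" "c \<noteq> b" "q \<noteq> p"
  shows "of_bool (a < c \<and> q < p) + of_bool (b < c \<and> q < r) =
    (of_bool (a < c \<and> q < r) + of_bool (b < c \<and> q < p) :: nat)"
  using assms by (cases "a < c"; cases "b < c"; cases "q < p"; cases "q < r") auto

text \<open>The graph of \<open>w\<close> arises from that of \<open>v\<close> by exchanging corners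
  of rectangles contained in the rectangle of the rise or in its mirror image. Freeness keeps
  \<open>(c, v c)\<close> out of the former and, as \<open>v\<close> is an involution, also out of
  the latter.\<close>

lemma rise_shape_count:
  assumes sh: "rise_shape v w i j" and vv: "v (v i) = i" "v (v j) = j"
    and off: "\<And>x. x \<notin> {i, j, v i, v j} \<Longrightarrow> w x = v x"
    and free: "\<And>m. i < m \<Longrightarrow> m < j \<Longrightarrow> \<not> (v i < v m \<and> v m < v j)"
    and c: "c \<notin> {i, j, v i, v j}" "v (v c) = c"
  shows "card {x. x < c \<and> w c < v x} = card {x. x < c \<and> w c < w x}"
proof -
  let ?D = "{i, j, v i, v j}"
  define q where "q = v c"
  have wc: "w c = q" using off[OF c(1)] by (simp add: q_def)
  have vq: "v q = c" using c(2) by (simp add: q_def)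
  have qD: "q \<notin> ?D" using c vv vq by auto
  have f1: "\<not> (i < c \<and> c < j \<and> v i < q \<and> q < v j)" using free[of c] by (auto simp: q_def)
  have f2: "\<not> (i < q \<and> q < j \<and> v i < c \<and> c < v j)" using free[of q] vq by auto
  have split: "card {x. x < c \<and> q < u x} = card {x. x < c \<and> x \<notin> ?D \<and> q < u x} + (\<Sum>x\<in>?D. of_bool (x < c \<and> q < u x))" for u
  proof -
    have "{x. x < c \<and> q < u x} = {x. x < c \<and> x \<notin> ?D \<and> q < u x} \<union> {x \<in> ?D. x < c \<and> q < u x}" by blast
    moreover have "card ({x. x < c \<and> x \<notin> ?D \<and> q < u x} \<union> {x \<in> ?D. x < c \<and> q < u x}) =
        card {x. x < c \<and> x \<notin> ?D \<and> q < u x} + card {x \<in> ?D. x < c \<and> q < u x}"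
      by (rule card_Un_disjoint) auto
    moreover have "card {x \<in> ?D. x < c \<and> q < u x} = (\<Sum>x\<in>?D. of_bool (x < c \<and> q < u x))"
      by (subst sum_of_bool_eq) (simp_all add: Int_def)
    ultimately show ?thesis by simp
  qed
  have "{x. x < c \<and> x \<notin> ?D \<and> q < v x} = {x. x < c \<and> x \<notin> ?D \<and> q < w x}" using off by auto
  moreover have "(\<Sum>x\<in>?D. of_bool (x < c \<and> q < v x)) = (\<Sum>x\<in>?D. (of_bool (x < c \<and> q < w x) :: nat))"
  proof -
    define k l where kl: "k = v i" "l = v j"
    have ne: "c \<noteq> i" "c \<noteq> j" "c \<noteq> k" "c \<noteq> l" "q \<noteq> i" "q \<noteq> j" "q \<noteq> k" "q \<noteq> l" using c qD by (auto simp: kl)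
    have f1': False if "i < c" "c < j" "k < q" "q < l" using f1 that by (simp add: kl)
    have f2': False if "i < q" "q < j" "k < c" "c < l" using f2 that by (simp add: kl)
    have v: "v i = k" "v j = l" "v k = i" "v l = j" using vv by (simp_all add: kl)
    have "(\<Sum>x\<in>{i, j, k, l}. of_bool (x < c \<and> q < v x)) = (\<Sum>x\<in>{i, j, k, l}. (of_bool (x < c \<and> q < w x) :: nat))"
      using sh[unfolded rise_shape_def, folded kl]
    proof (elim disjE conjE)
      assume A: "i < j" "k = i" "l = j" "w i = j" "w j = i"
      have e0: "of_bool (i < c \<and> q < i) + of_bool (j < c \<and> q < j) = (of_bool (i < c \<and> q < j) + of_bool (j < c \<and> q < i) :: nat)"
        by (rule of_bool_exchange; (intro notI, elim conjE, rule f1')?; use A ne in linarith)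
      have "of_bool (i < c \<and> q < i) + of_bool (j < c \<and> q < j) = (of_bool (i < c \<and> q < j) + of_bool (j < c \<and> q < i) :: nat)"
        using e0 by linarith
      moreover have "{i, j, k, l} = {i, j}" using A by auto
      ultimately show ?thesis using A v by (simp add: add_ac del: of_bool_conj sum_of_bool_eq)
    next
      assume A: "i < j" "j < l" "k = i" "w i = l" "w l = i" "w j = j"
      have e0: "of_bool (i < c \<and> q < i) + of_bool (j < c \<and> q < l) = (of_bool (i < c \<and> q < l) + of_bool (j < c \<and> q < i) :: nat)"
        by (rule of_bool_exchange; (intro notI, elim conjE, rule f1')?; use A ne in linarith)
      have e1: "of_bool (j < c \<and> q < i) + of_bool (l < c \<and> q < j) = (of_bool (j < c \<and> q < j) + of_bool (l < c \<and> q < i) :: nat)"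
        by (rule of_bool_exchange; (intro notI, elim conjE, rule f2')?; use A ne in linarith)
      have "of_bool (i < c \<and> q < i) + of_bool (l < c \<and> q < j) + of_bool (j < c \<and> q < l) = (of_bool (i < c \<and> q < l) + of_bool (l < c \<and> q < i) + of_bool (j < c \<and> q < j) :: nat)"
        using e0 e1 by linarith
      moreover have "{i, j, k, l} = {i, l, j}" using A by auto
      ultimately show ?thesis using A v by (simp add: add_ac del: of_bool_conj sum_of_bool_eq)
    next
      assume A: "i < k" "k < j" "l = j" "w i = j" "w j = i" "w k = k"
      have e0: "of_bool (i < c \<and> q < k) + of_bool (j < c \<and> q < j) = (of_bool (i < c \<and> q < j) + of_bool (j < c \<and> q < k) :: nat)"
        by (rule of_bool_exchange; (intro notI, elim conjE, rule f1')?; use A ne in linarith)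
      have e1: "of_bool (k < c \<and> q < i) + of_bool (j < c \<and> q < k) = (of_bool (k < c \<and> q < k) + of_bool (j < c \<and> q < i) :: nat)"
        by (rule of_bool_exchange; (intro notI, elim conjE, rule f2')?; use A ne in linarith)
      have "of_bool (i < c \<and> q < k) + of_bool (j < c \<and> q < j) + of_bool (k < c \<and> q < i) = (of_bool (i < c \<and> q < j) + of_bool (j < c \<and> q < i) + of_bool (k < c \<and> q < k) :: nat)"
        using e0 e1 by linarith
      moreover have "{i, j, k, l} = {i, j, k}" using A by auto
      ultimately show ?thesis using A v by (simp add: add_ac del: of_bool_conj sum_of_bool_eq)
    next
      assume A: "i < j" "j < k" "k < l" "w i = l" "w j = k" "w k = j" "w l = i"
      have e0: "of_bool (i < c \<and> q < k) + of_bool (j < c \<and> q < l) = (of_bool (i < c \<and> q < l) + of_bool (j < c \<and> q < k) :: nat)"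
        by (rule of_bool_exchange; (intro notI, elim conjE, rule f1')?; use A ne in linarith)
      have e1: "of_bool (k < c \<and> q < i) + of_bool (l < c \<and> q < j) = (of_bool (k < c \<and> q < j) + of_bool (l < c \<and> q < i) :: nat)"
        by (rule of_bool_exchange; (intro notI, elim conjE, rule f2')?; use A ne in linarith)
      have "of_bool (i < c \<and> q < k) + of_bool (j < c \<and> q < l) + of_bool (k < c \<and> q < i) + of_bool (l < c \<and> q < j) = (of_bool (i < c \<and> q < l) + of_bool (j < c \<and> q < k) + of_bool (k < c \<and> q < j) + of_bool (l < c \<and> q < i) :: nat)"
        using e0 e1 by linarith
      moreover have "{i, j, k, l} = {i, j, k, l}" ..
      ultimately show ?thesis using A v by (simp add: add_ac del: of_bool_conj sum_of_bool_eq)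
    next
      assume A: "i < k" "k < j" "j < l" "w i = l" "w l = i" "w j = j" "w k = k"
      have e0: "of_bool (i < c \<and> q < k) + of_bool (j < c \<and> q < l) = (of_bool (i < c \<and> q < l) + of_bool (j < c \<and> q < k) :: nat)"
        by (rule of_bool_exchange; (intro notI, elim conjE, rule f1')?; use A ne in linarith)
      have e1: "of_bool (k < c \<and> q < i) + of_bool (l < c \<and> q < j) = (of_bool (k < c \<and> q < j) + of_bool (l < c \<and> q < i) :: nat)"
        by (rule of_bool_exchange; (intro notI, elim conjE, rule f2')?; use A ne in linarith)
      \<comment> \<open>In the crossing case a third exchange turns \<open>k\<close> and
        \<open>j\<close> into fixed points; its square lies inside the rectangle of the
        rise.\<close>
      have e2: "of_bool (k < c \<and> q < k) + of_bool (j < c \<and> q < j) = (of_bool (k < c \<and> q < j) + of_bool (j < c \<and> q < k) :: nat)"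
        by (rule of_bool_exchange; (intro notI, elim conjE, rule f1')?; use A ne in linarith)
      have "of_bool (i < c \<and> q < k) + of_bool (l < c \<and> q < j) + of_bool (j < c \<and> q < l) + of_bool (k < c \<and> q < i) = (of_bool (i < c \<and> q < l) + of_bool (l < c \<and> q < i) + of_bool (j < c \<and> q < j) + of_bool (k < c \<and> q < k) :: nat)"
        using e0 e1 e2 by linarith
      moreover have "{i, j, k, l} = {i, l, j, k}" by blast
      ultimately show ?thesis using A v by (simp add: add_ac del: of_bool_conj sum_of_bool_eq)
    next
      assume A: "i < k" "k < l" "l < j" "w i = l" "w j = k" "w k = j" "w l = i"
      have e0: "of_bool (i < c \<and> q < k) + of_bool (j < c \<and> q < l) = (of_bool (i < c \<and> q < l) + of_bool (j < c \<and> q < k) :: nat)"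
        by (rule of_bool_exchange; (intro notI, elim conjE, rule f1')?; use A ne in linarith)
      have e1: "of_bool (k < c \<and> q < i) + of_bool (l < c \<and> q < j) = (of_bool (k < c \<and> q < j) + of_bool (l < c \<and> q < i) :: nat)"
        by (rule of_bool_exchange; (intro notI, elim conjE, rule f2')?; use A ne in linarith)
      have "of_bool (i < c \<and> q < k) + of_bool (j < c \<and> q < l) + of_bool (k < c \<and> q < i) + of_bool (l < c \<and> q < j) = (of_bool (i < c \<and> q < l) + of_bool (j < c \<and> q < k) + of_bool (k < c \<and> q < j) + of_bool (l < c \<and> q < i) :: nat)"
        using e0 e1 by linarith
      then show ?thesis using A v by (simp add: add_ac del: of_bool_conj sum_of_bool_eq)
    qed
    then show ?thesis by (simp only: kl)
  qed
  ultimately show ?thesis unfolding wc split by simp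
qed

text \<open>\<open>limit_sign_agree\<close> fixes the signs off \<open>D\<close>. On
  \<open>D\<close> the trace, constant on the cell and continuous, gives the sign relation for
  \<open>fe\<close>, \<open>ef\<close> and crossing \<open>ee\<close>. Non-crossing
  \<open>ee\<close> and \<open>ed\<close> rises have no fixed points in \<open>D\<close>, so the
  trace says nothing; there, and for \<open>ff\<close>, the relation comes from
  \<open>limit_sign_swap\<close>.\<close>

lemma rise_configI:
  assumes V: "involution_data n v t" and W: "involution_data n w s"
    and su: "suitable_rise n v i j" and w: "w = v \<circ> co i j v"
    and cl: "spm n v t \<in> mat_closure n (cell n (spm n w s))"
  shows "rise_config n v t w s i j"
proof -
  note DV = involution_dataD[OF V] and DW = involution_dataD[OF W]
  have ij: "i < j" "j < n" "v i < v j" and free: "\<And>m. i < m \<Longrightarrow> m < j \<Longrightarrow> \<not> (v i < v m \<and> v m < v j)"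
    using su by (auto simp: suitable_rise_def free_rise_def)
  have i: "i < n" using ij by simp
  have vv: "v (v i) = i" "v (v j) = j" using DV(2) i ij by auto
  have sh: "rise_shape v w i j" and off: "\<And>x. x \<notin> {i, j, v i, v j} \<Longrightarrow> w x = v x"
    using suitable_rise_shape[OF su vv w] by auto
  obtain X where X: "\<And>m. X m \<in> cell n (spm n w s)"
    and lim: "\<And>r c. r < n \<Longrightarrow> c < n \<Longrightarrow> (\<lambda>m. X m $$ (r, c)) \<longlonglongrightarrow> spm n v t $$ (r, c)"
    using cl unfolding mat_closure_def by blast
  have dc: "X m \<in> double_coset n (spm n w s)" and oi: "X m \<in> orth_invol n (card (neg_set n w s))" for m
    using X[of m] by (auto simp: cell_eq invol_index_spm[OF W])
  have ev: "eventually (\<lambda>m. X m \<in> double_coset n (spm n w s)) sequentially" using dc by simp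
  have ev2: "eventually (\<lambda>m. X m \<in> double_coset n (spm n w s) \<and> X m \<in> orth_invol n (card (neg_set n w s))) sequentially"
    using dc oi by simp
  have sgn: "s x = t x" if "x < n" "x \<notin> {i, j, v i, v j}" for x
    using limit_sign_agree[OF V W sequentially_bot ev lim that(1)] off[OF that(2)]
      rise_shape_count[OF sh vv off free that(2) DV(2)[OF that(1)]] by simp
  have tr: "(\<Sum>r\<in>{i, j, v i, v j}. (if r = v r then t r else 0) - (if r = w r then s r else 0)) = 0"
  proof -
    have "(\<lambda>m. \<Sum>r<n. X m $$ (r, r)) \<longlonglongrightarrow> (\<Sum>r<n. spm n v t $$ (r, r))" by (intro tendsto_sum lim) auto
    moreover have "(\<Sum>r<n. X m $$ (r, r)) = mat_trace (spm n w s)" for m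
      using orth_involD(1,5)[OF oi[of m]] by (simp add: mat_trace_def[of "X m"] mat_trace_spm[OF W])
    ultimately have "(\<Sum>r<n. spm n v t $$ (r, r)) = mat_trace (spm n w s)"
      using LIMSEQ_unique[OF _ tendsto_const] by simp
    then have "(\<Sum>r<n. (if r = v r then t r else 0) - (if r = w r then s r else 0)) = 0"
      by (simp add: mat_trace_def sum_subtractf)
    moreover have "(\<Sum>r<n. (if r = v r then t r else 0) - (if r = w r then s r else 0)) =
        (\<Sum>r\<in>{i, j, v i, v j}. (if r = v r then t r else 0) - (if r = w r then s r else 0))"
      using off sgn i ij DV(1) by (intro sum.mono_neutral_right) auto
    ultimately show ?thesis by simp
  qed
  have swap: "t i * t j = - (s i * s j)" if k: "w j = v i" and l: "w i = v j"
    and c1: "{x. x < i \<and> v j < v x} = {x. x < i \<and> v j < w x}"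
    and c2: "{x. j < x \<and> x < n \<and> v x < v i} = {x. j < x \<and> x < n \<and> w x < v i}"
    by (rule limit_sign_swap[OF V W sequentially_bot ev2 lim ij(1,2) refl k refl l ij(3) free c1 c2])
  have kinds: "kind_ff v t w s i j \<or> kind_fe v t w s i j \<or> kind_ef v t w s i j \<or>
      kind_ee_noncrossing v t w s i j \<or> kind_ee_crossing v t w s i j \<or> kind_ed v t w s i j"
    using sh unfolding rise_shape_def
  proof (elim disjE conjE)
    assume A: "i < j" "v i = i" "v j = j" "w i = j" "w j = i"
    have *: "w x = v x" if "x < i \<or> j < x" for x using off[of x] A that by auto
    have "t i * t j = - (s i * s j)"
    proof (rule swap)
      show "{x. x < i \<and> v j < v x} = {x. x < i \<and> v j < w x}" by (rule Collect_cong) (metis *)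
      show "{x. j < x \<and> x < n \<and> v x < v i} = {x. j < x \<and> x < n \<and> w x < v i}" by (rule Collect_cong) (metis *)
    qed (use A in simp_all)
    moreover have "s j = s i" using DW(3)[OF i] A by simp
    ultimately have "t j = - t i" using DV(4)[OF i] DW(5)[OF i] by auto
    then show ?thesis using A by (simp add: kind_ff_def)
  next
    assume A: "i < j" "j < v j" "v i = i" "w i = v j" "w (v j) = i" "w j = j"
    have "s j = t i" using tr A vv by (auto simp: insert_absorb insert_commute)
    then show ?thesis using A by (simp add: kind_fe_def)
  next
    assume A: "i < v i" "v i < j" "v j = j" "w i = j" "w j = i" "w (v i) = v i"
    have "s (v i) = t j" using tr A vv by (auto simp: insert_absorb insert_commute)
    then show ?thesis using A by (simp add: kind_ef_def)
  next
    assume A: "i < j" "j < v i" "v i < v j" "w i = v j" "w j = v i" "w (v i) = j" "w (v j) = i"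
    have *: "w x = v x" if "x < i" for x using off[of x] A that by auto
    \<comment> \<open>To the right of \<open>j\<close> the two maps differ only at
      \<open>v i\<close> and \<open>v j\<close>, where both take the values \<open>i\<close> and
      \<open>j\<close>, all below \<open>v i\<close>.\<close>
    have **: "v x < v i \<longleftrightarrow> w x < v i" if "j < x" for x
    proof (cases "x \<in> {i, j, v i, v j}")
      case True
      then show ?thesis using A that vv by auto
    next
      case False
      then show ?thesis using off[of x] by simp
    qed
    have "t i * t j = - (s i * s j)"
    proof (rule swap)
      show "{x. x < i \<and> v j < v x} = {x. x < i \<and> v j < w x}" by (rule Collect_cong) (metis *)
      show "{x. j < x \<and> x < n \<and> v x < v i} = {x. j < x \<and> x < n \<and> w x < v i}" by (rule Collect_cong) (metis **)
    qed (use A in simp_all)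
    then show ?thesis using A by (simp add: kind_ee_noncrossing_def)
  next
    assume A: "i < v i" "v i < j" "j < v j" "w i = v j" "w (v j) = i" "w j = j" "w (v i) = v i"
    have "s (v i) = - s j" using tr A vv by (auto simp: insert_absorb insert_commute)
    then show ?thesis using A by (simp add: kind_ee_crossing_def)
  next
    assume A: "i < v i" "v i < v j" "v j < j" "w i = v j" "w j = v i" "w (v i) = j" "w (v j) = i"
    have *: "w x = v x" if "x < i \<or> j < x" for x using off[of x] A that by auto
    have "t i * t j = - (s i * s j)"
    proof (rule swap)
      show "{x. x < i \<and> v j < v x} = {x. x < i \<and> v j < w x}" by (rule Collect_cong) (metis *)
      show "{x. j < x \<and> x < n \<and> v x < v i} = {x. j < x \<and> x < n \<and> w x < v i}" by (rule Collect_cong) (metis *)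
    qed (use A in simp_all)
    then show ?thesis using A by (simp add: kind_ed_def)
  qed
  show ?thesis
    using V W i ij free off sgn kinds by unfold_locales auto
qed


theorem lemma4p15:
  fixes n i j :: nat and V W :: "real mat" and D :: "nat set"
  assumes "signed_involution n V"
    and "signed_involution n W"
    and "V \<in> mat_closure n (cell n W)"
    and "int (cell_dim n V) = int (cell_dim n W) - 1"
    and "associated_rise n V W i j"
    and "D = {i, j, underlying V i, underlying V j}"
  shows "orient_sign n V W =
           orient_sign (card D) (submatrix V D D) (submatrix W D D) *
           sign (shuffle_perm D (neg_indices n V)) *
           sign (shuffle_perm D (neg_indices n W))"
proof -
  define v w where "v = underlying V" and "w = underlying W"
  obtain t where V: "V = spm n v t" "involution_data n v t" "v permutes {..<n}"
    using signed_involution_data[OF assms(1)] unfolding v_def by blast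
  obtain s where W: "W = spm n w s" "involution_data n w s" "w permutes {..<n}"
    using signed_involution_data[OF assms(2)] unfolding w_def by blast
  have su: "suitable_rise n v i j" "w = v \<circ> co i j v"
    using assms(5) by (simp_all add: associated_rise_def v_def w_def)
  interpret c: rise_config n v t w s i j
    using assms(3) unfolding V(1) W(1) by (rule rise_configI[OF V(2) W(2) su])
  have D: "D = c.D" unfolding c.D_def unfolding v_def by (rule assms(6))
  show ?thesis
    unfolding D V(1) W(1) c.submatrix_restrict neg_indices_spm[OF V(2,3)] neg_indices_spm[OF W(2,3)]
    by (rule c.orient_sign_restrict[OF V(3) W(3)])
qed

end
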